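(* Let $f=0$ be a reduced singular plane curve germ at $0\in\mathbf C^2$ and let $\ell=0$ be a smooth curve germ at $0$ which is not a branch of $f=0$. Then for every invertible power series $u_1(x,y)\in\mathbf C\{x,y\}$ the initial Newton polynomials of the discriminants of the morphisms $(\ell,f)$ and $(\ell,u_1f)$ are equal up to rescaling variables.
   Context: Power series $H_1(u,v)$, $H_2(u,v)$ are equal up to rescaling variables if there exist nonzero constants $A,B,C$ such that $H_1(u,v)=C\,H_2(Au,Bv)$. Discriminant: for a morphism $(\ell,f):(\mathbf C^2,0)\to(\mathbf C^2,0)$ given by $u=\ell(x,y)$, $v=f(x,y)$, the polar curve is $\frac{\partial \ell}{\partial x}\frac{\partial f}{\partial y}-\frac{\partial \ell}{\partial y}\frac{\partial f}{\partial x}=0$, and its direct image $\mathcal D(u,v)=0$ (with multiplicities) under $(\ell,f)$ is the discriminant curve; the power series $\mathcal D(u,v)$, defined up to multiplication by an invertible power series, is the discriminant. Analytic changes of coordinates in the source do not change it. In coordinates with $\ell(x,y)=x$, put $p=\mathrm{ord}\, f(0,y)$ and write $\frac{\partial f}{\partial y}(x,y)=\tilde u(x,y)\prod_{j=1}^{p-1}[y-\gamma_j(x)]$ with $\tilde u$ a unit and $\gamma_j$ Puiseux series of positive order; then $\mathcal D(u,v)=\prod_{j=1}^{p-1}(v-f(u,\gamma_j(u)))$ up to a unit. For $g=\sum a_{ij}u^iv^j\neq 0$, the Newton diagram is the convex hull of $\{(i,j):a_{ij}\neq0\}+\mathbf R_{\ge0}^2$, and the initial Newton polynomial of $g$ is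 the sum of the terms $a_{ij}u^iv^j$ with $(i,j)$ on a compact edge of it. (Multiplying $g$ by a unit changes it only by a nonzero constant factor.) *)

theory Defs
  imports "HOL-Analysis.Analysis" "HOL-Computational_Algebra.Squarefree"
begin

section \<open>The ring of convergent power series in two variables\<close>

text \<open>
  A series in \<open>x\<close>, \<open>y\<close> is stored as a series in \<open>y\<close> whose coefficients are series in \<open>x\<close>:
  the coefficient of \<open>x\<^sup>i y\<^sup>j\<close> is \<open>fps_nth (fps_nth F j) i\<close>.
  Convergence means absolute convergence at some point \<open>(r, r)\<close> with \<open>r > 0\<close>.
\<close>

definition fps2_convergent :: "complex fps fps \<Rightarrow> bool" where
  "fps2_convergent F \<longleftrightarrow>
     (\<exists>r>0. (\<lambda>(i, j). norm (fps_nth (fps_nth F j) i) * r ^ i * r ^ j) summable_on UNIV)"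

lemma fps2_convergentI:
  assumes "\<And>i j. norm (fps_nth (fps_nth F j) i) \<le> C * R ^ (i + j)"
  shows "fps2_convergent F"
proof -
  define D where "D = max C 0"
  have D: "D \<ge> 0" by (simp add: D_def)
  have le: "norm (fps_nth (fps_nth F j) i) \<le> D * \<bar>R\<bar> ^ (i + j)" for i j
  proof -
    have "norm (fps_nth (fps_nth F j) i) \<le> C * R ^ (i + j)" by (rule assms)
    also have "\<dots> \<le> D * \<bar>R\<bar> ^ (i + j)"
    proof (cases "C \<ge> 0")
      case True
      then show ?thesis
        using abs_ge_self[of "R ^ (i + j)"] by (auto simp: D_def power_abs intro!: mult_left_mono)
    next
      case False
      have "0 \<le> C * R ^ (0 + 0)" by (rule order_trans[OF norm_ge_zero assms])
      then show ?thesis using False by simp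
    qed
    finally show ?thesis .
  qed
  define r where "r = 1 / (2 * (\<bar>R\<bar> + 1))"
  have r: "r > 0" by (simp add: r_def)
  have rR: "\<bar>R\<bar> * r \<le> 1 / 2" by (simp add: r_def divide_simps)
  have "((\<lambda>i::nat. (1 / 2 :: real) ^ i) has_sum 2) UNIV"
    using geometric_sums[of "1 / 2 :: real"] by (intro norm_summable_imp_has_sum) auto
  note geo = this
  have "(\<lambda>(i::nat, j::nat). (1 / 2 :: real) ^ i * (1 / 2) ^ j) summable_on UNIV \<times> UNIV"
    by (rule summable_on_SigmaI[where g = "\<lambda>i. (1 / 2) ^ i * 2"])
       (use geo in \<open>auto intro!: has_sum_cmult_right summable_on_cmult_left intro: has_sum_imp_summable\<close>)
  then have "(\<lambda>(i::nat, j::nat). (1 / 2 :: real) ^ i * (1 / 2) ^ j) summable_on UNIV"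
    by simp
  then have "(\<lambda>p::nat \<times> nat. D * (case p of (i, j) \<Rightarrow> (1 / 2) ^ i * (1 / 2) ^ j)) summable_on UNIV"
    by (rule summable_on_cmult_right)
  then have "(\<lambda>(i, j). norm (fps_nth (fps_nth F j) i) * r ^ i * r ^ j) summable_on UNIV"
  proof (rule summable_on_comparison_test)
    fix p :: "nat \<times> nat"
    obtain i j where p: "p = (i, j)" by force
    have "norm (fps_nth (fps_nth F j) i) * r ^ (i + j) \<le> D * \<bar>R\<bar> ^ (i + j) * r ^ (i + j)"
      using r by (intro mult_right_mono le) auto
    also have "\<dots> = D * (\<bar>R\<bar> * r) ^ (i + j)" by (simp add: power_mult_distrib)
    also have "\<dots> \<le> D * (1 / 2) ^ (i + j)"
      using rR D r by (intro mult_left_mono power_mono) auto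
    finally show "(case p of (i, j) \<Rightarrow> norm (fps_nth (fps_nth F j) i) * r ^ i * r ^ j)
        \<le> D * (case p of (i, j) \<Rightarrow> (1 / 2) ^ i * (1 / 2) ^ j)"
      by (simp add: p power_add mult_ac)
    show "0 \<le> (case p of (i, j) \<Rightarrow> norm (fps_nth (fps_nth F j) i) * r ^ i * r ^ j)"
      using r by (simp add: p)
  qed
  then show ?thesis using r unfolding fps2_convergent_def by blast
qed

lemma fps2_convergentE:
  assumes "fps2_convergent F"
  obtains C R where "C \<ge> 0" "R \<ge> 1" "\<And>i j. norm (fps_nth (fps_nth F j) i) \<le> C * R ^ (i + j)"
proof -
  from assms obtain r where r: "r > 0"
    and s: "(\<lambda>(i, j). norm (fps_nth (fps_nth F j) i) * r ^ i * r ^ j) summable_on UNIV"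
    unfolding fps2_convergent_def by blast
  let ?g = "\<lambda>(i, j). norm (fps_nth (fps_nth F j) i) * r ^ i * r ^ j"
  define C where "C = infsum ?g UNIV"
  have nn: "?g p \<ge> 0" for p using r by (cases p) simp
  have C: "?g p \<le> C" for p
  proof -
    have "infsum ?g {p} \<le> infsum ?g UNIV"
      by (rule infsum_mono_neutral) (use s nn in auto)
    then show ?thesis by (simp add: C_def)
  qed
  have C0: "C \<ge> 0" using nn C order_trans by blast
  define R where "R = max 1 (1 / r)"
  have "norm (fps_nth (fps_nth F j) i) \<le> C * R ^ (i + j)" for i j
  proof -
    have "norm (fps_nth (fps_nth F j) i) * r ^ (i + j) \<le> C"
      using C[of "(i, j)"] by (simp add: power_add mult_ac)
    then have "norm (fps_nth (fps_nth F j) i) \<le> C * (1 / r) ^ (i + j)"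
      using r by (simp add: power_one_over field_simps)
    also have "\<dots> \<le> C * R ^ (i + j)"
      using C0 r by (intro mult_left_mono power_mono) (auto simp: R_def)
    finally show ?thesis .
  qed
  then show ?thesis using C0 by (intro that[of C R]) (auto simp: R_def)
qed

lemma fps2_convergent_0: "fps2_convergent 0"
  by (rule fps2_convergentI[of _ 0 1]) simp

lemma fps2_convergent_1: "fps2_convergent 1"
  by (rule fps2_convergentI[of _ 1 1]) auto

lemma fps2_convergent_uminus: "fps2_convergent F \<Longrightarrow> fps2_convergent (- F)"
  unfolding fps2_convergent_def by simp

lemma fps2_convergent_add:
  assumes "fps2_convergent F" "fps2_convergent G"
  shows "fps2_convergent (F + G)"
proof -
  obtain C R where F: "C \<ge> 0" "R \<ge> 1" "\<And>i j. norm (fps_nth (fps_nth F j) i) \<le> C * R ^ (i + j)"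
    using fps2_convergentE[OF assms(1)] by blast
  obtain D S where G: "D \<ge> 0" "S \<ge> 1" "\<And>i j. norm (fps_nth (fps_nth G j) i) \<le> D * S ^ (i + j)"
    using fps2_convergentE[OF assms(2)] by blast
  show ?thesis
  proof (rule fps2_convergentI)
    fix i j
    have "norm (fps_nth (fps_nth (F + G) j) i)
        \<le> norm (fps_nth (fps_nth F j) i) + norm (fps_nth (fps_nth G j) i)"
      by (simp add: norm_triangle_ineq)
    also have "\<dots> \<le> C * R ^ (i + j) + D * S ^ (i + j)" by (intro add_mono F G)
    also have "\<dots> \<le> C * (max R S) ^ (i + j) + D * (max R S) ^ (i + j)"
      using F(1,2) G(1,2) by (intro add_mono mult_left_mono power_mono) auto
    finally show "norm (fps_nth (fps_nth (F + G) j) i) \<le> (C + D) * (max R S) ^ (i + j)"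
      by (simp add: algebra_simps)
  qed
qed

lemma fps2_convergent_diff:
  "fps2_convergent F \<Longrightarrow> fps2_convergent G \<Longrightarrow> fps2_convergent (F - G)"
  using fps2_convergent_add[of F "- G"] fps2_convergent_uminus[of G] by simp

lemma Suc_le_two_power: "real (n + 1) \<le> 2 ^ n"
  by (induction n) auto

lemma fps2_convergent_mult:
  assumes "fps2_convergent F" "fps2_convergent G"
  shows "fps2_convergent (F * G)"
proof -
  obtain C R where F: "C \<ge> 0" "R \<ge> 1" "\<And>i j. norm (fps_nth (fps_nth F j) i) \<le> C * R ^ (i + j)"
    using fps2_convergentE[OF assms(1)] by blast
  obtain D S where G: "D \<ge> 0" "S \<ge> 1" "\<And>i j. norm (fps_nth (fps_nth G j) i) \<le> D * S ^ (i + j)"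
    using fps2_convergentE[OF assms(2)] by blast
  define T where "T = max R S"
  have T: "T \<ge> 1" using F(2) by (auto simp: T_def)
  have F': "norm (fps_nth (fps_nth F j) i) \<le> C * T ^ (i + j)" for i j
  proof (rule order_trans[OF F(3)])
    show "C * R ^ (i + j) \<le> C * T ^ (i + j)"
      using F(1,2) by (intro mult_left_mono power_mono) (auto simp: T_def)
  qed
  have G': "norm (fps_nth (fps_nth G j) i) \<le> D * T ^ (i + j)" for i j
  proof (rule order_trans[OF G(3)])
    show "D * S ^ (i + j) \<le> D * T ^ (i + j)"
      using G(1,2) by (intro mult_left_mono power_mono) (auto simp: T_def)
  qed
  show ?thesis
  proof (rule fps2_convergentI)
    fix i j
    have "norm (fps_nth (fps_nth (F * G) j) i) =
        norm (\<Sum>l=0..j. \<Sum>k=0..i. fps_nth (fps_nth F l) k * fps_nth (fps_nth G (j - l)) (i - k))"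
      by (simp add: fps_mult_nth fps_sum_nth)
    also have "\<dots> \<le> (\<Sum>l=0..j. \<Sum>k=0..i. C * D * T ^ (i + j))"
    proof (intro sum_norm_le)
      fix l k assume lk: "l \<in> {0..j}" "k \<in> {0..i}"
      have "norm (fps_nth (fps_nth F l) k * fps_nth (fps_nth G (j - l)) (i - k))
          \<le> (C * T ^ (k + l)) * (D * T ^ ((i - k) + (j - l)))"
        unfolding norm_mult using F(1) T by (intro mult_mono F' G') auto
      also have "\<dots> = C * D * T ^ ((k + l) + ((i - k) + (j - l)))"
        by (simp add: power_add mult_ac)
      also have "(k + l) + ((i - k) + (j - l)) = i + j" using lk by auto
      finally show "norm (fps_nth (fps_nth F l) k * fps_nth (fps_nth G (j - l)) (i - k))
          \<le> C * D * T ^ (i + j)" .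
    qed
    also have "\<dots> = (C * D * T ^ (i + j)) * (real (j + 1) * real (i + 1))"
      by simp
    also have "\<dots> \<le> (C * D * T ^ (i + j)) * (2 ^ j * 2 ^ i)"
      using F(1) G(1) T by (intro mult_left_mono mult_mono Suc_le_two_power) auto
    also have "\<dots> = C * D * (2 * T) ^ (i + j)"
      by (simp add: power_mult_distrib power_add)
    finally show "norm (fps_nth (fps_nth (F * G) j) i) \<le> C * D * (2 * T) ^ (i + j)" .
  qed
qed

lemma fps2_convergent_deriv_aux:
  assumes "fps2_convergent F"
    and "\<And>i j. norm (fps_nth (fps_nth G j) i) \<le> real (i + j + 1) * norm (fps_nth (fps_nth F (j + b)) (i + a))"
  shows "fps2_convergent G"
proof -
  obtain C R where F: "C \<ge> 0" "R \<ge> 1" "\<And>i j. norm (fps_nth (fps_nth F j) i) \<le> C * R ^ (i + j)"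
    using fps2_convergentE[OF assms(1)] by blast
  show ?thesis
  proof (rule fps2_convergentI)
    fix i j
    have "norm (fps_nth (fps_nth G j) i) \<le> real (i + j + 1) * (C * R ^ ((i + a) + (j + b)))"
      by (rule order_trans[OF assms(2)]) (intro mult_left_mono F(3); simp)
    also have "\<dots> \<le> 2 ^ (i + j) * (C * R ^ ((i + a) + (j + b)))"
      using F(1,2) Suc_le_two_power[of "i + j"] by (intro mult_right_mono) auto
    finally show "norm (fps_nth (fps_nth G j) i) \<le> (C * R ^ (a + b)) * (2 * R) ^ (i + j)"
      by (simp add: power_add power_mult_distrib mult_ac)
  qed
qed

typedef cps2 = "{F. fps2_convergent F}"
  morphisms fps2_of Abs_cps2
  using fps2_convergent_0 by blast

setup_lifting type_definition_cps2

instantiation cps2 :: idom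
begin
lift_definition zero_cps2 :: cps2 is 0 by (rule fps2_convergent_0)
lift_definition one_cps2 :: cps2 is 1 by (rule fps2_convergent_1)
lift_definition plus_cps2 :: "cps2 \<Rightarrow> cps2 \<Rightarrow> cps2" is "(+)" by (rule fps2_convergent_add)
lift_definition minus_cps2 :: "cps2 \<Rightarrow> cps2 \<Rightarrow> cps2" is "(-)" by (rule fps2_convergent_diff)
lift_definition uminus_cps2 :: "cps2 \<Rightarrow> cps2" is uminus by (rule fps2_convergent_uminus)
lift_definition times_cps2 :: "cps2 \<Rightarrow> cps2 \<Rightarrow> cps2" is "(*)" by (rule fps2_convergent_mult)
instance
  by standard (transfer; simp add: algebra_simps)+
end

definition coeff2 :: "cps2 \<Rightarrow> nat \<Rightarrow> nat \<Rightarrow> complex" where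
  "coeff2 F i j = fps_nth (fps_nth (fps2_of F) j) i"

lift_definition deriv_x :: "cps2 \<Rightarrow> cps2" is "\<lambda>F. Abs_fps (\<lambda>j. fps_deriv (fps_nth F j))"
  by (erule fps2_convergent_deriv_aux[where a = 1 and b = 0])
     (auto simp: norm_mult simp flip: of_nat_Suc intro!: mult_right_mono)

lift_definition deriv_y :: "cps2 \<Rightarrow> cps2" is fps_deriv
  by (erule fps2_convergent_deriv_aux[where a = 0 and b = 1])
     (auto simp: norm_mult fps_of_nat[symmetric] simp flip: of_nat_Suc intro!: mult_right_mono)

text \<open>
  \<open>F(a(t), b(t))\<close>, meaningful only if \<open>a\<close> and \<open>b\<close> have zero constant term: then \<open>a\<^sup>i b\<^sup>j\<close> has
  order at least \<open>i + j\<close>, so only the terms with \<open>i, j \<le> n\<close> contribute to \<open>t\<^sup>n\<close>.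
\<close>
definition subst2 :: "cps2 \<Rightarrow> complex fps \<Rightarrow> complex fps \<Rightarrow> complex fps" where
  "subst2 F a b = Abs_fps (\<lambda>n. \<Sum>i\<le>n. \<Sum>j\<le>n. coeff2 F i j * fps_nth (a ^ i * b ^ j) n)"


section \<open>Plane curve germs\<close>

definition singular_germ :: "cps2 \<Rightarrow> bool" where
  "singular_germ f \<longleftrightarrow> coeff2 f 0 0 = 0 \<and> coeff2 f 1 0 = 0 \<and> coeff2 f 0 1 = 0"

definition smooth_germ :: "cps2 \<Rightarrow> bool" where
  "smooth_germ l \<longleftrightarrow> coeff2 l 0 0 = 0 \<and> (coeff2 l 1 0 \<noteq> 0 \<or> coeff2 l 0 1 \<noteq> 0)"

definition branch_of :: "cps2 \<Rightarrow> cps2 \<Rightarrow> bool" where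
  "branch_of h f \<longleftrightarrow> irreducible h \<and> h dvd f"

text \<open>
  \<open>t \<mapsto> (a(t), b(t))\<close> is a primitive (i.e. generically one-to-one) parametrization of the branch
  \<open>h = 0\<close>, for irreducible \<open>h\<close>.
\<close>
definition primitive_param :: "complex fps \<Rightarrow> complex fps \<Rightarrow> cps2 \<Rightarrow> bool" where
  "primitive_param a b h \<longleftrightarrow>
     fps_conv_radius a > 0 \<and> fps_conv_radius b > 0 \<and> fps_nth a 0 = 0 \<and> fps_nth b 0 = 0 \<and>
     (\<exists>\<epsilon>>0. ereal \<epsilon> \<le> fps_conv_radius a \<and> ereal \<epsilon> \<le> fps_conv_radius b \<and>
        inj_on (\<lambda>t. (eval_fps a t, eval_fps b t)) (ball 0 \<epsilon>)) \<and>
     subst2 h a b = 0"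


section \<open>Direct image and discriminant\<close>

text \<open>
  The morphism \<open>(l, f)\<close> maps the branch \<open>p = 0\<close> onto the branch \<open>q = 0\<close> with degree \<open>k\<close>: in terms of
  primitive parametrizations \<open>(a, b)\<close> of the source and \<open>(c, d)\<close> of the target, the induced map of
  normalizations is \<open>t \<mapsto> s(t)\<close>, whose degree is the order of \<open>s\<close>.
\<close>
definition maps_branch :: "cps2 \<Rightarrow> cps2 \<Rightarrow> cps2 \<Rightarrow> cps2 \<Rightarrow> nat \<Rightarrow> bool" where
  "maps_branch l f p q k \<longleftrightarrow> irreducible p \<and> irreducible q \<and>
     (\<exists>a b c d s. primitive_param a b p \<and> primitive_param c d q \<and>
        fps_conv_radius s > 0 \<and> s \<noteq> 0 \<and> fps_nth s 0 = 0 \<and> subdegree s = k \<and>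
        subst2 l a b = fps_compose c s \<and> subst2 f a b = fps_compose d s)"

text \<open>
  \<open>D = 0\<close> is the direct image, with multiplicities, of the curve \<open>h = 0\<close> under \<open>(l, f)\<close>. Here \<open>h\<close> is
  factored into irreducible factors \<open>p\<close>, listed with multiplicity, and each contributes \<open>q ^ k\<close>.
\<close>
definition direct_image :: "cps2 \<Rightarrow> cps2 \<Rightarrow> cps2 \<Rightarrow> cps2 \<Rightarrow> bool" where
  "direct_image l f h D \<longleftrightarrow>
     (\<exists>(bs :: (cps2 \<times> cps2 \<times> nat) list) e e'.
        e dvd 1 \<and> e' dvd 1 \<and>
        (\<forall>(p, q, k) \<in> set bs. maps_branch l f p q k) \<and>
        h = e * (\<Prod>(p, q, k)\<leftarrow>bs. p) \<and>
        D = e' * (\<Prod>(p, q, k)\<leftarrow>bs. q ^ k))"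

definition polar :: "cps2 \<Rightarrow> cps2 \<Rightarrow> cps2" where
  "polar l f = deriv_x l * deriv_y f - deriv_y l * deriv_x f"

text \<open>A relation rather than a function, as \<open>D\<close> is determined only up to a unit.\<close>
definition is_discriminant :: "cps2 \<Rightarrow> cps2 \<Rightarrow> cps2 \<Rightarrow> bool" where
  "is_discriminant l f D \<longleftrightarrow> direct_image l f (polar l f) D"


section \<open>Newton diagrams\<close>

definition newton_diagram :: "cps2 \<Rightarrow> (real \<times> real) set" where
  "newton_diagram g =
     convex hull {(real i + s, real j + t) | i j s t. coeff2 g i j \<noteq> 0 \<and> 0 \<le> s \<and> 0 \<le> t}"

definition on_compact_edge :: "cps2 \<Rightarrow> nat \<Rightarrow> nat \<Rightarrow> bool" where
  "on_compact_edge g i j \<longleftrightarrow>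
     (\<exists>e. e edge_of newton_diagram g \<and> compact e \<and> (real i, real j) \<in> e)"

lift_definition restrict_supp :: "(nat \<Rightarrow> nat \<Rightarrow> bool) \<Rightarrow> cps2 \<Rightarrow> cps2" is
  "\<lambda>P F. Abs_fps (\<lambda>j. Abs_fps (\<lambda>i. if P i j then fps_nth (fps_nth F j) i else 0))"
  by (erule fps2_convergent_deriv_aux[where a = 0 and b = 0])
     (auto simp: mult_le_cancel_right1)

definition initial_newton_polynomial :: "cps2 \<Rightarrow> cps2" where
  "initial_newton_polynomial g = restrict_supp (on_compact_edge g) g"

text \<open>\<open>H1(u,v) = C H2(A u, B v)\<close>, written coefficientwise.\<close>
definition equal_up_to_rescaling :: "cps2 \<Rightarrow> cps2 \<Rightarrow> bool" where
  "equal_up_to_rescaling H1 H2 \<longleftrightarrow>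
     (\<exists>A B C. A \<noteq> 0 \<and> B \<noteq> 0 \<and> C \<noteq> 0 \<and>
        (\<forall>i j. coeff2 H1 i j = C * (coeff2 H2 i j * A ^ i * B ^ j)))"

end

theory Submission
  imports Defs "HOL-Complex_Analysis.Complex_Analysis"
begin

text \<open>
  Choose formal coordinates \<open>(x, y)\<close> with \<open>l = x\<close>. After a base change \<open>x \<mapsto> x\<^sup>M\<close> the polar curves of
  \<open>f\<close> and of \<open>u f\<close> both split into factors \<open>y - \<gamma>(x)\<close>, and the discriminants split into the factors
  \<open>v - f(x, \<gamma>(x))\<close>. So the initial Newton polynomial of the discriminant only depends on the multiset
  of leading terms of the critical values \<open>f(x, \<gamma>(x))\<close>, and it suffices to show that passing from \<open>f\<close>
  to \<open>u f\<close> multiplies each leading coefficient by \<open>u(0, 0)\<close>.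

  Let \<open>\<phi>\<close> be a critical point and \<open>h\<close> the slope of the first edge of the Newton polygon of
  \<open>f(x, \<phi> + y)\<close>, so that \<open>f(x, \<phi> + z x\<^sup>h) = P(z) x\<^sup>\<theta> + \<dots>\<close> with \<open>P\<close> not constant. Comparing with
  \<open>\<partial>f/\<partial>y\<close> shows that the critical points \<open>\<phi> + z x\<^sup>h + \<dots>\<close> correspond to the roots \<open>z\<close> of \<open>P'\<close>, and their
  critical values start with \<open>P(z) x\<^sup>\<theta>\<close>. For \<open>u f\<close> the polynomial \<open>P\<close> is replaced by \<open>u(0, 0) P\<close>,
  which has the same critical points. Partitioning the critical points by such balls gives the claim.

  Irreducibility in the ring of convergent series enters only in showing that an irreducible \<open>p\<close>
  generates the kernel of evaluation along a primitive parametrization of \<open>p = 0\<close>.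
\<close>

section \<open>Formal power series in two variables\<close>

text \<open>Coordinates and linear factors are treated formally, since evaluation, divisibility and
  Newton polygons only need coefficients. Convergence is still required at one point: the
  factorizations defining a direct image live in the convergent ring, so the formal generator of the
  kernel along a parametrization must be shown convergent before irreducibility applies. It is a
  product of conjugate linear factors descended from x^n to x; it and quotients by it inherit
  convergence. The exponent in \<open>q ^ k\<close> is matched by counting conjugates: a branch with
  k N conjugates is sent to one with N, each hit k times. That l is not a branch of f keeps l
  nonzero on polar branches, so that they can be written x = t^n; squarefreeness keeps the critical
  values nonzero, so that leading terms exist. The critical points of f and of its unit multiple
  differ in general, and no bijection between them is at hand; only their multisets of centres in
  each ball can be compared. In the final rescaling A = 1 and B is the value of u1 at the
  origin.\<close>

type_synonym fps2 = "complex fps fps"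

definition c2 :: "fps2 \<Rightarrow> nat \<Rightarrow> nat \<Rightarrow> complex" where
  "c2 F i j = fps_nth (fps_nth F j) i"

definition const2 :: "complex \<Rightarrow> fps2" where "const2 c = fps_const (fps_const c)"
definition XX :: fps2 where "XX = fps_const fps_X"
definition YY :: fps2 where "YY = fps_X"

lemma c2_0 [simp]: "c2 0 i j = 0"
  and c2_1: "c2 1 i j = (if i = 0 \<and> j = 0 then 1 else 0)"
  and c2_add [simp]: "c2 (F + G) i j = c2 F i j + c2 G i j"
  and c2_diff [simp]: "c2 (F - G) i j = c2 F i j - c2 G i j"
  and c2_uminus [simp]: "c2 (- F) i j = - c2 F i j"
  and c2_sum: "c2 (\<Sum>s\<in>S. f s) i j = (\<Sum>s\<in>S. c2 (f s) i j)"
  and c2_const_series: "c2 (fps_const a) i j = (if j = 0 then fps_nth a i else 0)"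
  and c2_const2: "c2 (const2 c) i j = (if i = 0 \<and> j = 0 then c else 0)"
  by (auto simp: c2_def fps_sum_nth const2_def)

lemma c2_eqI: "(\<And>i j. c2 F i j = c2 G i j) \<Longrightarrow> F = G"
  by (simp add: fps_eq_iff c2_def)

lemma c2_mult:
  "c2 (F * G) i j = (\<Sum>l\<le>j. \<Sum>k\<le>i. c2 F k l * c2 G (i - k) (j - l))"
  by (simp add: c2_def fps_mult_nth fps_sum_nth atLeast0AtMost)

lemma c2_mult_00 [simp]: "c2 (F * G) 0 0 = c2 F 0 0 * c2 G 0 0"
  by (simp add: c2_mult)

lemma c2_monom: "c2 (const2 c * XX ^ k * YY ^ l) i j = (if i = k \<and> j = l then c else 0)"
proof -
  have "const2 c * XX ^ k = fps_const (fps_const c * fps_X ^ k)"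
    by (simp add: const2_def XX_def fps_const_power)
  then show ?thesis
    by (auto simp: c2_def YY_def fps_X_power_mult_right_nth)
qed

lemma c2_XX: "c2 XX i j = (if i = 1 \<and> j = 0 then 1 else 0)"
  using c2_monom[of 1 1 0 i j] by (simp add: const2_def)

lemma c2_YY: "c2 YY i j = (if i = 0 \<and> j = 1 then 1 else 0)"
  using c2_monom[of 1 0 1 i j] by (simp add: const2_def)

text \<open>The (x, y)-adic filtration, which serves as the topology: equality is tested modulo
  every order, and limits are built by stabilizing coefficients.\<close>

definition ordge :: "nat \<Rightarrow> fps2 \<Rightarrow> bool" where
  "ordge n F \<longleftrightarrow> (\<forall>i j. i + j < n \<longrightarrow> c2 F i j = 0)"

lemma ordge_0 [simp]: "ordge n 0" "ordge 0 F" by (auto simp: ordge_def)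

lemma ordge_add: "ordge n F \<Longrightarrow> ordge n G \<Longrightarrow> ordge n (F + G)"
  and ordge_diff: "ordge n F \<Longrightarrow> ordge n G \<Longrightarrow> ordge n (F - G)"
  and ordge_uminus: "ordge n F \<Longrightarrow> ordge n (- F)"
  and ordge_mono: "ordge n F \<Longrightarrow> m \<le> n \<Longrightarrow> ordge m F"
  by (auto simp: ordge_def)

definition nonunit2 :: "fps2 \<Rightarrow> bool" where "nonunit2 F \<longleftrightarrow> c2 F 0 0 = 0"

lemma nonunit2_ordge: "nonunit2 F \<longleftrightarrow> ordge (Suc 0) F"
  by (auto simp: ordge_def nonunit2_def)

lemma ordge_mult:
  assumes "ordge m F" "ordge n G"
  shows "ordge (m + n) (F * G)"
  unfolding ordge_def
proof (intro allI impI)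
  fix i j :: nat assume ij: "i + j < m + n"
  show "c2 (F * G) i j = 0"
    unfolding c2_mult
  proof (intro sum.neutral ballI)
    fix l k assume "l \<in> {..j}" "k \<in> {..i}"
    with ij have "k + l < m \<or> (i - k) + (j - l) < n" by auto
    then show "c2 F k l * c2 G (i - k) (j - l) = 0"
      using assms by (auto simp: ordge_def)
  qed
qed

lemma ordge_multL: "ordge n F \<Longrightarrow> ordge n (F * G)"
  and ordge_multR: "ordge n G \<Longrightarrow> ordge n (F * G)"
  using ordge_mult[of n F 0 G] ordge_mult[of 0 F n G] by auto

lemma ordge_power: "nonunit2 F \<Longrightarrow> ordge n (F ^ n)"
  by (induction n) (auto simp: nonunit2_ordge dest: ordge_mult[of "Suc 0" F])

lemma ordge_power_mult: "nonunit2 a \<Longrightarrow> nonunit2 b \<Longrightarrow> ordge (k + l) (a ^ k * b ^ l)"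
  by (intro ordge_mult ordge_power)

lemma ordge_eqI: "(\<And>n. ordge n (F - G)) \<Longrightarrow> F = G"
  unfolding ordge_def by (intro c2_eqI) (metis c2_diff eq_iff_diff_eq_0 less_Suc_eq)

lemma truncation2:
  "ordge n (F - (\<Sum>k<n. \<Sum>l<n. const2 (c2 F k l) * XX ^ k * YY ^ l))"
  unfolding ordge_def
proof (intro allI impI)
  fix i j assume ij: "i + j < n"
  have "(\<Sum>k<n. \<Sum>l<n. c2 (const2 (c2 F k l) * XX ^ k * YY ^ l) i j)
      = (\<Sum>k<n. \<Sum>l<n. if l = j then (if k = i then c2 F k l else 0) else 0)"
    by (intro sum.cong) (auto simp: c2_monom)
  also have "\<dots> = c2 F i j" using ij by (simp add: sum.delta')
  finally show "c2 (F - (\<Sum>k<n. \<Sum>l<n. const2 (c2 F k l) * XX ^ k * YY ^ l)) i j = 0"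
    by (simp add: c2_sum)
qed

text \<open>Polynomials are dense, so continuous additive maps are determined by their values on monomials.\<close>
lemma additive_eqI:
  fixes \<phi> \<psi> :: "fps2 \<Rightarrow> fps2"
  assumes add: "\<And>F G. \<phi> (F + G) = \<phi> F + \<phi> G" "\<And>F G. \<psi> (F + G) = \<psi> F + \<psi> G"
    and cont: "\<And>n F. ordge (n + d) F \<Longrightarrow> ordge n (\<phi> F)" "\<And>n F. ordge (n + d) F \<Longrightarrow> ordge n (\<psi> F)"
    and monom: "\<And>c k l. \<phi> (const2 c * XX ^ k * YY ^ l) = \<psi> (const2 c * XX ^ k * YY ^ l)"
  shows "\<phi> F = \<psi> F"
proof (rule ordge_eqI)
  fix n
  have zero: "\<phi> 0 = 0" "\<psi> 0 = 0" using add(1)[of 0 0] add(2)[of 0 0] by auto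
  have sum: "\<phi> (sum f A) = (\<Sum>a\<in>A. \<phi> (f a))" "\<psi> (sum f A) = (\<Sum>a\<in>A. \<psi> (f a))"
    for f and A :: "nat set"
    by (induction A rule: infinite_finite_induct; simp add: add zero)+
  define S where "S = (\<Sum>k<n+d. \<Sum>l<n+d. const2 (c2 F k l) * XX ^ k * YY ^ l)"
  have R: "ordge (n + d) (F - S)" unfolding S_def by (rule truncation2)
  have "\<phi> F = \<phi> S + \<phi> (F - S)" "\<psi> F = \<psi> S + \<psi> (F - S)"
    using add(1)[of S "F - S"] add(2)[of S "F - S"] by auto
  moreover have "\<phi> S = \<psi> S" unfolding S_def by (simp add: sum monom)
  ultimately have "\<phi> F - \<psi> F = \<phi> (F - S) - \<psi> (F - S)" by simp
  then show "ordge n (\<phi> F - \<psi> F)" by (simp add: ordge_diff cont R)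
qed

subsection \<open>Substitution\<close>

text \<open>
  \<open>F(a, b)\<close> for \<open>a\<close>, \<open>b\<close> without constant term. The coefficient of \<open>x\<^sup>i y\<^sup>j\<close> only involves
  \<open>a\<^sup>k b\<^sup>l\<close> with \<open>k + l \<le> i + j\<close>.
\<close>
definition subst :: "fps2 \<Rightarrow> fps2 \<Rightarrow> fps2 \<Rightarrow> fps2" where
  "subst F a b = Abs_fps (\<lambda>j. Abs_fps (\<lambda>i.
     \<Sum>k\<le>i + j. \<Sum>l\<le>i + j. c2 F k l * c2 (a ^ k * b ^ l) i j))"

lemma c2_subst: "c2 (subst F a b) i j = (\<Sum>k\<le>i + j. \<Sum>l\<le>i + j. c2 F k l * c2 (a ^ k * b ^ l) i j)"
  by (simp add: subst_def c2_def)

lemma subst_add: "subst (F + G) a b = subst F a b + subst G a b"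
  and subst_diff: "subst (F - G) a b = subst F a b - subst G a b"
  and subst_uminus: "subst (- F) a b = - subst F a b"
  and subst_0 [simp]: "subst 0 a b = 0"
  by (rule c2_eqI; simp add: c2_subst sum.distrib sum_subtractf algebra_simps sum_negf)+

lemma const2_mult_c2: "c2 (const2 c * F) i j = c * c2 F i j"
  by (simp add: const2_def c2_def)

context
  fixes a b :: fps2
  assumes ab: "nonunit2 a" "nonunit2 b"
begin

lemma ordge_subst: "ordge n F \<Longrightarrow> ordge n (subst F a b)"
  unfolding ordge_def[of n "subst F a b"]
proof (intro allI impI)
  fix i j assume F: "ordge n F" and ij: "i + j < n"
  show "c2 (subst F a b) i j = 0"
    unfolding c2_subst
  proof (intro sum.neutral ballI)
    fix k l
    show "c2 F k l * c2 (a ^ k * b ^ l) i j = 0"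
      using F ordge_power_mult[OF ab, of k l] ij unfolding ordge_def
      by (cases "k + l < n") auto
  qed
qed

lemma subst_monom: "subst (const2 c * XX ^ k * YY ^ l) a b = const2 c * a ^ k * b ^ l"
proof (rule c2_eqI)
  fix i j
  have "c2 (subst (const2 c * XX ^ k * YY ^ l) a b) i j
      = (\<Sum>k'\<le>i + j. \<Sum>l'\<le>i + j. if l' = l then (if k' = k then c * c2 (a ^ k' * b ^ l') i j else 0) else 0)"
    unfolding c2_subst by (intro sum.cong) (auto simp: c2_monom)
  also have "\<dots> = (if l \<le> i + j \<and> k \<le> i + j then c * c2 (a ^ k * b ^ l) i j else 0)"
    by (cases "l \<le> i + j") (simp_all add: sum.delta')
  also have "\<dots> = c * c2 (a ^ k * b ^ l) i j"
    using ordge_power_mult[OF ab, of k l] by (auto simp: ordge_def)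
  finally show "c2 (subst (const2 c * XX ^ k * YY ^ l) a b) i j = c2 (const2 c * a ^ k * b ^ l) i j"
    by (simp add: const2_mult_c2 mult.assoc)
qed

lemma const2_1 [simp]: "const2 1 = 1" and const2_mult: "const2 (c * d) = const2 c * const2 d"
  by (simp_all add: const2_def)

lemma subst_const2 [simp]: "subst (const2 c) a b = const2 c"
  using subst_monom[of c 0 0] by simp

lemma subst_1 [simp]: "subst 1 a b = 1"
  using subst_const2[of 1] by simp

lemma subst_XX [simp]: "subst XX a b = a"
  using subst_monom[of 1 1 0] by simp

lemma subst_YY [simp]: "subst YY a b = b"
  using subst_monom[of 1 0 1] by simp

text \<open>Density is used twice: first in F with the other factor a fixed monomial, then in G with
  F arbitrary.\<close>

lemma subst_mult: "subst (F * G) a b = subst F a b * subst G a b"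
proof -
  have 1: "subst (F * (const2 c * XX ^ k * YY ^ l)) a b = subst F a b * (const2 c * a ^ k * b ^ l)"
    for F c k l
  proof (rule additive_eqI[where \<phi> = "\<lambda>F. subst (F * (const2 c * XX ^ k * YY ^ l)) a b" and d = 0])
    fix c' k' l'
    have "(const2 c' * XX ^ k' * YY ^ l') * (const2 c * XX ^ k * YY ^ l)
        = const2 (c' * c) * XX ^ (k' + k) * YY ^ (l' + l)"
      by (simp add: const2_mult power_add mult_ac)
    then have "subst (const2 c' * XX ^ k' * YY ^ l' * (const2 c * XX ^ k * YY ^ l)) a b
        = const2 (c' * c) * a ^ (k' + k) * b ^ (l' + l)"
      by (simp only: subst_monom)
    also have "\<dots> = subst (const2 c' * XX ^ k' * YY ^ l') a b * (const2 c * a ^ k * b ^ l)"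
      by (simp only: subst_monom) (simp add: const2_mult power_add mult_ac)
    finally show "subst (const2 c' * XX ^ k' * YY ^ l' * (const2 c * XX ^ k * YY ^ l)) a b
        = subst (const2 c' * XX ^ k' * YY ^ l') a b * (const2 c * a ^ k * b ^ l)" .
  qed (auto simp: distrib_right subst_add intro: ordge_subst ordge_multL)
  show ?thesis
    by (rule additive_eqI[where \<phi> = "\<lambda>G. subst (F * G) a b" and d = 0])
       (auto simp: distrib_left subst_add subst_monom 1 intro: ordge_subst ordge_multR)
qed

lemma subst_power: "subst (F ^ n) a b = subst F a b ^ n"
  by (induction n) (auto simp: subst_mult)

lemma subst_prod_list: "subst (prod_list Fs) a b = prod_list (map (\<lambda>F. subst F a b) Fs)"
  by (induction Fs) (auto simp: subst_mult)

lemma subst_prod: "subst (prod f S) a b = prod (\<lambda>s. subst (f s) a b) S"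
  by (induction S rule: infinite_finite_induct) (auto simp: subst_mult)

lemma subst_dvd: "F dvd G \<Longrightarrow> subst F a b dvd subst G a b"
  by (auto simp: dvd_def subst_mult)


lemma c2_subst_00 [simp]: "c2 (subst F a b) 0 0 = c2 F 0 0"
proof -
  have "nonunit2 (F - const2 (c2 F 0 0))" by (simp add: nonunit2_def c2_const2)
  then have "nonunit2 (subst (F - const2 (c2 F 0 0)) a b)"
    unfolding nonunit2_ordge by (rule ordge_subst)
  then show ?thesis by (simp add: subst_diff nonunit2_def c2_const2)
qed

lemma nonunit2_subst [simp]: "nonunit2 (subst F a b) \<longleftrightarrow> nonunit2 F"
  by (simp add: nonunit2_def)

end

lemma nonunit2_XX [simp]: "nonunit2 XX" and nonunit2_YY [simp]: "nonunit2 YY"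
  by (auto simp: nonunit2_def c2_XX c2_YY)

lemma subst_XX_YY [simp]: "subst F XX YY = F"
  by (rule additive_eqI[where \<phi> = "\<lambda>F. subst F XX YY" and \<psi> = "\<lambda>F. F" and d = 0])
     (auto simp: subst_add subst_monom intro: ordge_subst)

lemma subst_subst:
  assumes "nonunit2 A" "nonunit2 B" "nonunit2 a" "nonunit2 b"
  shows "subst (subst F A B) a b = subst F (subst A a b) (subst B a b)"
proof -
  have ab': "nonunit2 (subst A a b)" "nonunit2 (subst B a b)"
    using assms by auto
  show ?thesis
  proof (rule additive_eqI[where \<phi> = "\<lambda>F. subst (subst F A B) a b" and d = 0])
    show "subst (subst (const2 c * XX ^ k * YY ^ l) A B) a b
        = subst (const2 c * XX ^ k * YY ^ l) (subst A a b) (subst B a b)" for c k l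
      using assms ab' by (simp only: subst_monom subst_mult subst_power subst_const2 subst_XX subst_YY)
  qed (use assms ab' in \<open>auto simp: subst_add intro!: ordge_subst\<close>)
qed

subsection \<open>Partial derivatives\<close>

definition dx :: "fps2 \<Rightarrow> fps2" where "dx F = Abs_fps (\<lambda>j. fps_deriv (fps_nth F j))"
definition dy :: "fps2 \<Rightarrow> fps2" where "dy = fps_deriv"

lemma c2_dx: "c2 (dx F) i j = of_nat (Suc i) * c2 F (Suc i) j"
  by (simp add: c2_def dx_def)

lemma c2_dy: "c2 (dy F) i j = of_nat (Suc j) * c2 F i (Suc j)"
  by (simp add: c2_def dy_def flip: fps_of_nat del: of_nat_Suc)

lemma dx_add: "dx (F + G) = dx F + dx G" and dy_add: "dy (F + G) = dy F + dy G"
  by (simp_all add: dx_def dy_def fps_eq_iff)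

lemma dy_mult: "dy (F * G) = F * dy G + dy F * G"
  by (simp add: dy_def)

lemma dx_mult: "dx (F * G) = F * dx G + dx F * G"
proof (rule fps_ext)
  fix n
  show "fps_nth (dx (F * G)) n = fps_nth (F * dx G + dx F * G) n"
    by (simp add: dx_def fps_mult_nth fps_deriv_sum sum.distrib)
qed

lemma dx_const2 [simp]: "dx (const2 c) = 0" and dy_const2 [simp]: "dy (const2 c) = 0"
  and dx_XX [simp]: "dx XX = 1" and dy_XX [simp]: "dy XX = 0"
  and dx_YY [simp]: "dx YY = 0" and dy_YY [simp]: "dy YY = 1"
  by (simp_all add: const2_def XX_def YY_def dx_def dy_def fps_eq_iff fps_X_def)

lemma dx_power: "dx (F ^ n) = of_nat n * F ^ (n - 1) * dx F"
  and dy_power: "dy (F ^ n) = of_nat n * F ^ (n - 1) * dy F"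
proof -
  have one: "dx 1 = 0" "dy 1 = 0" by (simp_all add: dx_def dy_def fps_eq_iff)
  show "dx (F ^ n) = of_nat n * F ^ (n - 1) * dx F"
  proof (induction n)
    case (Suc n) then show ?case by (cases n) (simp_all add: dx_mult algebra_simps)
  qed (simp add: one)
  show "dy (F ^ n) = of_nat n * F ^ (n - 1) * dy F"
  proof (induction n)
    case (Suc n) then show ?case by (cases n) (simp_all add: dy_mult algebra_simps)
  qed (simp add: one)
qed

lemma ordge_dx: "ordge (n + 1) F \<Longrightarrow> ordge n (dx F)" and ordge_dy: "ordge (n + 1) F \<Longrightarrow> ordge n (dy F)"
  by (auto simp: ordge_def c2_dx c2_dy)

lemma subst_of_nat [simp]: "nonunit2 a \<Longrightarrow> nonunit2 b \<Longrightarrow> subst (of_nat n) a b = of_nat n"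
  by (induction n) (auto simp: subst_add)

lemma dy_subst:
  assumes "nonunit2 a" "nonunit2 b"
  shows "dy (subst F a b) = subst (dx F) a b * dy a + subst (dy F) a b * dy b"
\<comment> \<open>The chain rule is checked on monomials; \<open>d = 1\<close> because
  differentiation lowers the order by one.\<close>
proof (rule additive_eqI[where \<phi> = "\<lambda>F. dy (subst F a b)" and d = 1])
  fix c k l
  show "dy (subst (const2 c * XX ^ k * YY ^ l) a b)
      = subst (dx (const2 c * XX ^ k * YY ^ l)) a b * dy a + subst (dy (const2 c * XX ^ k * YY ^ l)) a b * dy b"
    using assms
    by (simp add: subst_monom dx_mult dy_mult dx_power dy_power subst_mult subst_power algebra_simps)
next
  fix n F assume "ordge (n + 1) F"
  then have "ordge n (dx F)" "ordge n (dy F)" by (auto intro: ordge_dx ordge_dy)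
  then show "ordge n (subst (dx F) a b * dy a + subst (dy F) a b * dy b)"
    using assms by (auto intro!: ordge_add ordge_multL ordge_subst)
qed (use assms in \<open>auto simp: subst_add dx_add dy_add algebra_simps intro!: ordge_dy ordge_subst\<close>)

subsection \<open>Units\<close>

lemma unit2_iff: "F dvd 1 \<longleftrightarrow> c2 F 0 0 \<noteq> 0" for F :: fps2
proof
  assume "F dvd 1"
  then obtain G where "1 = F * G" by (auto simp: dvd_def)
  then have "c2 F 0 0 * c2 G 0 0 = 1" by (metis c2_1 c2_mult_00)
  then show "c2 F 0 0 \<noteq> 0" by auto
next
  assume "c2 F 0 0 \<noteq> 0"
  then have "fps_nth F 0 * inverse (fps_nth F 0) = 1"
    by (simp add: c2_def inverse_mult_eq_1')
  from fps_right_inverse[OF this] show "F dvd 1" by (metis dvd_triv_left)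
qed

subsection \<open>Values along a parametrized curve\<close>

definition eval2 :: "fps2 \<Rightarrow> complex fps \<Rightarrow> complex fps \<Rightarrow> complex fps" where
  "eval2 F a b = Abs_fps (\<lambda>n. \<Sum>i\<le>n. \<Sum>j\<le>n. c2 F i j * fps_nth (a ^ i * b ^ j) n)"

lemma subst2_eq_eval2: "subst2 F a b = eval2 (fps2_of F) a b"
  by (simp add: subst2_def eval2_def coeff2_def c2_def)

lemma nonunit2_fps_const [simp]: "nonunit2 (fps_const a) \<longleftrightarrow> fps_nth a 0 = 0"
  by (simp add: nonunit2_def c2_const_series)

lemma nonunit2_add: "nonunit2 F \<Longrightarrow> nonunit2 G \<Longrightarrow> nonunit2 (F + G)"
  and nonunit2_mult: "nonunit2 F \<or> nonunit2 G \<Longrightarrow> nonunit2 (F * G)"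
  by (auto simp: nonunit2_def)

lemma nonunit2_power: "nonunit2 F \<Longrightarrow> n > 0 \<Longrightarrow> nonunit2 (F ^ n)"
  by (cases n) (auto intro: nonunit2_mult)

text \<open>A curve is a substitution by two series that do not involve y, so the homomorphism
  properties of \<open>eval2\<close> are inherited from \<open>subst\<close>.\<close>

lemma subst_fps_const_eval2:
  assumes "fps_nth a 0 = 0" "fps_nth b 0 = 0"
  shows "subst F (fps_const a) (fps_const b) = fps_const (eval2 F a b)"
proof (rule c2_eqI)
  fix i j
  have "c2 (fps_const a ^ k * fps_const b ^ l) i j = (if j = 0 then fps_nth (a ^ k * b ^ l) i else 0)" for k l
    by (simp add: fps_const_power c2_const_series)
  then show "c2 (subst F (fps_const a) (fps_const b)) i j = c2 (fps_const (eval2 F a b)) i j"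
    by (simp add: c2_subst eval2_def c2_const_series)
qed

context
  fixes a b :: "complex fps"
  assumes ab: "fps_nth a 0 = 0" "fps_nth b 0 = 0"
begin

lemma eval2_eqI: "subst F (fps_const a) (fps_const b) = fps_const c \<Longrightarrow> eval2 F a b = c"
  using subst_fps_const_eval2[OF ab] by simp

lemma eval2_add: "eval2 (F + G) a b = eval2 F a b + eval2 G a b"
  by (rule eval2_eqI) (simp add: subst_add subst_fps_const_eval2[OF ab, symmetric] flip: fps_const_add)

lemma eval2_diff: "eval2 (F - G) a b = eval2 F a b - eval2 G a b"
  by (rule eval2_eqI) (simp add: subst_diff subst_fps_const_eval2[OF ab, symmetric] flip: fps_const_sub)

lemma eval2_mult: "eval2 (F * G) a b = eval2 F a b * eval2 G a b"
  by (rule eval2_eqI) (simp add: subst_mult ab subst_fps_const_eval2[OF ab, symmetric] flip: fps_const_mult)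

lemma eval2_1 [simp]: "eval2 1 a b = 1"
  by (rule eval2_eqI) (simp add: ab)

lemma eval2_power: "eval2 (F ^ n) a b = eval2 F a b ^ n"
  by (induction n) (simp_all add: eval2_mult)

lemma eval2_prod: "eval2 (prod f S) a b = prod (\<lambda>s. eval2 (f s) a b) S"
  by (induction S rule: infinite_finite_induct) (simp_all add: eval2_mult)

lemma eval2_XX [simp]: "eval2 XX a b = a" and eval2_YY [simp]: "eval2 YY a b = b"
  by (rule eval2_eqI; simp add: ab)+

lemma eval2_nth_0 [simp]: "fps_nth (eval2 F a b) 0 = c2 F 0 0"
  by (simp add: eval2_def)

lemma eval2_subst:
  assumes "nonunit2 A" "nonunit2 B"
  shows "eval2 (subst F A B) a b = eval2 F (eval2 A a b) (eval2 B a b)"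
proof (rule eval2_eqI)
  have [simp]: "fps_nth (eval2 A a b) 0 = 0" "fps_nth (eval2 B a b) 0 = 0"
    using assms by (simp_all add: nonunit2_def)
  show "subst (subst F A B) (fps_const a) (fps_const b) = fps_const (eval2 F (eval2 A a b) (eval2 B a b))"
    using assms ab subst_fps_const_eval2[of "eval2 A a b" "eval2 B a b" F]
    by (subst subst_subst) (simp_all add: subst_fps_const_eval2[OF ab] nonunit2_def c2_const_series)
qed

end

lemma subst_fps_const:
  assumes "fps_nth s 0 = 0" "nonunit2 B"
  shows "subst (fps_const a) (fps_const s) B = fps_const (a oo s)"
proof (rule c2_eqI)
  fix i j
  have 1: "c2 (fps_const s ^ k) i j = (if j = 0 then fps_nth (s ^ k) i else 0)" for k
    by (simp add: fps_const_power c2_const_series)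
  have "c2 (subst (fps_const a) (fps_const s) B) i j
      = (\<Sum>k\<le>i + j. \<Sum>l\<le>i + j. if l = 0 then fps_nth a k * c2 (fps_const s ^ k) i j else 0)"
    unfolding c2_subst by (intro sum.cong) (auto simp: c2_const_series)
  also have "\<dots> = (\<Sum>k\<le>i + j. fps_nth a k * c2 (fps_const s ^ k) i j)"
    by simp
  also have "\<dots> = c2 (fps_const (a oo s)) i j"
    by (simp add: 1 c2_const_series fps_compose_nth atLeast0AtMost)
  finally show "c2 (subst (fps_const a) (fps_const s) B) i j = c2 (fps_const (a oo s)) i j" .
qed

lemma eval2_fps_const:
  assumes "fps_nth s 0 = 0" "fps_nth b 0 = 0"
  shows "eval2 (fps_const a) s b = a oo s"
  by (rule eval2_eqI) (use assms in \<open>simp_all add: subst_fps_const\<close>)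

text \<open>Reparametrizing is itself an evaluation of a y-free series, along the curve (s, 0),
  which reduces the claim to composition of substitutions.\<close>

lemma eval2_compose:
  assumes "fps_nth a 0 = 0" "fps_nth b 0 = 0" "fps_nth s 0 = 0"
  shows "eval2 F a b oo s = eval2 F (a oo s) (b oo s)"
proof -
  have "eval2 F a b oo s = eval2 (subst F (fps_const a) (fps_const b)) s 0"
    using assms by (simp add: subst_fps_const_eval2 eval2_fps_const)
  also have "\<dots> = eval2 F (a oo s) (b oo s)"
    using assms by (simp add: eval2_subst eval2_fps_const)
  finally show ?thesis .
qed

subsection \<open>Base change, rotations and translations\<close>

definition pw :: "nat \<Rightarrow> fps2 \<Rightarrow> fps2" where "pw n F = subst F (XX ^ n) YY"
definition rot :: "complex \<Rightarrow> fps2 \<Rightarrow> fps2" where "rot w F = subst F (const2 w * XX) YY"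
definition shift :: "complex fps \<Rightarrow> fps2 \<Rightarrow> fps2" where "shift g F = subst F XX (YY + fps_const g)"

lemma XX_power: "XX ^ n = fps_const (fps_X ^ n)"
  by (simp add: XX_def fps_const_power)

lemma c2_XX_YY_power: "c2 (XX ^ k * YY ^ l) i j = (if i = k \<and> j = l then 1 else 0)"
  using c2_monom[of 1 k l i j] by (simp add: const2_def)

lemma c2_pw:
  assumes "n > 0"
  shows "c2 (pw n F) i j = (if n dvd i then c2 F (i div n) j else 0)"
proof -
  have "c2 (pw n F) i j = (\<Sum>k\<le>i + j. \<Sum>l\<le>i + j. if l = j then (if i = n * k then c2 F k l else 0) else 0)"
    unfolding pw_def c2_subst
    by (intro sum.cong) (auto simp: c2_XX_YY_power simp flip: power_mult)
  also have "\<dots> = (\<Sum>k\<le>i + j. if i = n * k then c2 F k j else 0)"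
    by simp
  also have "\<dots> = (\<Sum>k\<le>i + j. if k = i div n then (if n dvd i then c2 F k j else 0) else 0)"
    using assms by (intro sum.cong) auto
  also have "\<dots> = (if n dvd i then c2 F (i div n) j else 0)"
    using div_le_dividend[of i n] by (auto simp: trans_le_add1)
  finally show ?thesis .
qed

lemma pw_eq_iff: "n > 0 \<Longrightarrow> pw n F = pw n G \<longleftrightarrow> F = G"
proof
  assume n: "n > 0" and eq: "pw n F = pw n G"
  show "F = G"
  proof (rule c2_eqI)
    fix i j
    have "c2 (pw n F) (n * i) j = c2 (pw n G) (n * i) j" using eq by simp
    then show "c2 F i j = c2 G i j" using n by (simp add: c2_pw)
  qed
qed auto

lemma nonunit2_XX_power [simp]: "n > 0 \<Longrightarrow> nonunit2 (XX ^ n)"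
  by (simp add: nonunit2_power)

lemma nonunit2_shift_arg [simp]: "fps_nth g 0 = 0 \<Longrightarrow> nonunit2 (YY + fps_const g)"
  by (simp add: nonunit2_add)

lemma nonunit2_rot_arg [simp]: "nonunit2 (const2 w * XX)"
  by (simp add: nonunit2_mult)

lemma pw_hom:
  assumes "n > 0"
  shows "pw n (F * G) = pw n F * pw n G" "pw n 1 = 1" "pw n YY = YY" "pw n (F ^ k) = pw n F ^ k"
    "pw n (prod_list Fs) = prod_list (map (pw n) Fs)" "pw n (prod f S) = prod (\<lambda>s. pw n (f s)) S"
    "pw n (F - G) = pw n F - pw n G" "pw n 0 = 0"
  using assms unfolding pw_def
  by (simp_all add: subst_mult subst_power subst_prod_list subst_prod subst_diff)

lemma pw_fps_const: "n > 0 \<Longrightarrow> pw n (fps_const g) = fps_const (g oo fps_X ^ n)"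
  by (simp add: pw_def XX_power subst_fps_const)

lemma pw_pw: "m > 0 \<Longrightarrow> n > 0 \<Longrightarrow> pw m (pw n F) = pw (m * n) F"
  by (simp add: pw_def subst_subst subst_power power_mult)

lemma c2_pw_00 [simp]: "n > 0 \<Longrightarrow> c2 (pw n F) 0 0 = c2 F 0 0"
  by (simp add: c2_pw)

lemma dy_pw: "n > 0 \<Longrightarrow> dy (pw n F) = pw n (dy F)"
  by (intro c2_eqI) (simp add: c2_pw c2_dy)

lemma eval2_pw:
  assumes "n > 0" "fps_nth s 0 = 0" "fps_nth b 0 = 0"
  shows "eval2 (pw n F) s b = eval2 F (s ^ n) b"
  using assms by (simp add: pw_def eval2_subst eval2_power)

lemma c2_rot: "c2 (rot w F) i j = w ^ i * c2 F i j"
proof -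
  have "c2 ((const2 w * XX) ^ k * YY ^ l) i j = (if i = k \<and> j = l then w ^ k else 0)" for k l
  proof -
    have "(const2 w * XX) ^ k * YY ^ l = const2 (w ^ k) * (XX ^ k * YY ^ l)"
      by (simp add: power_mult_distrib const2_def fps_const_power mult_ac)
    then show ?thesis by (simp only: const2_mult_c2 c2_XX_YY_power) auto
  qed
  then have "c2 (rot w F) i j = (\<Sum>k\<le>i + j. \<Sum>l\<le>i + j. if l = j then (if k = i then w ^ k * c2 F k l else 0) else 0)"
    unfolding rot_def c2_subst by (intro sum.cong) auto
  then show ?thesis by simp
qed

lemma rot_hom:
  "rot w (F * G) = rot w F * rot w G" "rot w (F - G) = rot w F - rot w G" "rot w YY = YY"
  "rot w (prod f S) = prod (\<lambda>s. rot w (f s)) S"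
  unfolding rot_def by (simp_all add: subst_mult subst_diff subst_prod)

lemma const2_XX: "const2 w * XX = fps_const (fps_const w * fps_X)"
  by (simp add: const2_def XX_def)

lemma rot_fps_const: "rot w (fps_const g) = fps_const (g oo (fps_const w * fps_X))"
  by (simp add: rot_def const2_XX subst_fps_const)

text \<open>A primitive root w alone kills every coefficient with n not dividing i, since w^i
  differs from 1.\<close>

lemma pw_rot_invariant:
  assumes n: "n > 0" and inv: "\<And>w. w ^ n = 1 \<Longrightarrow> rot w F = F"
  obtains G where "F = pw n G" "\<And>i j. c2 G i j = c2 F (n * i) j"
proof
  define G where "G = Abs_fps (\<lambda>j. Abs_fps (\<lambda>i. c2 F (n * i) j))"
  show G: "c2 G i j = c2 F (n * i) j" for i j by (simp add: G_def c2_def)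
  show "F = pw n G"
  proof (rule c2_eqI)
    fix i j
    define w where "w = exp (2 * of_real pi * \<i> / of_nat n)"
    have w: "w ^ k = exp (2 * of_real pi * \<i> * of_nat k / of_nat n)" for k
      by (simp add: w_def mult_ac flip: exp_of_nat_mult)
    have "w ^ n = 1" using n by (simp add: w)
    from inv[OF this] have "w ^ i * c2 F i j = c2 F i j" by (metis c2_rot)
    moreover have "w ^ i \<noteq> 1" if "\<not> n dvd i"
      using that n complex_root_unity_eq_1[of n i] by (simp add: w)
    ultimately have "\<not> n dvd i \<Longrightarrow> c2 F i j = 0" by auto
    then show "c2 F i j = c2 (pw n G) i j" using n by (auto simp: c2_pw G)
  qed
qed

lemma shift_hom:
  assumes "fps_nth g 0 = 0"
  shows "shift g (F * G) = shift g F * shift g G" "shift g (F + G) = shift g F + shift g G"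
    "shift g (F - G) = shift g F - shift g G"
    "shift g YY = YY + fps_const g" "shift g (fps_const a) = fps_const a" "shift g 1 = 1"
    "shift g (prod_list Fs) = prod_list (map (shift g) Fs)"
  using assms subst_fps_const[of fps_X "YY + fps_const g" a] unfolding shift_def
  by (simp_all add: subst_mult subst_add subst_diff subst_prod_list XX_def)

lemma shift_shift:
  assumes "fps_nth g 0 = 0" "fps_nth h 0 = 0"
  shows "shift h (shift g F) = shift (h + g) F"
proof -
  have "subst (fps_const g) XX (YY + fps_const h) = fps_const g"
    using assms shift_hom(5)[of h g] by (simp add: shift_def)
  then show ?thesis
    using assms by (simp add: shift_def subst_subst subst_add add.assoc flip: fps_const_add)
qed

lemma shift_0 [simp]: "shift 0 F = F"
  by (simp add: shift_def)

lemma dy_shift: "fps_nth g 0 = 0 \<Longrightarrow> dy (shift g F) = shift g (dy F)"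
  by (simp add: shift_def dy_subst dy_add) (simp add: dy_def)

lemma eval2_shift:
  assumes "fps_nth g 0 = 0" "fps_nth b 0 = 0"
  shows "eval2 (shift g F) fps_X b = eval2 F fps_X (b + g)"
  using assms by (simp add: shift_def eval2_subst eval2_add eval2_fps_const)

lemma eval2_X_0: "eval2 F fps_X 0 = fps_nth F 0"
proof -
  have "fps_nth (eval2 F fps_X 0) n = fps_nth (fps_nth F 0) n" for n
  proof -
    have "fps_nth (eval2 F fps_X 0) n = (\<Sum>i\<le>n. \<Sum>j\<le>n. if j = 0 then (if i = n then c2 F i j else 0) else 0)"
      unfolding eval2_def fps_nth_Abs_fps by (intro sum.cong refl) (auto simp: power_0_left)
    then show ?thesis by (simp add: c2_def)
  qed
  then show ?thesis by (simp add: fps_eq_iff)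
qed

lemma shift_nth_0: "fps_nth g 0 = 0 \<Longrightarrow> fps_nth (shift g F) 0 = eval2 F fps_X g"
  using eval2_shift[of g 0 F] by (simp add: eval2_X_0)

text \<open>Translating the root to 0 turns vanishing along it into divisibility by y; translating
  back gives the factor.\<close>

lemma linear_factor:
  assumes g: "fps_nth g 0 = 0" and "eval2 F fps_X g = 0"
  shows "YY - fps_const g dvd F"
proof -
  have "fps_nth (shift g F) 0 = 0" using assms by (simp add: shift_nth_0)
  then have "shift g F = YY * fps_shift 1 (shift g F)"
    by (auto simp: YY_def fps_eq_iff fps_X_mult_nth simp del: One_nat_def)
  then have "shift (- g) (shift g F) = (YY - fps_const g) * shift (- g) (fps_shift 1 (shift g F))"
    using g by (metis (no_types, lifting) shift_hom(1,4) fps_const_neg add_uminus_conv_diff fps_neg_nth neg_equal_0_iff_equal)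
  then show ?thesis using g by (simp add: shift_shift) (rule dvdI)
qed

lemma linear_factors:
  assumes "finite S" "inj_on g S" "\<And>s. s \<in> S \<Longrightarrow> fps_nth (g s) 0 = 0"
    "\<And>s. s \<in> S \<Longrightarrow> eval2 F fps_X (g s) = 0"
  shows "(\<Prod>s\<in>S. YY - fps_const (g s)) dvd F"
  using assms
proof (induction S arbitrary: F rule: finite_induct)
  case (insert s S)
  then obtain H where H: "F = (YY - fps_const (g s)) * H"
    using linear_factor[of "g s" F] by (auto simp: dvd_def)
  have "eval2 H fps_X (g t) = 0" if t: "t \<in> S" for t
  proof -
    have "g t - g s \<noteq> 0" using insert.hyps insert.prems(1) t by (auto simp: inj_on_def)
    moreover have "(g t - g s) * eval2 H fps_X (g t) = 0"
      using insert.prems(2)[of t] insert.prems(2)[of s] insert.prems(3)[of t] t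
      by (simp add: H eval2_mult eval2_diff eval2_fps_const)
    ultimately show ?thesis by simp
  qed
  then have "(\<Prod>s\<in>S. YY - fps_const (g s)) dvd H"
    using insert by (intro insert.IH) (auto simp: inj_on_def)
  then show ?case using insert.hyps by (simp add: H mult_dvd_mono)
qed simp

subsection \<open>Straightening a smooth curve\<close>

lemma ordge_power_diff:
  assumes "nonunit2 A'" "nonunit2 A" "ordge n (A' - A)"
  shows "ordge (n + k) (A' ^ Suc k - A ^ Suc k)"
proof (induction k)
  case (Suc k)
  have "A' ^ Suc (Suc k) - A ^ Suc (Suc k) = A' * (A' ^ Suc k - A ^ Suc k) + (A' - A) * A ^ Suc k"
    by (simp add: algebra_simps)
  moreover have "ordge (Suc 0 + (n + k)) (A' * (A' ^ Suc k - A ^ Suc k))"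
    by (rule ordge_mult) (use assms Suc in \<open>simp_all add: nonunit2_ordge\<close>)
  moreover have "ordge (n + Suc k) ((A' - A) * A ^ Suc k)"
    by (intro ordge_mult assms ordge_power)
  ultimately show ?case by (simp add: ordge_add del: power_Suc)
qed (use assms in simp)

text \<open>The contraction estimate for the iteration below: with d = 1 it applies to the part of l
  beyond its linear terms and gains one order per step; with d = 0 it gives continuity.\<close>

lemma ordge_subst_diff:
  assumes A: "nonunit2 A'" "nonunit2 A" "nonunit2 b" and n: "ordge n (A' - A)" and F: "ordge (Suc d) F"
  shows "ordge (n + d) (subst F A' b - subst F A b)"
  unfolding ordge_def
proof (intro allI impI)
  fix i j assume ij: "i + j < n + d"
  have "c2 F k l * c2 (A' ^ k * b ^ l) i j - c2 F k l * c2 (A ^ k * b ^ l) i j = 0" for k l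
  proof (cases "k + l < Suc d \<or> k = 0")
    case True
    then show ?thesis using F by (auto simp: ordge_def)
  next
    case False
    then obtain k' where k: "k = Suc k'" and kl: "d \<le> k' + l" by (cases k) auto
    have "ordge (n + k' + l) ((A' ^ k - A ^ k) * b ^ l)"
      unfolding k by (intro ordge_mult ordge_power_diff ordge_power A n)
    then have "c2 ((A' ^ k - A ^ k) * b ^ l) i j = 0"
      using ij kl by (simp add: ordge_def)
    then show ?thesis by (simp add: left_diff_distrib)
  qed
  then show "c2 (subst F A' b - subst F A b) i j = 0"
    unfolding c2_diff c2_subst sum_subtractf[symmetric] by (intro sum.neutral ballI)
qed

lemma right_inverse_exists:
  assumes l: "nonunit2 l" and \<alpha>: "c2 l 1 0 \<noteq> 0"
  shows "\<exists>A. nonunit2 A \<and> subst l A YY = XX"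
proof -
  define \<alpha> where "\<alpha> = c2 l 1 0"
  define l2 where "l2 = l - const2 \<alpha> * XX - const2 (c2 l 0 1) * YY"
  have l2: "ordge (Suc 1) l2"
    using l unfolding ordge_def l2_def
    by (auto simp: less_Suc_eq_le const2_mult_c2 c2_XX c2_YY \<alpha>_def nonunit2_def)
       (metis One_nat_def add_is_1 le_SucE le_zero_eq add_is_0)+
  \<comment> \<open>Simplified Newton iteration for l(A, y) = x: the error is divided by the fixed
    linear coefficient \<alpha>. The linear part of the error cancels exactly, so the new error is a
    difference of values of \<open>l2\<close>.\<close>
  define G where "G = (\<lambda>A. A - const2 (1 / \<alpha>) * (subst l A YY - XX))"
  define S where "S = (\<lambda>n. (G ^^ n) 0)"
  have S_Suc: "S (Suc n) = G (S n)" for n by (simp add: S_def)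
  have *: "nonunit2 (S n) \<and> ordge (Suc n) (subst l (S n) YY - XX)" for n
  proof (induction n)
    case 0
    have "nonunit2 (0 :: fps2)" by (simp add: nonunit2_def)
    then have "c2 (subst l 0 YY) 0 0 = 0" using l by (subst c2_subst_00) (auto simp: nonunit2_def c2_YY)
    then have "nonunit2 (subst l 0 YY - XX)" by (simp add: nonunit2_def c2_XX)
    with \<open>nonunit2 0\<close> show ?case by (simp add: S_def flip: nonunit2_ordge)
  next
    case (Suc n)
    define E where "E = subst l (S n) YY - XX"
    define \<delta> where "\<delta> = const2 (1 / \<alpha>) * E"
    have E: "ordge (Suc n) E" using Suc by (simp add: E_def)
    have S: "S (Suc n) = S n - \<delta>" by (simp add: S_Suc G_def E_def \<delta>_def)
    have \<delta>: "ordge (Suc n) \<delta>" unfolding \<delta>_def by (intro ordge_multR E)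
    then have "nonunit2 \<delta>" unfolding nonunit2_ordge by (rule ordge_mono) simp
    with Suc have nu: "nonunit2 (S n - \<delta>)" by (simp add: nonunit2_def)
    have "ordge (Suc n + 1) (subst l2 (S n - \<delta>) YY - subst l2 (S n) YY)"
      by (rule ordge_subst_diff) (use nu Suc \<delta> l2 in \<open>auto simp: ordge_uminus\<close>)
    moreover have "subst l (S n - \<delta>) YY - XX = subst l2 (S n - \<delta>) YY - subst l2 (S n) YY"
    proof -
      have "subst l2 B YY = subst l B YY - const2 \<alpha> * B - const2 (c2 l 0 1) * YY" if "nonunit2 B" for B
        using that by (simp add: l2_def subst_diff subst_mult)
      from this[of "S n"] this[of "S n - \<delta>"]
      have "subst l2 (S n - \<delta>) YY - subst l2 (S n) YY
          = subst l (S n - \<delta>) YY - subst l (S n) YY + const2 \<alpha> * \<delta>"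
        using nu Suc by (simp add: right_diff_distrib)
      moreover have "const2 \<alpha> * \<delta> = E"
        using assms(2) by (simp add: \<delta>_def \<alpha>_def const2_mult flip: mult.assoc) (simp add: const2_def)
      ultimately show ?thesis by (simp add: E_def)
    qed
    ultimately show ?case using nu by (simp add: S)
  qed
  have step: "ordge (Suc n) (S (Suc n) - S n)" for n
  proof -
    have "S (Suc n) - S n = - (const2 (1 / \<alpha>) * (subst l (S n) YY - XX))"
      by (simp add: S_Suc G_def)
    then show ?thesis using * by (simp add: ordge_uminus ordge_multR)
  qed
  have stab: "c2 (S (n + d)) i j = c2 (S n) i j" if "i + j \<le> n" for n d i j
  proof (induction d)
    case (Suc d)
    have "c2 (S (Suc (n + d)) - S (n + d)) i j = 0"
      using step[of "n + d"] that by (simp add: ordge_def)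
    with Suc show ?case by simp
  qed simp
  \<comment> \<open>Coefficients of total degree at most n no longer change from \<open>S n\<close>
    on, so \<open>S (i + j)\<close> already has the limiting one.\<close>
  define A where "A = Abs_fps (\<lambda>j. Abs_fps (\<lambda>i. c2 (S (i + j)) i j))"
  have A: "c2 A i j = c2 (S (i + j)) i j" for i j by (simp add: A_def c2_def)
  have A_S: "ordge (Suc n) (A - S n)" for n
    unfolding ordge_def
  proof (intro allI impI)
    fix i j assume "i + j < Suc n"
    then show "c2 (A - S n) i j = 0" using stab[of i j "i + j" "n - (i + j)"] by (simp add: A)
  qed
  have nuA: "nonunit2 A" by (simp add: nonunit2_def A S_def)
  have "subst l A YY = XX"
  proof (rule ordge_eqI)
    fix n
    have "ordge (Suc n + 0) (subst l A YY - subst l (S n) YY)"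
      using nuA * l A_S by (intro ordge_subst_diff) (auto simp flip: nonunit2_ordge)
    then have "ordge (Suc n) ((subst l A YY - subst l (S n) YY) + (subst l (S n) YY - XX))"
      using * by (intro ordge_add) auto
    then show "ordge n (subst l A YY - XX)" by (simp add: ordge_mono)
  qed
  with nuA show ?thesis by blast
qed

text \<open>\<open>(A, B)\<close> is the inverse of the formal coordinate change \<open>(l, m)\<close>.\<close>
definition straight :: "fps2 \<Rightarrow> fps2 \<Rightarrow> fps2 \<Rightarrow> fps2 \<Rightarrow> bool" where
  "straight l m A B \<longleftrightarrow> nonunit2 l \<and> nonunit2 m \<and> nonunit2 A \<and> nonunit2 B \<and>
     subst l A B = XX \<and> subst m A B = YY \<and> subst A l m = XX \<and> subst B l m = YY"

text \<open>The right inverse A again has nonzero x-coefficient, hence a right inverse A' of its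
  own; associativity of substitution gives A' = l, so A is a two-sided inverse.\<close>

lemma straight_YY_exists:
  assumes l: "nonunit2 l" "c2 l 1 0 \<noteq> 0"
  shows "\<exists>A. straight l YY A YY"
proof -
  obtain A where A: "nonunit2 A" "subst l A YY = XX"
    using right_inverse_exists[OF l] by blast
  have "c2 (A * YY) 1 0 = 0"
    using A(1) by (simp add: c2_mult c2_YY nonunit2_def)
  then have "c2 (subst l A YY) 1 0 = c2 l 1 0 * c2 A 1 0"
    by (simp add: c2_subst c2_1 c2_YY)
  then have "c2 A 1 0 \<noteq> 0" by (auto simp: A c2_XX)
  then obtain A' where A': "nonunit2 A'" "subst A A' YY = XX"
    using right_inverse_exists A by blast
  have "l = subst l (subst A A' YY) (subst YY A' YY)" using A' by simp
  also have "\<dots> = subst (subst l A YY) A' YY" using A A' subst_subst[of A YY A' YY l] by simp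
  also have "\<dots> = A'" using A A' by simp
  finally have "straight l YY A YY" using A A' l by (simp add: straight_def)
  then show ?thesis ..
qed

definition pol :: "fps2 \<Rightarrow> fps2 \<Rightarrow> fps2" where "pol l f = dx l * dy f - dy l * dx f"

text \<open>One of A, B is y. Differentiating l(A, B) = x in y expresses the derivative of the other
  through those of l, and the chain rule for f(A, B) becomes the polar form divided, up to sign, by
  a partial derivative of l that is a unit. So in the new coordinates the polar curve is the zero
  set of the y-derivative.\<close>

lemma straight_exists:
  assumes l: "nonunit2 l" "c2 l 1 0 \<noteq> 0 \<or> c2 l 0 1 \<noteq> 0"
  obtains m A B \<kappa> where "straight l m A B" "\<kappa> dvd 1" "\<And>f. dy (subst f A B) = \<kappa> * subst (pol l f) A B"
proof (cases "c2 l 1 0 = 0")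
  case False
  then obtain A where s: "straight l YY A YY" using straight_YY_exists l by blast
  then have A: "nonunit2 A" and lA: "subst l A YY = XX" by (auto simp: straight_def)
  have "subst (dx l) A YY dvd 1"
    using False A by (simp add: unit2_iff c2_dx)
  then obtain \<kappa> where \<kappa>: "1 = subst (dx l) A YY * \<kappa>" by (auto simp: dvd_def)
  have 0: "subst (dx l) A YY * dy A + subst (dy l) A YY = 0"
    using dy_subst[of A YY l] A lA by simp
  have "dy (subst f A YY) = \<kappa> * subst (pol l f) A YY" for f
  proof -
    have "\<kappa> * subst (pol l f) A YY = \<kappa> * subst (dx l) A YY * subst (dy f) A YY - \<kappa> * subst (dy l) A YY * subst (dx f) A YY"
      using A by (simp add: pol_def subst_diff subst_mult algebra_simps)
    also have "\<kappa> * subst (dy l) A YY = - (\<kappa> * subst (dx l) A YY) * dy A"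
      using 0 by (metis add_eq_0_iff minus_mult_left minus_mult_right mult.assoc)
    also have "\<kappa> * subst (dx l) A YY = 1" using \<kappa> by (simp add: mult.commute)
    finally show ?thesis using A by (simp add: dy_subst algebra_simps)
  qed
  moreover have "\<kappa> dvd 1" using \<kappa> by (metis dvd_triv_right)
  ultimately show ?thesis using that s by blast
next
  case True
  with l have l01: "c2 l 0 1 \<noteq> 0" by simp
  \<comment> \<open>Exchanging the variables reduces to the case of a nonzero x-coefficient.\<close>
  define l' where "l' = subst l YY XX"
  have nul': "nonunit2 l'" using l by (simp add: l'_def)
  have "c2 l' 1 0 = c2 l 0 1"
    using c2_XX_YY_power[of 1 1 1 0] by (simp add: l'_def c2_subst c2_1 c2_YY c2_XX mult.commute)
  then obtain A where s: "straight l' YY A YY"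
    using straight_YY_exists[OF nul'] l01 by auto
  then have A: "nonunit2 A" and 1: "subst l' A YY = XX" and 2: "subst A l' YY = XX" by (auto simp: straight_def)
  have lA: "subst l YY A = XX"
    using 1 A by (simp add: l'_def subst_subst)
  have "subst (subst A l' YY) YY XX = subst A (subst l' YY XX) XX"
    using A nul' by (simp add: subst_subst)
  moreover have "subst l' YY XX = l" by (simp add: l'_def subst_subst)
  ultimately have Al: "subst A l XX = YY" by (simp add: 2)
  have s': "straight l XX YY A" using A l lA Al by (simp add: straight_def)
  have "subst (dy l) YY A dvd 1"
    using l01 A by (simp add: unit2_iff c2_dy)
  then obtain \<kappa> where \<kappa>: "1 = subst (dy l) YY A * \<kappa>" by (auto simp: dvd_def)
  have 0: "subst (dx l) YY A + subst (dy l) YY A * dy A = 0"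
    using dy_subst[of YY A l] A lA by simp
  have "dy (subst f YY A) = (- \<kappa>) * subst (pol l f) YY A" for f
  proof -
    have "(- \<kappa>) * subst (pol l f) YY A = \<kappa> * subst (dy l) YY A * subst (dx f) YY A - \<kappa> * subst (dx l) YY A * subst (dy f) YY A"
      using A by (simp add: pol_def subst_diff subst_mult algebra_simps)
    also have "\<kappa> * subst (dx l) YY A = - (\<kappa> * subst (dy l) YY A) * dy A"
      using 0 by (metis add.commute add_eq_0_iff minus_mult_left minus_mult_right mult.assoc)
    also have "\<kappa> * subst (dy l) YY A = 1" using \<kappa> by (simp add: mult.commute)
    finally show ?thesis using A by (simp add: dy_subst algebra_simps)
  qed
  moreover have "- \<kappa> dvd 1" using \<kappa> by (metis dvd_triv_right minus_dvd_iff)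
  ultimately show ?thesis using that s' by blast
qed

subsection \<open>Products over conjugate Puiseux series\<close>

definition conj_series :: "complex \<Rightarrow> complex fps \<Rightarrow> complex fps" where
  "conj_series w b = b oo (fps_const w * fps_X)"

text \<open>The base change by x^n of an equation of the curve (t^n, b(t)), provided that the n
  conjugates are distinct.\<close>

definition conj_prod :: "nat \<Rightarrow> complex fps \<Rightarrow> fps2" where
  "conj_prod n b = (\<Prod>w | w ^ n = 1. YY - fps_const (conj_series w b))"

lemma conj_series_nth: "fps_nth (conj_series w b) k = w ^ k * fps_nth b k"
  by (simp add: conj_series_def)

lemma conj_series_1 [simp]: "conj_series 1 b = b"
  by (simp add: conj_series_def)

lemma conj_series_conj_series: "conj_series v (conj_series w b) = conj_series (v * w) b"
  by (simp add: fps_eq_iff conj_series_nth power_mult_distrib)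

lemma finite_roots_1: "n > 0 \<Longrightarrow> finite {w :: complex. w ^ n = 1}"
  using finite_roots_unity[of n] by simp

lemma rot_conj_prod:
  assumes "n > 0" "v ^ n = 1"
  shows "rot v (conj_prod n b) = conj_prod n b"
proof -
  have v: "v \<noteq> 0" using assms by (auto simp: power_0_left)
  have "rot v (conj_prod n b) = (\<Prod>w | w ^ n = 1. YY - fps_const (conj_series (v * w) b))"
    by (simp add: conj_prod_def rot_hom rot_fps_const flip: conj_series_conj_series conj_series_def)
  also have "\<dots> = conj_prod n b"
    unfolding conj_prod_def
  proof (rule prod.reindex_bij_witness[where i = "\<lambda>w. w / v" and j = "\<lambda>w. v * w"])
  qed (use assms v in \<open>auto simp: power_mult_distrib power_divide\<close>)
  finally show ?thesis .
qed

lemma rot_pw: "n > 0 \<Longrightarrow> v ^ n = 1 \<Longrightarrow> rot v (pw n F) = pw n F"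
  by (intro c2_eqI) (auto simp: c2_rot c2_pw power_mult elim!: dvdE)

lemma YY_neq_fps_const [simp]: "YY \<noteq> fps_const g"
proof
  assume "YY = fps_const g"
  then have "c2 YY 0 1 = c2 (fps_const g) 0 1" by (rule arg_cong)
  then show False by (simp add: c2_YY c2_const_series)
qed

lemma c2_prod_00: "c2 (prod f S) 0 0 = (\<Prod>s\<in>S. c2 (f s) 0 0)"
  by (induction S rule: infinite_finite_induct) (simp_all add: c2_1)

lemma conj_prod_nonzero: "n > 0 \<Longrightarrow> conj_prod n b \<noteq> 0"
  by (simp add: conj_prod_def prod_zero_iff finite_roots_1)

text \<open>The product is invariant under the rotations, so it comes from some P. If F vanishes
  along (t^n, b), its base change vanishes at all conjugates and is divisible by the product because
  these are distinct; the quotient is again invariant and descends.\<close>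

lemma conj_prod_descends:
  assumes n: "n > 0" and b: "fps_nth b 0 = 0" and inj: "inj_on (\<lambda>w. conj_series w b) {w. w ^ n = 1}"
  obtains P where "pw n P = conj_prod n b" "nonunit2 P" "eval2 P (fps_X ^ n) b = 0"
    "\<And>F. eval2 F (fps_X ^ n) b = 0 \<Longrightarrow> \<exists>H. F = P * H"
proof -
  obtain P where P: "conj_prod n b = pw n P"
    using pw_rot_invariant[OF n rot_conj_prod[OF n]] by blast
  have fin: "finite {w :: complex. w ^ n = 1}" using n by (rule finite_roots_1)
  have cb: "fps_nth (conj_series w b) 0 = 0" for w by (simp add: conj_series_nth b)
  have "c2 (conj_prod n b) 0 0 = (\<Prod>w | (w :: complex) ^ n = 1. 0)"
    by (simp add: conj_prod_def c2_prod_00 c2_YY c2_const_series conj_series_nth b)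
  also have "\<dots> = 0" using fin by (subst prod_zero_iff) (auto intro: exI[of _ 1])
  finally have "nonunit2 P" using n by (simp add: P nonunit2_def)
  have "eval2 (conj_prod n b) fps_X b = (\<Prod>w | w ^ n = 1. b - conj_series w b)"
    using b by (simp add: conj_prod_def eval2_prod eval2_diff eval2_fps_const)
  also have "\<dots> = 0" using fin by (subst prod_zero_iff) (auto intro: exI[of _ 1])
  finally have "eval2 P (fps_X ^ n) b = 0" using n b by (simp add: P eval2_pw)
  have "\<exists>H. F = P * H" if F: "eval2 F (fps_X ^ n) b = 0" for F
  proof -
    have "conj_prod n b dvd pw n F"
      unfolding conj_prod_def
    proof (rule linear_factors[OF fin inj])
      fix w :: complex assume w: "w \<in> {w. w ^ n = 1}"
      have "eval2 (pw n F) fps_X (conj_series w b) = eval2 F (fps_X ^ n) (conj_series w b)"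
        using n cb by (simp add: eval2_pw)
      also have "(fps_X :: complex fps) ^ n = fps_X ^ n oo (fps_const w * fps_X)"
        using w by (simp add: power_mult_distrib fps_const_power fps_X_power_compose)
      also have "eval2 F \<dots> (conj_series w b) = eval2 F (fps_X ^ n) b oo (fps_const w * fps_X)"
        using n b by (subst eval2_compose) (simp_all add: conj_series_def)
      finally show "eval2 (pw n F) fps_X (conj_series w b) = 0" using F by simp
    qed (rule cb)
    then obtain H where H: "pw n F = conj_prod n b * H" by (auto simp: dvd_def)
    have "rot v H = H" if "v ^ n = 1" for v
    proof -
      have "conj_prod n b * rot v H = rot v (conj_prod n b * H)"
        using n that by (simp add: rot_hom rot_conj_prod)
      also have "\<dots> = conj_prod n b * H"
        using n that by (simp add: rot_pw flip: H)
      finally show ?thesis using conj_prod_nonzero[OF n] by simp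
    qed
    then obtain H' where "H = pw n H'" using pw_rot_invariant[OF n] by blast
    then have "pw n F = pw n (P * H')" using n by (simp add: H P pw_hom)
    then show ?thesis using n by (auto simp: pw_eq_iff)
  qed
  then show ?thesis using that P \<open>nonunit2 P\<close> \<open>eval2 P (fps_X ^ n) b = 0\<close> by metis
qed

subsection \<open>Reparametrization\<close>

text \<open>The formal version of a parametrization being generically one-to-one.\<close>
definition primitive :: "complex fps \<Rightarrow> complex fps \<Rightarrow> bool" where
  "primitive a b \<longleftrightarrow> (\<forall>\<psi>. fps_nth \<psi> 0 = 0 \<longrightarrow> fps_nth \<psi> 1 \<noteq> 0 \<longrightarrow> a oo \<psi> = a \<longrightarrow> b oo \<psi> = b \<longrightarrow> \<psi> = fps_X)"

text \<open>Two equal conjugates would give a rotation by v / w that preserves the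
  parametrization.\<close>

lemma inj_on_conj_series:
  assumes n: "n > 0" and b: "fps_nth b 0 = 0" and prim: "primitive (fps_X ^ n) b"
  shows "inj_on (\<lambda>w. conj_series w b) {w. w ^ n = 1}"
proof (rule inj_onI)
  fix v w :: complex assume vw: "v \<in> {w. w ^ n = 1}" "w \<in> {w. w ^ n = 1}" "conj_series v b = conj_series w b"
  then have nz: "v \<noteq> 0" "w \<noteq> 0" using n by (auto simp: power_0_left)
  define \<psi> where "\<psi> = fps_const (v / w) * fps_X"
  have "b oo \<psi> = conj_series (v / w) b" by (simp add: conj_series_def \<psi>_def)
  also have "\<dots> = conj_series (1 / w) (conj_series v b)"
    by (simp add: conj_series_conj_series)
  also have "\<dots> = b" using nz by (simp add: vw(3) conj_series_conj_series)
  finally have "b oo \<psi> = b" .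
  moreover have "fps_X ^ n oo \<psi> = fps_X ^ n"
    using vw by (simp add: \<psi>_def fps_X_power_compose power_mult_distrib fps_const_power power_divide)
  moreover have "fps_nth \<psi> 0 = 0" "fps_nth \<psi> 1 \<noteq> 0" using nz by (simp_all add: \<psi>_def)
  ultimately have "\<psi> = fps_X" using prim unfolding primitive_def by blast
  then have "fps_nth \<psi> 1 = fps_nth fps_X 1" by simp
  then show "v = w" using nz by (simp add: \<psi>_def)
qed

lemma fps_inv_nth_0 [simp]: "fps_nth (fps_inv a) 0 = 0"
  by (simp add: fps_inv_def)

lemma fps_inv_nth_1:
  assumes "fps_nth a 0 = 0" "fps_nth a 1 \<noteq> 0"
  shows "fps_nth (fps_inv a) 1 \<noteq> 0"
proof
  assume "fps_nth (fps_inv a) 1 = 0"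
  then have "fps_nth (fps_inv a oo a) 1 = 0"
    using assms by (simp add: fps_compose_nth)
  then show False using fps_inv[OF assms] by simp
qed

lemma primitive_compose:
  assumes prim: "primitive a b" and e: "fps_nth e 0 = 0" "fps_nth e 1 \<noteq> 0"
  shows "primitive (a oo e) (b oo e)"
  unfolding primitive_def
proof (intro allI impI)
  fix \<psi> :: "complex fps"
  assume \<psi>: "fps_nth \<psi> 0 = 0" "fps_nth \<psi> 1 \<noteq> 0" "a oo e oo \<psi> = a oo e" "b oo e oo \<psi> = b oo e"
  define i where "i = fps_inv e"
  have i: "fps_nth i 0 = 0" "fps_nth i 1 \<noteq> 0" "i oo e = fps_X" "e oo i = fps_X"
    using e by (simp_all add: i_def fps_inv_nth_1[simplified] fps_inv fps_inv_right)
  define \<phi> where "\<phi> = e oo \<psi> oo i"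
  have "c oo \<phi> = c" if "c oo e oo \<psi> = c oo e" for c
  proof -
    have "c oo \<phi> = (c oo e oo \<psi>) oo i"
      using \<psi>(1) e(1) i(1) by (simp add: \<phi>_def fps_compose_assoc)
    also have "\<dots> = c oo (e oo i)"
      using e(1) i(1) that by (simp add: fps_compose_assoc)
    finally show ?thesis by (simp add: i)
  qed
  moreover have "fps_nth \<phi> 0 = 0" using e by (simp add: \<phi>_def)
  moreover have "fps_nth \<phi> 1 \<noteq> 0" using e \<psi> i by (simp add: \<phi>_def fps_compose_nth)
  ultimately have "\<phi> = fps_X" using prim \<psi> unfolding primitive_def by blast
  then have "e oo \<psi> oo i oo e = fps_X oo e" by (simp add: \<phi>_def)
  moreover have "e oo \<psi> oo i oo e = e oo \<psi>"
    using e(1) i by (simp add: fps_compose_assoc[symmetric])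
  ultimately have "e oo \<psi> = e" using e by simp
  then have "i oo e oo \<psi> = i oo e" using \<psi>(1) e(1) by (simp add: fps_compose_assoc[symmetric])
  then show "\<psi> = fps_X" using i \<psi>(1) by simp
qed

lemma formal_root_exists:
  fixes a :: "complex fps"
  assumes "subdegree a = n" "n > 0"
  obtains e where "fps_nth e 0 = 0" "fps_nth e 1 \<noteq> 0" "e ^ n = a"
proof -
  define a1 where "a1 = fps_shift n a"
  have a: "a = a1 * fps_X ^ n"
    using assms by (simp add: a1_def fps_shift_times_fps_X_power)
  have a1: "fps_nth a1 0 \<noteq> 0" using assms by (auto simp: a1_def)
  define z where "z = exp (Ln (fps_nth a1 0) / of_nat n)"
  have z: "z ^ n = fps_nth a1 0"
    using a1 assms by (simp add: z_def flip: exp_of_nat_mult)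
  obtain k where k: "n = Suc k" using assms by (cases n) auto
  define r where "r = fps_radical (\<lambda>_ _. z) n a1"
  have r: "r ^ n = a1"
    using power_radical[of a1 "\<lambda>_ _. z" k] a1 z by (simp add: r_def k)
  have "fps_nth r 0 \<noteq> 0"
    using r a1 by (metis fps_nth_power_0 assms(2) zero_power)
  show ?thesis
  proof
    show "(fps_X * r) ^ n = a" by (simp add: power_mult_distrib r a mult.commute)
  qed (use \<open>fps_nth r 0 \<noteq> 0\<close> in auto)
qed

section \<open>Convergence of inverses, roots and reparametrizations in one variable\<close>

definition conv :: "complex fps \<Rightarrow> bool" where "conv a \<longleftrightarrow> fps_conv_radius a > 0"

lemma conv_iff: "conv a \<longleftrightarrow> (\<exists>f. f has_fps_expansion a)"
  unfolding conv_def using eval_fps_has_fps_expansion has_fps_expansion_def by blast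

lemma conv_compose: "conv a \<Longrightarrow> conv s \<Longrightarrow> fps_nth s 0 = 0 \<Longrightarrow> conv (a oo s)"
  unfolding conv_iff by (blast intro: has_fps_expansion_compose)

text \<open>The analytic local inverse of the sum of e has a convergent expansion, and uniqueness of
  formal inverses identifies it with \<open>fps_inv e\<close>.\<close>

lemma conv_inv:
  assumes "conv e" "fps_nth e 0 = 0" "fps_nth e 1 \<noteq> 0"
  shows "conv (fps_inv e)"
proof -
  obtain f where f: "f has_fps_expansion e" using assms by (auto simp: conv_iff)
  obtain s where s: "open s" "0 \<in> s" "f holomorphic_on s"
    using has_fps_expansion_imp_holomorphic[OF f] by metis
  have f0: "f 0 = 0" using has_fps_expansion_imp_0_eq_fps_nth_0[OF f] assms by simp
  have "deriv f 0 \<noteq> 0" using fps_nth_fps_expansion[OF f, of 1] assms by simp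
  from has_complex_derivative_locally_injective[OF s(3,2,1) this]
  obtain r where r: "r > 0" "ball 0 r \<subseteq> s" "inj_on f (ball 0 r)" by metis
  have hol: "f holomorphic_on ball 0 r" using s(3) r(2) by (rule holomorphic_on_subset)
  from holomorphic_has_inverse[OF hol open_ball r(3)]
  obtain g where g: "g holomorphic_on f ` ball 0 r" "\<And>z. z \<in> ball 0 r \<Longrightarrow> g (f z) = z" by metis
  have "open (f ` ball 0 r)" by (rule open_mapping_thm3[OF hol open_ball r(3)])
  moreover have "0 \<in> f ` ball 0 r" using f0 r(1) by (metis centre_in_ball image_eqI)
  ultimately have "g analytic_on {0}" using g(1) by (auto simp: analytic_at)
  then have G: "g has_fps_expansion fps_expansion g 0" by (rule analytic_at_imp_has_fps_expansion_0)
  define G where "G = fps_expansion g 0"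
  have 1: "(g \<circ> f) has_fps_expansion (G oo e)"
    using G f assms unfolding G_def by (intro has_fps_expansion_compose)
  have ev: "eventually (\<lambda>z. z = (g \<circ> f) z) (nhds 0)"
    using eventually_nhds_in_open[of "ball 0 r" 0] r(1) by (auto elim!: eventually_mono simp: g(2))
  have "(\<lambda>z. z) has_fps_expansion (G oo e)"
    using 1 has_fps_expansion_cong[OF ev refl] by blast
  from fps_expansion_unique_complex[OF this has_fps_expansion_fps_X] have "G oo e = fps_X" .
  then have "G oo e oo fps_inv e = fps_inv e" by simp
  moreover have "G oo e oo fps_inv e = G"
    using assms by (simp add: fps_inv_right[simplified] flip: fps_compose_assoc)
  ultimately have "fps_inv e = G" by simp
  then show ?thesis using G by (auto simp: conv_iff G_def)
qed

text \<open>After splitting off a factor t, the root has a nonzero constant term z. The analytic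
  branch of the root with value z has the same n-th power and the same constant term, so uniqueness
  of radicals identifies the two.\<close>

lemma conv_root:
  fixes a :: "complex fps"
  assumes a: "conv a" and e: "fps_nth e 0 = 0" "fps_nth e 1 \<noteq> 0" "e ^ n = a" and n: "n > 0"
  shows "conv e"
proof -
  define r where "r = fps_shift 1 e"
  have "subdegree e \<ge> 1" using e by (intro subdegree_geI) (auto simp: fps_eq_iff)
  then have er: "e = r * fps_X" by (simp add: r_def fps_shift_times_fps_X del: One_nat_def)
  have r0: "fps_nth r 0 \<noteq> 0" using e by (simp add: r_def)
  have "r ^ n = fps_shift n a"
    by (simp add: e(3)[symmetric] er power_mult_distrib)
  then have "conv (r ^ n)" using a by (simp add: conv_def)
  then obtain f where f: "f has_fps_expansion r ^ n" by (auto simp: conv_iff)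
  define z where "z = fps_nth r 0"
  have f0: "f 0 = z ^ n" using has_fps_expansion_imp_0_eq_fps_nth_0[OF f] by (simp add: z_def fps_nth_power_0)
  have z: "z \<noteq> 0" using r0 by (simp add: z_def)
  have fa: "f analytic_on {0}" using f by (rule has_fps_expansion_imp_analytic_0)
  define g where "g = (\<lambda>t. z * exp (Ln (f t / z ^ n) / of_nat n))"
  have "g analytic_on {0}"
    unfolding g_def using fa z n by (intro analytic_intros) (auto simp: f0)
  then have G: "g has_fps_expansion fps_expansion g 0" by (rule analytic_at_imp_has_fps_expansion_0)
  define G where "G = fps_expansion g 0"
  have gn: "(\<lambda>t. g t ^ n) has_fps_expansion G ^ n"
    using G unfolding G_def by (intro fps_expansion_intros)
  have cont: "isCont f 0" using fa by (simp add: analytic_at_imp_isCont)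
  then have "(f \<longlongrightarrow> f 0) (nhds 0)" by (simp add: continuous_at tendsto_at_iff_tendsto_nhds)
  then have "eventually (\<lambda>t. f t \<noteq> 0) (nhds 0)"
    by (rule tendsto_imp_eventually_ne) (use z in \<open>simp add: f0\<close>)
  then have ev: "eventually (\<lambda>t. g t ^ n = f t) (nhds 0)"
    by eventually_elim (use z n in \<open>simp add: g_def power_mult_distrib flip: exp_of_nat_mult\<close>)
  have "f has_fps_expansion G ^ n"
    using gn has_fps_expansion_cong[OF ev refl] by blast
  then have Gn: "G ^ n = r ^ n" using f by (rule fps_expansion_unique_complex)
  have G0: "fps_nth G 0 = z"
    using has_fps_expansion_imp_0_eq_fps_nth_0[OF G] z by (simp add: G_def g_def f0)
  obtain k where k: "n = Suc k" using n by (cases n) auto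
  have "G = r"
  proof -
    have "x = fps_radical (\<lambda>_ _. z) (Suc k) (r ^ n)" if "x ^ n = r ^ n" "fps_nth x 0 = z" for x
      using that z radical_unique[of "\<lambda>_ _. z" k "r ^ n" x]
      by (simp add: z_def k fps_nth_power_0 del: power_Suc)
    from this[OF Gn G0] this[OF refl z_def[symmetric]]
    have "G = fps_radical (\<lambda>_ _. z) (Suc k) (r ^ n)" "r = fps_radical (\<lambda>_ _. z) (Suc k) (r ^ n)" .
    then show ?thesis by simp
  qed
  then have "conv r" using G by (auto simp: conv_iff G_def)
  then show ?thesis unfolding er conv_iff
    by (blast intro: has_fps_expansion_mult has_fps_expansion_fps_X)
qed

text \<open>Needed because \<open>primitive\<close> tests formal \<psi> while injectivity concerns
  functions. If e is an n-th root of g, then so is e o \<psi>; their ratio has n-th power 1, hence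
  derivative 0, hence is a constant w. So \<psi> is the inverse of e composed with w e.\<close>

lemma conv_compose_fixed:
  fixes g :: "complex fps"
  assumes g: "conv g" "g \<noteq> 0" "fps_nth g 0 = 0"
    and \<psi>: "fps_nth \<psi> 0 = 0" "fps_nth \<psi> 1 \<noteq> 0" "g oo \<psi> = g"
  shows "conv \<psi>"
proof -
  define n where "n = subdegree g"
  have n: "n > 0" using g by (auto simp: n_def subdegree_eq_0_iff intro!: Nat.gr0I)
  obtain e where e: "fps_nth e 0 = 0" "fps_nth e 1 \<noteq> 0" "e ^ n = g"
    using formal_root_exists[of g n] n by (auto simp: n_def)
  have ce: "conv e" by (rule conv_root[OF g(1) e n])
  define e' where "e' = e oo \<psi>"
  have e': "fps_nth e' 0 = 0" "fps_nth e' 1 \<noteq> 0" "e' ^ n = e ^ n"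
    using e \<psi> by (simp_all add: e'_def fps_compose_nth fps_compose_power)
  define s where "s = fps_shift 1 e"
  define s' where "s' = fps_shift 1 e'"
  have se: "e = s * fps_X" "e' = s' * fps_X"
    using e e' unfolding s_def s'_def
    by (subst fps_shift_times_fps_X; force intro: subdegree_geI simp del: One_nat_def)+
  have s0: "fps_nth s 0 \<noteq> 0" using e by (simp add: s_def)
  have "s' ^ n = s ^ n" using e'(3) by (simp add: se power_mult_distrib)
  define u where "u = s' * inverse s"
  have s'u: "s' = u * s" using s0 by (simp add: u_def mult.assoc inverse_mult_eq_1)
  have "s ^ n \<noteq> 0" using s0 by auto
  moreover have "u ^ n * s ^ n = 1 * s ^ n" using \<open>s' ^ n = s ^ n\<close> by (simp add: s'u power_mult_distrib)
  ultimately have un: "u ^ n = 1" by (rule mult_right_cancel[THEN iffD1])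
  then have "u \<noteq> 0" using n by (auto simp: power_0_left)
  have "fps_deriv (u ^ n) = 0" by (simp add: un)
  then have "fps_deriv u = 0" using \<open>u \<noteq> 0\<close> n by (simp add: fps_deriv_power)
  then obtain w where w: "u = fps_const w" by (metis fps_deriv_eq_0_iff)
  have "e oo \<psi> = s' * fps_X" unfolding e'_def[symmetric] by (rule se(2))
  also have "\<dots> = fps_const w * e" unfolding s'u w mult.assoc se(1)[symmetric] ..
  finally have "e oo \<psi> = fps_const w * e" .
  then have "fps_inv e oo (fps_const w * e) = fps_inv e oo (e oo \<psi>)" by simp
  also have "\<dots> = fps_inv e oo e oo \<psi>" using e \<psi> by (intro fps_compose_assoc)
  also have "\<dots> = \<psi>" using fps_inv[OF e(1,2)] \<psi> by simp
  finally have "\<psi> = fps_inv e oo (fps_const w * e)" ..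
  moreover have "conv (fps_const w * e)"
    using ce unfolding conv_iff by (blast intro: has_fps_expansion_cmult_left)
  ultimately show ?thesis using ce e by (metis conv_compose conv_inv fps_mult_nth_0 mult_zero_right)
qed

text \<open>Injectivity excludes a = b = 0, so a formal reparametrization \<psi> fixes a nonzero
  component and therefore converges; near 0 injectivity then forces \<psi>(t) = t.\<close>

lemma primitive_param_imp_primitive:
  assumes "primitive_param a b p"
  shows "primitive a b"
  unfolding primitive_def
proof (intro allI impI)
  fix \<psi> :: "complex fps"
  assume \<psi>: "fps_nth \<psi> 0 = 0" "fps_nth \<psi> 1 \<noteq> 0" "a oo \<psi> = a" "b oo \<psi> = b"
  have ab: "conv a" "conv b" "fps_nth a 0 = 0" "fps_nth b 0 = 0"
    using assms by (simp_all add: primitive_param_def conv_def)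
  obtain \<epsilon> where \<epsilon>: "\<epsilon> > 0" "inj_on (\<lambda>t. (eval_fps a t, eval_fps b t)) (ball 0 \<epsilon>)"
    using assms by (auto simp: primitive_param_def)
  have "a \<noteq> 0 \<or> b \<noteq> 0"
  proof (rule ccontr)
    assume "\<not> (a \<noteq> 0 \<or> b \<noteq> 0)"
    then have "(0::complex) = of_real (\<epsilon> / 2)"
      using \<epsilon> by (intro inj_onD[OF \<epsilon>(2)]) auto
    then show False using \<epsilon>(1) by (metis half_gt_zero less_irrefl of_real_eq_0_iff)
  qed
  then have "conv \<psi>" using conv_compose_fixed ab \<psi> by blast
  then have E: "eval_fps \<psi> has_fps_expansion \<psi>" unfolding conv_def by (rule eval_fps_has_fps_expansion)
  have ev: "eventually (\<lambda>t. eval_fps c (eval_fps \<psi> t) = eval_fps c t) (nhds 0)"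
    if "conv c" "c oo \<psi> = c" for c
  proof -
    have "(eval_fps c \<circ> eval_fps \<psi>) has_fps_expansion (c oo \<psi>)"
      using that(1) unfolding conv_def
      by (intro has_fps_expansion_compose[OF eval_fps_has_fps_expansion E \<psi>(1)])
    then show ?thesis
      unfolding that(2) has_fps_expansion_def by (auto elim: eventually_mono)
  qed
  have "isCont (eval_fps \<psi>) 0" using has_fps_expansion_imp_continuous[OF E, of UNIV] by simp
  then have "(eval_fps \<psi> \<longlongrightarrow> eval_fps \<psi> 0) (nhds 0)"
    by (simp add: continuous_at tendsto_at_iff_tendsto_nhds)
  then have "(eval_fps \<psi> \<longlongrightarrow> 0) (nhds 0)" using \<psi>(1) by (simp add: eval_fps_at_0)
  from tendstoD[OF this \<epsilon>(1)] have "eventually (\<lambda>t. eval_fps \<psi> t \<in> ball 0 \<epsilon>) (nhds 0)" by simp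
  moreover have "eventually (\<lambda>t. t \<in> ball 0 \<epsilon>) (nhds (0::complex))"
    using \<epsilon>(1) by (intro eventually_nhds_in_open) auto
  ultimately have "eventually (\<lambda>t. eval_fps \<psi> t = t) (nhds 0)"
    using ev[OF ab(1) \<psi>(3)] ev[OF ab(2) \<psi>(4)]
  proof eventually_elim
    case (elim t)
    then have "(eval_fps a (eval_fps \<psi> t), eval_fps b (eval_fps \<psi> t)) = (eval_fps a t, eval_fps b t)" by simp
    from inj_onD[OF \<epsilon>(2) this elim(1,2)] show ?case .
  qed
  then have "(\<lambda>t. t) has_fps_expansion \<psi>" using E by (simp add: has_fps_expansion_def)
  then show "\<psi> = fps_X" using has_fps_expansion_fps_X by (rule fps_expansion_unique_complex)
qed

subsection \<open>Convergence of quotients\<close>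

lemma conv_bound:
  assumes "conv b"
  obtains C R where "C \<ge> 1" "R \<ge> 1" "\<And>i. norm (fps_nth b i) \<le> C * R ^ i"
proof -
  obtain r where r: "r > 0" "ereal r < fps_conv_radius b"
    using assms ereal_dense2[of 0 "fps_conv_radius b"] by (auto simp: conv_def zero_ereal_def)
  have "summable (\<lambda>n. fps_nth b n * of_real r ^ n)"
    using r by (intro summable_fps) auto
  then have "Bseq (\<lambda>n. fps_nth b n * of_real r ^ n)"
    by (intro summable_imp_Bseq)
  then obtain K where K: "K > 0" "\<And>n. norm (fps_nth b n * of_real r ^ n) \<le> K"
    by (auto simp: Bseq_def)
  define R where "R = max 1 (1 / r)"
  have "norm (fps_nth b i) \<le> max 1 K * R ^ i" for i
  proof -
    have "norm (fps_nth b i) * r ^ i \<le> K"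
      using K(2)[of i] r(1) by (simp add: norm_mult norm_power)
    then have "norm (fps_nth b i) \<le> K * (1 / r) ^ i"
      using r by (simp add: field_simps power_one_over)
    also have "\<dots> \<le> max 1 K * R ^ i"
      using r K by (intro mult_mono power_mono) (auto simp: R_def)
    finally show ?thesis .
  qed
  then show ?thesis by (intro that[of "max 1 K" R]) (auto simp: R_def)
qed

text \<open>Doubling R leaves a geometric sum of ratio 1/2, of value at most 2, so each
  multiplication costs a factor 2 C independent of i.\<close>

lemma norm_power_coeff_bound:
  fixes b :: "complex fps"
  assumes "C \<ge> 0" "R \<ge> 0" "\<And>i. norm (fps_nth b i) \<le> C * R ^ i"
  shows "norm (fps_nth (b ^ k) i) \<le> (2 * C) ^ k * (2 * R) ^ i"
proof (induction k arbitrary: i)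
  case 0
  then show ?case using assms by (cases "i = 0") auto
next
  case (Suc k)
  have "norm (fps_nth (b ^ Suc k) i) \<le> (\<Sum>l=0..i. norm (fps_nth b l) * norm (fps_nth (b ^ k) (i - l)))"
    by (simp only: power_Suc fps_mult_nth norm_mult[symmetric] norm_sum)
  also have "\<dots> \<le> (\<Sum>l=0..i. (C * R ^ l) * ((2 * C) ^ k * (2 * R) ^ (i - l)))"
    by (rule sum_mono, rule mult_mono[OF assms(3) Suc.IH]) (use assms(1,2) in simp_all)
  also have "\<dots> = (\<Sum>l=0..i. C * (2 * C) ^ k * (2 * R) ^ i * (1 / 2) ^ l)"
  proof (intro sum.cong refl)
    fix l assume "l \<in> {0..i}"
    then have "(2 * R) ^ i = (2 * R) ^ (i - l + l)" by simp
    also have "\<dots> = (2 * R) ^ (i - l) * (2 ^ l * R ^ l)" by (simp only: power_add power_mult_distrib)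
    finally have *: "(2 * R) ^ i = (2 * R) ^ (i - l) * (2 ^ l * R ^ l)" .
    have "(2 :: real) ^ l * (1 / 2) ^ l = 1" by (simp add: power_one_over)
    then show "C * R ^ l * ((2 * C) ^ k * (2 * R) ^ (i - l)) = C * (2 * C) ^ k * (2 * R) ^ i * (1 / 2) ^ l"
      unfolding * by (simp add: mult_ac)
  qed
  also have "\<dots> = C * (2 * C) ^ k * (2 * R) ^ i * (\<Sum>l=0..i. (1 / 2) ^ l)"
    by (simp add: sum_distrib_left)
  also have "\<dots> \<le> C * (2 * C) ^ k * (2 * R) ^ i * 2"
  proof (intro mult_left_mono)
    have "(\<Sum>l=0..i. (1 / 2 :: real) ^ l) = 2 - (1 / 2) ^ i"
      by (induction i) auto
    then show "(\<Sum>l=0..i. (1 / 2 :: real) ^ l) \<le> 2" by simp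
  qed (use assms in auto)
  finally show ?case by (simp add: mult_ac)
qed

text \<open>Comparing powers of y gives H_j = G_(j+1) + b H_(j+1). Iterating i + 1 times leaves a
  remainder with factor b^(i+1), which has no x^i term, so each coefficient of H is a finite sum
  that can be estimated.\<close>

lemma convergent_linear_quotient:
  assumes G: "fps2_convergent G" and b: "conv b" "fps_nth b 0 = 0"
    and eq: "G = (YY - fps_const b) * H"
  shows "fps2_convergent H"
proof -
  obtain C R1 where C: "C \<ge> 1" "R1 \<ge> 1" "\<And>i. norm (fps_nth b i) \<le> C * R1 ^ i"
    using conv_bound[OF b(1)] by metis
  obtain D R2 where D: "D \<ge> 0" "R2 \<ge> 1" "\<And>i j. norm (fps_nth (fps_nth G j) i) \<le> D * R2 ^ (i + j)"
    using fps2_convergentE[OF G] by metis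
  define R where "R = max R1 R2"
  have R: "R \<ge> 1" using C by (simp add: R_def)
  have C': "norm (fps_nth b i) \<le> C * R ^ i" for i
  proof -
    have "C * R1 ^ i \<le> C * R ^ i" using C by (intro mult_left_mono power_mono) (auto simp: R_def)
    then show ?thesis using C(3)[of i] by linarith
  qed
  have D': "norm (fps_nth (fps_nth G j) i) \<le> D * R ^ (i + j)" for i j
  proof -
    have "D * R2 ^ (i + j) \<le> D * R ^ (i + j)" using D by (intro mult_left_mono power_mono) (auto simp: R_def)
    then show ?thesis using D(3)[of j i] by linarith
  qed
  have step: "fps_nth H j = fps_nth G (Suc j) + b * fps_nth H (Suc j)" for j
    by (simp add: eq YY_def left_diff_distrib)
  have iter: "fps_nth H j = (\<Sum>k<m. b ^ k * fps_nth G (Suc (j + k))) + b ^ m * fps_nth H (j + m)" for j m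
  proof (induction m)
    case (Suc m)
    have "b ^ m * fps_nth H (j + m) = b ^ m * fps_nth G (Suc (j + m)) + b ^ Suc m * fps_nth H (Suc (j + m))"
      by (subst step) (simp add: algebra_simps)
    with Suc show ?case by simp
  qed simp
  show ?thesis
  proof (rule fps2_convergentI)
    fix i j
    have "fps_nth (b ^ Suc i) l = 0" if "l \<le> i" for l
      using startsby_zero_power_prefix[OF b(2), of "Suc i"] that by (auto simp del: power_Suc)
    then have "fps_nth (b ^ Suc i * fps_nth H (j + Suc i)) i = 0"
      by (simp only: fps_mult_nth) (intro sum.neutral; simp)
    then have "fps_nth (fps_nth H j) i = (\<Sum>k<Suc i. fps_nth (b ^ k * fps_nth G (Suc (j + k))) i)"
      by (subst iter[of j "Suc i"]) (simp only: fps_add_nth fps_sum_nth add_0_right)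
    also have "norm \<dots> \<le> (\<Sum>k<Suc i. \<Sum>l=0..i. norm (fps_nth (b ^ k) l) * norm (fps_nth (fps_nth G (Suc (j + k))) (i - l)))"
      by (intro sum_norm_le) (simp only: fps_mult_nth norm_mult[symmetric] norm_sum)
    also have "\<dots> \<le> (\<Sum>k<Suc i. \<Sum>l=0..i. ((2 * C) ^ k * (2 * R) ^ l) * (D * R ^ (i - l + Suc (j + k))))"
      using C R D by (intro sum_mono mult_mono D' norm_power_coeff_bound C') auto
    also have "\<dots> \<le> (\<Sum>k<Suc i. \<Sum>l=0..i. D * R * (2 * C) ^ i * 2 ^ i * R ^ (2 * i + j))"
    proof (intro sum_mono)
      fix k l assume k: "k \<in> {..<Suc i}" and l: "l \<in> {0..i}"
      have e: "l + (i - l + Suc (j + k)) = Suc (i + j + k)" using l by simp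
      have "(2 * C) ^ k * (2 * R) ^ l * (D * R ^ (i - l + Suc (j + k)))
          = (2 * C) ^ k * 2 ^ l * (D * R ^ Suc (i + j + k))"
        unfolding e[symmetric] power_add[of R l] power_mult_distrib[of 2 R] by (simp only: mult_ac)
      also have "\<dots> \<le> (2 * C) ^ i * 2 ^ i * (D * R ^ Suc (2 * i + j))"
        using C R D k l by (intro mult_mono power_increasing) auto
      finally show "(2 * C) ^ k * (2 * R) ^ l * (D * R ^ (i - l + Suc (j + k)))
          \<le> D * R * (2 * C) ^ i * 2 ^ i * R ^ (2 * i + j)" by (simp add: mult_ac)
    qed
    also have "\<dots> = D * R * (2 * C) ^ i * 2 ^ i * R ^ (2 * i + j) * (real (i + 1) * real (i + 1))"
      by simp
    also have "\<dots> \<le> D * R * (2 * C) ^ i * 2 ^ i * R ^ (2 * i + j) * (2 ^ i * 2 ^ i)"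
      using C R D by (intro mult_left_mono mult_mono Suc_le_two_power) auto
    \<comment> \<open>The 16 collects 2^i from the powers of b, 2^i from the doubled radius and 4^i
      from the number of terms.\<close>
    also have "\<dots> = D * R * ((16 * C) ^ i * R ^ (2 * i + j))"
    proof -
      have "(16 * C) ^ i = ((2 * C) * 2 * (2 * 2)) ^ i" by simp
      also have "\<dots> = (2 * C) ^ i * 2 ^ i * (2 ^ i * 2 ^ i)" by (simp only: power_mult_distrib)
      finally have *: "(16 * C) ^ i = (2 * C) ^ i * 2 ^ i * (2 ^ i * 2 ^ i)" .
      show ?thesis unfolding * by (simp only: mult_ac)
    qed
    also have "\<dots> \<le> D * R * ((16 * C) ^ (i + j) * R ^ (2 * (i + j)))"
      using C R D by (intro mult_left_mono mult_mono power_increasing) auto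
    also have "\<dots> = D * R * (16 * C * R ^ 2) ^ (i + j)"
      by (simp only: power_mult_distrib power_mult)
    finally show "norm (fps_nth (fps_nth H j) i) \<le> D * R * (16 * C * R\<^sup>2) ^ (i + j)" .
  qed
qed

lemma convergent_product_quotient:
  assumes "finite S" "\<And>s. s \<in> S \<Longrightarrow> conv (g s)" "\<And>s. s \<in> S \<Longrightarrow> fps_nth (g s) 0 = 0"
    and "fps2_convergent ((\<Prod>s\<in>S. YY - fps_const (g s)) * H)"
  shows "fps2_convergent H"
  using assms
proof (induction S rule: finite_induct)
  case (insert s S)
  let ?G = "(\<Prod>s\<in>S. YY - fps_const (g s)) * H"
  have "fps2_convergent ((YY - fps_const (g s)) * ?G)"
    using insert.prems(3) insert.hyps by (simp add: mult.assoc)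
  from convergent_linear_quotient[OF this _ _ refl] have "fps2_convergent ?G"
    using insert.prems(1,2) by blast
  then show ?case using insert.IH insert.prems(1,2) by blast
qed simp

lemma fps2_convergent_fps_const:
  assumes "conv b"
  shows "fps2_convergent (fps_const b)"
proof -
  obtain C R where "C \<ge> 1" "R \<ge> 1" "\<And>i. norm (fps_nth b i) \<le> C * R ^ i"
    using conv_bound[OF assms] by metis
  then show ?thesis by (intro fps2_convergentI[of _ C R]) auto
qed

lemma fps2_convergent_XX: "fps2_convergent XX"
  unfolding XX_def by (rule fps2_convergent_fps_const) (simp add: conv_def)

lemma fps2_convergent_YY: "fps2_convergent YY"
  by (rule fps2_convergentI[of _ 1 1]) (auto simp: YY_def fps_X_def)

lemma fps2_convergent_prod: "(\<And>s. s \<in> S \<Longrightarrow> fps2_convergent (f s)) \<Longrightarrow> fps2_convergent (prod f S)"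
  by (induction S rule: infinite_finite_induct) (auto intro: fps2_convergent_1 fps2_convergent_mult)

lemma fps2_convergent_pw_iff:
  assumes n: "n > 0"
  shows "fps2_convergent (pw n F) \<longleftrightarrow> fps2_convergent F"
proof
  assume "fps2_convergent F"
  from fps2_convergentE[OF this] obtain C R
    where C: "C \<ge> 0" "R \<ge> 1" "\<And>i j. norm (fps_nth (fps_nth F j) i) \<le> C * R ^ (i + j)" by blast
  show "fps2_convergent (pw n F)"
  proof (rule fps2_convergentI)
    fix i j
    have "norm (c2 (pw n F) i j) \<le> norm (c2 F (i div n) j)" using n by (simp add: c2_pw)
    also have "\<dots> \<le> C * R ^ (i div n + j)" unfolding c2_def by (rule C(3))
    also have "\<dots> \<le> C * R ^ (i + j)" using C(1,2) by (intro mult_left_mono power_increasing) auto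
    finally show "norm (fps_nth (fps_nth (pw n F) j) i) \<le> C * R ^ (i + j)" by (simp only: c2_def)
  qed
next
  assume "fps2_convergent (pw n F)"
  from fps2_convergentE[OF this] obtain C R
    where C: "C \<ge> 0" "R \<ge> 1" "\<And>i j. norm (fps_nth (fps_nth (pw n F) j) i) \<le> C * R ^ (i + j)" by blast
  show "fps2_convergent F"
  proof (rule fps2_convergentI)
    fix i j
    have "norm (c2 F i j) = norm (c2 (pw n F) (n * i) j)" using n by (simp add: c2_pw)
    also have "\<dots> \<le> C * R ^ (n * i + j)" unfolding c2_def by (rule C(3))
    also have "\<dots> \<le> C * R ^ (n * (i + j))"
      using C(1,2) n by (intro mult_left_mono power_increasing) (auto simp: distrib_left)
    finally show "norm (fps_nth (fps_nth F j) i) \<le> C * (R ^ n) ^ (i + j)" by (simp only: c2_def power_mult)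
  qed
qed

lemma conv_conj_series: "conv b \<Longrightarrow> conv (conj_series w b)"
  unfolding conj_series_def
  by (rule conv_compose) (auto simp: conv_iff intro: has_fps_expansion_cmult_left[OF has_fps_expansion_fps_X])

lemma XX_dvd_iff: "XX dvd F \<longleftrightarrow> (\<forall>j. c2 F 0 j = 0)"
proof
  assume "XX dvd F"
  then obtain G where "F = XX * G" by (auto simp: dvd_def)
  then show "\<forall>j. c2 F 0 j = 0" by (simp add: c2_def XX_def)
next
  assume F: "\<forall>j. c2 F 0 j = 0"
  have "F = XX * Abs_fps (\<lambda>j. fps_shift 1 (fps_nth F j))"
  proof (rule c2_eqI)
    fix i j show "c2 F i j = c2 (XX * Abs_fps (\<lambda>j. fps_shift 1 (fps_nth F j))) i j"
      using F[rule_format, of j] by (cases i) (simp_all add: c2_def XX_def)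
  qed
  then show "XX dvd F" by (metis dvd_triv_left)
qed

lemma convergent_XX_quotient: "fps2_convergent (XX * H) \<Longrightarrow> fps2_convergent H"
  by (erule fps2_convergent_deriv_aux[where a = 1 and b = 0]) (simp add: XX_def algebra_simps)

text \<open>If a = 0 the curve is the line x = 0 and x generates. Otherwise a root e of a is a
  parameter in which the first component is t^n, and the product over the conjugates descends to a
  generator. Convergence passes through linear factors, quotients by them, and base change in both
  directions.\<close>

lemma kernel_generator:
  assumes conv: "conv a" "conv b" and ab: "fps_nth a 0 = 0" "fps_nth b 0 = 0" and prim: "primitive a b"
  obtains P where "fps2_convergent P" "nonunit2 P"
    "\<And>F. eval2 F a b = 0 \<Longrightarrow> \<exists>H. F = P * H \<and> (fps2_convergent F \<longrightarrow> fps2_convergent H)"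
proof (cases "a = 0")
  case True
  have "b \<noteq> 0"
  proof
    assume "b = 0"
    \<comment> \<open>If both components vanished, t \<mapsto> 2 t would be a nontrivial
      reparametrization.\<close>
    with True prim[unfolded primitive_def, rule_format, of "fps_const 2 * fps_X"]
    have "fps_const (2 :: complex) * fps_X = fps_X" by simp
    then have "fps_nth (fps_const (2 :: complex) * fps_X) 1 = fps_nth (fps_X :: complex fps) 1" by (rule arg_cong)
    then show False by simp
  qed
  have "\<exists>H. F = XX * H \<and> (fps2_convergent F \<longrightarrow> fps2_convergent H)" if F: "eval2 F a b = 0" for F
  proof -
    \<comment> \<open>The restriction F(0, y), whose composition with b is the value of F along the
      curve.\<close>
    define F0 where "F0 = Abs_fps (\<lambda>j. c2 F 0 j)"
    have "fps_nth (F0 oo b) n = 0" for n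
    proof -
      have "0 = (\<Sum>i\<le>n. \<Sum>j\<le>n. c2 F i j * fps_nth (a ^ i * b ^ j) n)"
        using arg_cong[OF F, of "\<lambda>s. fps_nth s n"] by (simp add: eval2_def)
      also have "\<dots> = (\<Sum>i\<le>n. if i = 0 then \<Sum>j\<le>n. c2 F i j * fps_nth (b ^ j) n else 0)"
        by (intro sum.cong refl) (auto simp: True power_0_left)
      also have "\<dots> = fps_nth (F0 oo b) n" by (simp add: F0_def fps_compose_nth atLeast0AtMost)
      finally show ?thesis ..
    qed
    then have "F0 oo b = 0" by (simp add: fps_eq_iff)
    then have "F0 = 0" using ab \<open>b \<noteq> 0\<close> by (simp add: fps_compose_eq_0_iff)
    then have "\<forall>j. c2 F 0 j = 0" by (simp add: F0_def fps_eq_iff)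
    then have "XX dvd F" using XX_dvd_iff by blast
    then obtain H where "F = XX * H" by (elim dvdE)
    then show ?thesis using convergent_XX_quotient by blast
  qed
  then show ?thesis using that[OF fps2_convergent_XX nonunit2_XX] by blast
next
  case False
  define n where "n = subdegree a"
  have n: "n > 0" using False ab by (auto simp: n_def subdegree_eq_0_iff intro!: Nat.gr0I)
  obtain e where e: "fps_nth e 0 = 0" "fps_nth e 1 \<noteq> 0" "e ^ n = a"
    using formal_root_exists[of a n] n by (auto simp: n_def)
  have ce: "conv e" by (rule conv_root[OF conv(1) e n])
  define i where "i = fps_inv e"
  have i: "fps_nth i 0 = 0" "fps_nth i 1 \<noteq> 0" "conv i"
    using fps_inv_nth_1[OF e(1,2)] conv_inv[OF ce e(1,2)] by (simp_all add: i_def)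
  define \<beta> where "\<beta> = b oo i"
  have \<beta>: "conv \<beta>" "fps_nth \<beta> 0 = 0" using conv i ab by (simp_all add: \<beta>_def conv_compose)
  have ai: "a oo i = fps_X ^ n"
    using fps_inv_right[OF e(1,2)] i by (simp add: i_def flip: e(3) fps_compose_power)
  have "primitive (fps_X ^ n) \<beta>"
    using primitive_compose[OF prim i(1,2)] by (simp add: ai \<beta>_def)
  from inj_on_conj_series[OF n \<beta>(2) this] obtain P
    where P: "pw n P = conj_prod n \<beta>" "nonunit2 P" "\<And>F. eval2 F (fps_X ^ n) \<beta> = 0 \<Longrightarrow> \<exists>H. F = P * H"
    using conj_prod_descends[OF n \<beta>(2)] by metis
  have lin: "conv (conj_series w \<beta>)" "fps_nth (conj_series w \<beta>) 0 = 0" for w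
    using \<beta> by (simp_all add: conv_conj_series conj_series_nth)
  have "fps2_convergent (conj_prod n \<beta>)"
    unfolding conj_prod_def
    by (intro fps2_convergent_prod fps2_convergent_diff fps2_convergent_YY fps2_convergent_fps_const lin)
  then have "fps2_convergent P" using fps2_convergent_pw_iff[OF n, of P] by (simp add: P(1))
  moreover have "\<exists>H. F = P * H \<and> (fps2_convergent F \<longrightarrow> fps2_convergent H)" if F: "eval2 F a b = 0" for F
  proof -
    have "eval2 F (fps_X ^ n) \<beta> = eval2 F a b oo i"
      using ab i by (simp add: eval2_compose ai \<beta>_def)
    then obtain H where H: "F = P * H" using P(3) F by auto
    have "fps2_convergent H" if "fps2_convergent F"
    proof -
      have "fps2_convergent (conj_prod n \<beta> * pw n H)"
        using that fps2_convergent_pw_iff[OF n, of F] pw_hom(1)[OF n, of P H] by (simp add: H P(1))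
      then have "fps2_convergent (pw n H)"
        unfolding conj_prod_def by (rule convergent_product_quotient[OF finite_roots_1[OF n] lin])
      then show ?thesis using fps2_convergent_pw_iff[OF n] by simp
    qed
    with H show ?thesis by blast
  qed
  ultimately show ?thesis using that P(2) by blast
qed

subsection \<open>The ring of convergent series\<close>

lemma fps2_of_simps [simp]:
  "fps2_of (F * G) = fps2_of F * fps2_of G" "fps2_of (F + G) = fps2_of F + fps2_of G"
  "fps2_of (F - G) = fps2_of F - fps2_of G" "fps2_of 1 = 1" "fps2_of 0 = 0"
  by (simp_all add: times_cps2.rep_eq plus_cps2.rep_eq minus_cps2.rep_eq one_cps2.rep_eq zero_cps2.rep_eq)

lemma fps2_of_power [simp]: "fps2_of (F ^ n) = fps2_of F ^ n"
  by (induction n) simp_all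

lemma fps2_of_prod_list: "fps2_of (prod_list Fs) = prod_list (map fps2_of Fs)"
  by (induction Fs) simp_all

lemma fps2_of_dvd: "F dvd G \<Longrightarrow> fps2_of F dvd fps2_of G"
  by (auto simp: dvd_def)

lemma convergent_fps2_of [simp]: "fps2_convergent (fps2_of F)"
  using fps2_of by simp

lemma fps2_of_polar: "fps2_of (polar l f) = pol (fps2_of l) (fps2_of f)"
  by (simp add: polar_def pol_def deriv_x.rep_eq deriv_y.rep_eq dx_def dy_def)

lemma coeff2_c2: "coeff2 F i j = c2 (fps2_of F) i j"
  by (simp add: coeff2_def c2_def)

lemma unit_cps2_imp: "F dvd 1 \<Longrightarrow> c2 (fps2_of F) 0 0 \<noteq> 0"
  using fps2_of_dvd[of F 1] by (simp add: unit2_iff)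

text \<open>p lies in the kernel, so it is the convergent generator times a convergent series; as
  the generator is not a unit, irreducibility makes the cofactor one. Formal elements of the kernel
  are then divisible formally, convergent ones within the convergent ring.\<close>

lemma param_kernel:
  assumes p: "irreducible p" and param: "primitive_param a b p"
  shows "eval2 F a b = 0 \<Longrightarrow> fps2_of p dvd F"
    and "eval2 (fps2_of G) a b = 0 \<Longrightarrow> p dvd G"
proof -
  have ab: "conv a" "conv b" "fps_nth a 0 = 0" "fps_nth b 0 = 0" "eval2 (fps2_of p) a b = 0"
    using param by (simp_all add: primitive_param_def conv_def subst2_eq_eval2)
  obtain P where P: "fps2_convergent P" "nonunit2 P"
    "\<And>F. eval2 F a b = 0 \<Longrightarrow> \<exists>H. F = P * H \<and> (fps2_convergent F \<longrightarrow> fps2_convergent H)"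
    using kernel_generator[OF ab(1-4) primitive_param_imp_primitive[OF param]] by metis
  obtain Q where Q: "fps2_of p = P * Q" "fps2_convergent Q"
    using P(3)[OF ab(5)] by auto
  define P' Q' where "P' = Abs_cps2 P" and "Q' = Abs_cps2 Q"
  have P': "fps2_of P' = P" and Q': "fps2_of Q' = Q"
    using P(1) Q(2) by (simp_all add: P'_def Q'_def Abs_cps2_inverse)
  have pPQ: "p = P' * Q'" using Q(1) by (simp add: fps2_of_inject[symmetric] P' Q')
  have "\<not> P' dvd 1" using unit_cps2_imp[of P'] P(2) by (auto simp: P' nonunit2_def)
  moreover have "P' dvd 1 \<or> Q' dvd 1" by (rule irreducibleD[OF p pPQ])
  ultimately have "Q' dvd 1" by simp
  then obtain V where V: "1 = Q' * V" by (elim dvdE)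
  have "P' = p * V" unfolding pPQ mult.assoc V[symmetric] by simp
  then have "p dvd P'" by (rule dvdI)
  show "fps2_of p dvd F" if F0: "eval2 F a b = 0"
  proof -
    obtain H where "F = P * H" using P(3)[OF F0] by blast
    moreover have "fps2_of p dvd P" using fps2_of_dvd[OF \<open>p dvd P'\<close>] by (simp only: P')
    ultimately show ?thesis by (simp only: dvd_mult2)
  qed
  show "p dvd G" if G0: "eval2 (fps2_of G) a b = 0"
  proof -
    obtain H where "fps2_of G = P * H" "fps2_convergent H" using P(3)[OF G0] by auto
    then have "G = P' * Abs_cps2 H"
      by (simp add: fps2_of_inject[symmetric] P' Abs_cps2_inverse)
    with \<open>p dvd P'\<close> show ?thesis by (simp only: dvd_mult2)
  qed
qed

lemma sum_half_powers: "(\<Sum>k\<le>i. (1 / 2 :: real) ^ k) = 2 - (1 / 2) ^ i"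
  by (induction i) auto

lemma fps2_convergent_inverse:
  assumes F: "fps2_convergent F" and FG: "F * G = 1"
  shows "fps2_convergent G"
proof -
  obtain C R where C: "C \<ge> 0" "R \<ge> 1" "\<And>i j. norm (fps_nth (fps_nth F j) i) \<le> C * R ^ (i + j)"
    using fps2_convergentE[OF F] by metis
  define f0 where "f0 = c2 F 0 0"
  have fg: "f0 * c2 G 0 0 = 1" unfolding f0_def by (metis FG c2_1 c2_mult_00)
  then have f0: "norm f0 > 0" by auto
  \<comment> \<open>In the convolution the terms other than the one with f0 are bounded by E S^(i+j)
    C (2 / T) times two geometric sums, each at most 2. T is chosen so that the resulting factor 8 C
    / T is at most |f0|, which closes the induction.\<close>
  define T where "T = max 2 (8 * C / norm f0)"
  have T: "T \<ge> 2" "C * 8 / T \<le> norm f0"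
    using f0 by (auto simp: T_def field_simps max_def)
  define S where "S = R * T"
  have S: "S > 0" using C T by (simp add: S_def)
  define E where "E = 1 / norm f0"
  have E: "E > 0" using f0 by (simp add: E_def)
  have small: "R ^ m \<le> S ^ m * (2 / T * (1 / 2) ^ m)" if m: "m > 0" for m
  proof -
    obtain m' where m': "m = Suc m'" using m by (cases m) auto
    have "1 = T ^ m * (1 / T) ^ m" using T by (simp add: power_one_over)
    also have "\<dots> \<le> T ^ m * (2 / T * (1 / 2) ^ m)"
    proof (intro mult_left_mono)
      have "(1 / T) ^ m' \<le> (1 / 2) ^ m'" using T by (intro power_mono) (auto simp: field_simps)
      then have "1 / T * (1 / T) ^ m' \<le> 1 / T * (1 / 2) ^ m'" using T by (intro mult_left_mono) auto
      then show "(1 / T) ^ m \<le> 2 / T * (1 / 2) ^ m" by (simp add: m')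
    qed (use T in simp)
    finally have "R ^ m * 1 \<le> R ^ m * (T ^ m * (2 / T * (1 / 2) ^ m))"
      using C by (intro mult_left_mono) auto
    then show ?thesis by (simp only: S_def power_mult_distrib mult.assoc mult_1_right)
  qed
  have bound: "norm (c2 G i j) \<le> E * S ^ (i + j)" for i j
  proof (induction "i + j" arbitrary: i j rule: less_induct)
    case less
    show ?case
    proof (cases "i + j = 0")
      case True
      have "norm f0 * norm (c2 G 0 0) = 1" using fg by (metis norm_mult norm_one)
      then have "norm (c2 G 0 0) = E" using f0 by (simp add: E_def field_simps)
      then show ?thesis using True by simp
    next
      case False
      define t where "t = (\<lambda>k l. if k = 0 \<and> l = 0 then 0 else c2 F k l * c2 G (i - k) (j - l))"
      have "0 = c2 (F * G) i j" using False by (auto simp: FG c2_1)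
      also have "\<dots> = (\<Sum>l\<le>j. \<Sum>k\<le>i. t k l + (if l = 0 then (if k = 0 then f0 * c2 G i j else 0) else 0))"
        unfolding c2_mult by (intro sum.cong refl) (auto simp: t_def f0_def)
      also have "\<dots> = (\<Sum>l\<le>j. \<Sum>k\<le>i. t k l) + f0 * c2 G i j"
      proof -
        have "(\<Sum>k\<le>i. if l = 0 then (if k = 0 then f0 * c2 G i j else 0) else 0)
            = (if l = 0 then f0 * c2 G i j else 0)" for l :: nat by simp
        then show ?thesis by (simp add: sum.distrib)
      qed
      finally have "f0 * c2 G i j = - (\<Sum>l\<le>j. \<Sum>k\<le>i. t k l)" by (simp add: eq_neg_iff_add_eq_0 add.commute)
      then have "norm f0 * norm (c2 G i j) = norm (\<Sum>l\<le>j. \<Sum>k\<le>i. t k l)" by (metis norm_minus_cancel norm_mult)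
      also have "\<dots> \<le> (\<Sum>l\<le>j. \<Sum>k\<le>i. E * S ^ (i + j) * (C * 2 / T) * ((1 / 2) ^ k * (1 / 2) ^ l))"
      proof (intro sum_norm_le)
        fix l k assume lk: "l \<in> {..j}" "k \<in> {..i}"
        show "norm (t k l) \<le> E * S ^ (i + j) * (C * 2 / T) * ((1 / 2) ^ k * (1 / 2) ^ l)"
        proof (cases "k = 0 \<and> l = 0")
          case True
          then show ?thesis using E S C T by (simp add: t_def)
        next
          case ne: False
          have ih: "norm (c2 G (i - k) (j - l)) \<le> E * S ^ (i - k + (j - l))"
            using ne lk by (intro less) auto
          have "norm (t k l) = norm (c2 F k l) * norm (c2 G (i - k) (j - l))"
            using ne by (auto simp: t_def norm_mult)
          also have "\<dots> \<le> (C * R ^ (k + l)) * (E * S ^ (i - k + (j - l)))"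
            using C(1,2) unfolding c2_def[of F] by (intro mult_mono C(3) ih) auto
          also have "\<dots> \<le> (C * (S ^ (k + l) * (2 / T * (1 / 2) ^ (k + l)))) * (E * S ^ (i - k + (j - l)))"
            using C(1) E S ne by (intro mult_right_mono mult_left_mono small) auto
          also have "\<dots> = E * (S ^ (k + l) * S ^ (i - k + (j - l))) * (C * 2 / T) * (1 / 2) ^ (k + l)"
            by (simp add: mult_ac)
          also have "S ^ (k + l) * S ^ (i - k + (j - l)) = S ^ (i + j)"
            using lk by (simp flip: power_add)
          finally show ?thesis by (simp only: power_add)
        qed
      qed
      also have "\<dots> = E * S ^ (i + j) * (C * 2 / T) * ((\<Sum>k\<le>i. (1 / 2) ^ k) * (\<Sum>l\<le>j. (1 / 2) ^ l))"
        by (simp only: sum_distrib_left[symmetric] sum_distrib_right[symmetric])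
      also have "\<dots> \<le> E * S ^ (i + j) * (C * 2 / T) * (2 * 2)"
      proof -
        have "(1 / 2 :: real) ^ m \<le> 2" for m using power_le_one[of "1 / 2 :: real" m] by simp
        then show ?thesis
          using E S C T unfolding sum_half_powers by (intro mult_left_mono mult_mono) auto
      qed
      also have "\<dots> = E * S ^ (i + j) * (C * 8 / T)" by simp
      also have "\<dots> \<le> E * S ^ (i + j) * norm f0" using E S T by (intro mult_left_mono) auto
      finally show ?thesis using f0 by (simp add: mult.commute)
    qed
  qed
  show ?thesis by (rule fps2_convergentI) (use bound in \<open>simp add: c2_def\<close>)
qed

lemma unit_cps2_iff: "F dvd 1 \<longleftrightarrow> c2 (fps2_of F) 0 0 \<noteq> 0"
proof
  assume "c2 (fps2_of F) 0 0 \<noteq> 0"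
  then obtain G where G: "1 = fps2_of F * G" using unit2_iff by (auto simp: dvd_def)
  then have "fps2_convergent G" using fps2_convergent_inverse[of "fps2_of F" G] by simp
  then have "1 = F * Abs_cps2 G" using G by (simp add: fps2_of_inject[symmetric] Abs_cps2_inverse)
  then show "F dvd 1" by (rule dvdI)
qed (rule unit_cps2_imp)

section \<open>Splitting the polar curve and the discriminant\<close>

text \<open>\<open>pw n F\<close> involves x only through x^n, so it is unaffected by x \<mapsto> w
  x.\<close>

lemma eval2_pw_conj_series:
  assumes n: "n > 0" and b: "fps_nth b 0 = 0" and w: "w ^ n = 1"
  shows "eval2 (pw n F) fps_X (conj_series w b) = conj_series w (eval2 (pw n F) fps_X b)"
proof -
  have "eval2 (pw n F) fps_X (conj_series w b) = eval2 F (fps_X ^ n) (conj_series w b)"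
    using n b by (simp add: eval2_pw conj_series_nth)
  also have "(fps_X :: complex fps) ^ n = fps_X ^ n oo (fps_const w * fps_X)"
    using w by (simp add: power_mult_distrib fps_const_power fps_X_power_compose)
  also have "eval2 F \<dots> (conj_series w b) = eval2 F (fps_X ^ n) b oo (fps_const w * fps_X)"
    using n b by (subst eval2_compose) (simp_all add: conj_series_def)
  finally show ?thesis using n b by (simp add: eval2_pw conj_series_def)
qed

text \<open>Both p and the descended product of linear factors generate the kernel along the curve,
  so each divides the other and they differ by a unit.\<close>

lemma kernel_generator_splits:
  fixes p :: fps2
  assumes n: "n > 0" and e: "fps_nth e 0 = 0" "fps_nth e 1 \<noteq> 0" and b: "fps_nth b 0 = 0"
    and prim: "primitive (e ^ n) b"
    and p: "eval2 p (e ^ n) b = 0" "\<And>F. eval2 F (e ^ n) b = 0 \<Longrightarrow> p dvd F"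
    and \<beta>: "\<beta> = b oo fps_inv e"
  shows "fps_nth \<beta> 0 = 0" "inj_on (\<lambda>w. conj_series w \<beta>) {w. w ^ n = 1}"
    "\<exists>U. U dvd 1 \<and> pw n p = U * conj_prod n \<beta>"
proof -
  define i where "i = fps_inv e"
  have i: "fps_nth i 0 = 0" "fps_nth i 1 \<noteq> 0" "e oo i = fps_X" "i oo e = fps_X"
    using fps_inv_nth_1[OF e] fps_inv_right[OF e] fps_inv[OF e] by (simp_all add: i_def)
  have en: "fps_nth (e ^ n) 0 = 0" using e(1) n by (simp add: fps_nth_power_0)
  have ai: "e ^ n oo i = fps_X ^ n" using i by (simp flip: fps_compose_power)
  show \<beta>0: "fps_nth \<beta> 0 = 0" using b by (simp add: \<beta>)
  have "primitive (fps_X ^ n) \<beta>"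
    using primitive_compose[OF prim i(1,2)] by (simp only: ai) (simp add: \<beta> i_def)
  then show inj: "inj_on (\<lambda>w. conj_series w \<beta>) {w. w ^ n = 1}"
    by (rule inj_on_conj_series[OF n \<beta>0])
  obtain P where P: "pw n P = conj_prod n \<beta>" "eval2 P (fps_X ^ n) \<beta> = 0"
    "\<And>F. eval2 F (fps_X ^ n) \<beta> = 0 \<Longrightarrow> \<exists>H. F = P * H"
    using conj_prod_descends[OF n \<beta>0 inj] by metis
  have "eval2 p (fps_X ^ n) \<beta> = eval2 p (e ^ n) b oo i"
    unfolding eval2_compose[OF en b i(1)] ai by (simp add: \<beta> i_def)
  then obtain H where H: "p = P * H" using P(3) p(1) by auto
  have \<beta>e: "\<beta> oo e = b"
    using e(1) i by (simp add: \<beta> flip: i_def fps_compose_assoc)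
  have "fps_X ^ n oo e = e ^ n" using e(1) by (rule fps_X_power_compose)
  then have "eval2 P (e ^ n) b = eval2 P (fps_X ^ n) \<beta> oo e"
    using e(1) n \<beta>0 by (subst eval2_compose) (simp_all add: \<beta>e)
  then have "p dvd P" using p(2) P(2) by simp
  then obtain K where K: "P = p * K" by (elim dvdE)
  have "P * (H * K) = P * 1" using K by (simp add: H mult.assoc)
  moreover have "P \<noteq> 0" using conj_prod_nonzero[OF n, of \<beta>] P(1) pw_hom(8)[OF n] by auto
  ultimately have "H * K = 1" by simp
  then have "H dvd 1" by (metis dvd_triv_left)
  then have "pw n H dvd 1" using n by (simp add: unit2_iff)
  moreover have "pw n p = pw n H * conj_prod n \<beta>" using n by (simp add: H pw_hom P(1) mult.commute)
  ultimately show "\<exists>U. U dvd 1 \<and> pw n p = U * conj_prod n \<beta>" by blast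
qed

text \<open>The k-th power maps the (k N)-th roots of unity onto the N-th roots with every fibre of
  size k.\<close>

lemma prod_power_roots:
  fixes g :: "complex \<Rightarrow> 'a :: comm_semiring_1"
  assumes k: "k > 0" and N: "N > 0"
  shows "(\<Prod>w | w ^ (k * N) = 1. g (w ^ k)) = (\<Prod>v | v ^ N = 1. g v) ^ k"
proof -
  have fin: "finite {w :: complex. w ^ (k * N) = 1}" "finite {v :: complex. v ^ N = 1}"
    using k N by (intro finite_roots_1; simp)+
  have "(\<Prod>v | v ^ N = 1. \<Prod>w | w \<in> {w. w ^ (k * N) = 1} \<and> w ^ k = v. g (w ^ k))
      = (\<Prod>w | w ^ (k * N) = 1. g (w ^ k))"
    by (rule prod.group[OF fin]) (auto simp: power_mult)
  moreover have "(\<Prod>w | w \<in> {w. w ^ (k * N) = 1} \<and> w ^ k = v. g (w ^ k)) = g v ^ k" if "v ^ N = 1" for v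
  proof -
    have "v \<noteq> 0" using that N by (auto simp: power_0_left)
    have "(\<Prod>w | w \<in> {w. w ^ (k * N) = 1} \<and> w ^ k = v. g (w ^ k)) = (\<Prod>w | w ^ k = v. g v)"
      using that by (intro prod.cong) (auto simp: power_mult)
    then show ?thesis using card_nth_roots[OF \<open>v \<noteq> 0\<close> k] by simp
  qed
  ultimately have "(\<Prod>w | w ^ (k * N) = 1. g (w ^ k)) = (\<Prod>v | v ^ N = 1. g v ^ k)" by simp
  then show ?thesis by (simp only: prod_power_distrib)
qed

text \<open>This accounts for the exponent in \<open>q ^ k\<close>. The source branch is normalized
  to (t^n, \<beta>) with n = k N, where N is the order of the first target coordinate. Rotating the
  source by w rotates the target by w^k, so each of the N conjugate factors of q occurs k times
  among the n values of f.\<close>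

lemma maps_branch_splits:
  fixes l f p q :: cps2
  assumes st: "straight (fps2_of l) m A B"
    and param: "primitive_param a b p" "primitive_param c d q" and irr: "irreducible p" "irreducible q"
    and s: "s \<noteq> 0" "fps_nth s 0 = 0" "subdegree s = k"
    and lf: "subst2 l a b = c oo s" "subst2 f a b = d oo s"
    and nz: "subst2 l a b \<noteq> 0"
  obtains n \<beta> e where "n > 0" "fps_nth \<beta> 0 = 0" "inj_on (\<lambda>w. conj_series w \<beta>) {w. w ^ n = 1}"
    "\<exists>U. U dvd 1 \<and> pw n (subst (fps2_of p) A B) = U * conj_prod n \<beta>"
    "\<exists>U. U dvd 1 \<and> pw n (fps2_of (q ^ k)) =
       U * (\<Prod>w | w ^ n = 1. YY - fps_const (eval2 (pw n (subst (fps2_of f) A B)) fps_X (conj_series w \<beta>)))"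
    "fps_nth e 0 = 0" "\<And>F. eval2 (pw n (subst (fps2_of F) A B)) fps_X \<beta> = subst2 F a b oo e" "fps_nth e 1 \<noteq> 0"
proof -
  let ?l = "fps2_of l" and ?f = "fps2_of f" and ?p = "fps2_of p" and ?q = "fps2_of q"
  have nu: "nonunit2 ?l" "nonunit2 m" "nonunit2 A" "nonunit2 B"
    and inv: "subst ?l A B = XX" "subst m A B = YY" "subst A ?l m = XX" "subst B ?l m = YY"
    using st by (auto simp: straight_def)
  have ab: "fps_nth a 0 = 0" "fps_nth b 0 = 0" "eval2 ?p a b = 0"
    and cd: "fps_nth c 0 = 0" "fps_nth d 0 = 0" "eval2 ?q c d = 0"
    using param by (simp_all add: primitive_param_def subst2_eq_eval2)
  have "c \<noteq> 0" using nz lf by auto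
  define N where "N = subdegree c"
  have N: "N > 0" using \<open>c \<noteq> 0\<close> cd by (auto simp: N_def subdegree_eq_0_iff intro!: Nat.gr0I)
  obtain x where x: "fps_nth x 0 = 0" "fps_nth x 1 \<noteq> 0" "x ^ N = c"
    using formal_root_exists[of c N] N by (auto simp: N_def)
  have k: "k > 0" using s by (auto simp: subdegree_eq_0_iff intro!: Nat.gr0I)
  have "subdegree x = 1" using x by (intro subdegreeI) auto
  then have "subdegree (x oo s) = k" using s by simp
  \<comment> \<open>\<open>x\<close> is a parameter of the target with \<open>x ^ N = c\<close>, and
    \<open>x oo s\<close> has order k. Its k-th root \<eta> is the source parameter in which l
    becomes \<eta>^n.\<close>
  then obtain \<eta> where \<eta>: "fps_nth \<eta> 0 = 0" "fps_nth \<eta> 1 \<noteq> 0" "\<eta> ^ k = x oo s"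
    using formal_root_exists k by metis
  define n where "n = k * N"
  have n: "n > 0" using k N by (simp add: n_def)
  have la: "eval2 ?l a b = \<eta> ^ n"
    using s lf by (simp add: n_def power_mult \<eta>(3) subst2_eq_eval2 fps_compose_power x(3))
  \<comment> \<open>In straightened coordinates the source curve is (\<eta>^n, b').\<close>
  define b' where "b' = eval2 m a b"
  have b'0: "fps_nth b' 0 = 0" using nu by (simp add: b'_def ab nonunit2_def)
  have a'0: "fps_nth (\<eta> ^ n) 0 = 0" using \<eta>(1) n by (simp add: fps_nth_power_0)
  have pull: "eval2 A (\<eta> ^ n) b' = a" "eval2 B (\<eta> ^ n) b' = b"
    using eval2_subst[OF ab(1,2) nu(1,2), of A] eval2_subst[OF ab(1,2) nu(1,2), of B]
    by (simp_all add: la b'_def inv ab)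
  have ev: "eval2 (subst F A B) (\<eta> ^ n) b' = eval2 F a b" for F
    using eval2_subst[OF a'0 b'0 nu(3,4)] by (simp add: pull)
  have prim': "primitive (\<eta> ^ n) b'"
    unfolding primitive_def
  proof (intro allI impI)
    fix \<psi> :: "complex fps"
    assume \<psi>: "fps_nth \<psi> 0 = 0" "fps_nth \<psi> 1 \<noteq> 0" "\<eta> ^ n oo \<psi> = \<eta> ^ n" "b' oo \<psi> = b'"
    have "eval2 F (\<eta> ^ n) b' oo \<psi> = eval2 F (\<eta> ^ n) b'" for F
      unfolding eval2_compose[OF a'0 b'0 \<psi>(1)] \<psi>(3,4) ..
    from this[of A] this[of B] have "a oo \<psi> = a" "b oo \<psi> = b" by (simp_all add: pull)
    then show "\<psi> = fps_X"
      using primitive_param_imp_primitive[OF param(1)] \<psi> unfolding primitive_def by blast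
  qed
  have ker: "subst ?p A B dvd F" if F: "eval2 F (\<eta> ^ n) b' = 0" for F
  proof -
    have "eval2 (subst F ?l m) a b = 0"
      using ab nu F by (simp add: eval2_subst la flip: b'_def)
    then have "?p dvd subst F ?l m" by (rule param_kernel(1)[OF irr(1) param(1)])
    then have "subst ?p A B dvd subst (subst F ?l m) A B" using nu by (intro subst_dvd)
    then show ?thesis using nu by (simp add: subst_subst inv)
  qed
  define i where "i = fps_inv \<eta>"
  have i: "fps_nth i 0 = 0" "fps_nth i 1 \<noteq> 0" "\<eta> oo i = fps_X"
    using fps_inv_nth_1[OF \<eta>(1,2)] fps_inv_right[OF \<eta>(1,2)] by (simp_all add: i_def)
  define \<beta> where "\<beta> = b' oo i"
  have p_eval: "eval2 (subst ?p A B) (\<eta> ^ n) b' = 0" using ev ab by simp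
  note source = kernel_generator_splits[OF n \<eta>(1,2) b'0 prim' p_eval ker \<beta>_def[unfolded i_def]]
  have \<eta>i: "\<eta> ^ n oo i = fps_X ^ n" using i by (simp flip: fps_compose_power)
  have val: "eval2 (pw n (subst (fps2_of F) A B)) fps_X \<beta> = subst2 F a b oo i" for F
  proof -
    have "eval2 (pw n (subst (fps2_of F) A B)) fps_X \<beta> = eval2 (subst (fps2_of F) A B) (fps_X ^ n) \<beta>"
      using n source(1) by (simp add: eval2_pw)
    also have "\<dots> = eval2 (subst (fps2_of F) A B) (\<eta> ^ n) b' oo i"
      unfolding eval2_compose[OF a'0 b'0 i(1)] \<eta>i \<beta>_def ..
    finally show ?thesis by (simp add: ev subst2_eq_eval2)
  qed
  define j where "j = fps_inv x"
  have j: "fps_nth j 0 = 0" "j oo x = fps_X"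
    using fps_inv[OF x(1,2)] by (simp_all add: j_def)
  define \<delta> where "\<delta> = d oo j"
  have q_eval: "eval2 ?q (x ^ N) d = 0" using cd x by simp
  have q_prim: "primitive (x ^ N) d" using primitive_param_imp_primitive[OF param(2)] x by simp
  have q_ker: "?q dvd F" if "eval2 F (x ^ N) d = 0" for F
    using param_kernel(1)[OF irr(2) param(2)] that x by simp
  note target = kernel_generator_splits[OF N x(1,2) cd(2) q_prim q_eval q_ker \<delta>_def[unfolded j_def]]
  obtain U where U: "U dvd 1" "pw N ?q = U * conj_prod N \<delta>" using target(3) by blast
  have \<delta>x: "\<delta> oo x = d" using j x(1) by (simp add: \<delta>_def flip: fps_compose_assoc)
  \<comment> \<open>In the normalized parameters the map of branches is t \<mapsto> t^k, so f along
    the source is the target series \<delta> evaluated at t^k.\<close>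
  have f\<beta>: "eval2 (pw n (subst ?f A B)) fps_X \<beta> = \<delta> oo fps_X ^ k"
  proof -
    have "eval2 (pw n (subst ?f A B)) fps_X \<beta> = (\<delta> oo x oo s) oo i" by (simp add: val lf \<delta>x)
    also have "\<delta> oo x oo s = \<delta> oo \<eta> ^ k" using x(1) s(2) by (simp add: \<eta>(3) fps_compose_assoc)
    also have "\<delta> oo \<eta> ^ k oo i = \<delta> oo (\<eta> ^ k oo i)"
      using i(1) \<eta>(1) k by (intro fps_compose_assoc[symmetric]) (auto simp: fps_nth_power_0)
    also have "\<eta> ^ k oo i = fps_X ^ k" using i by (simp flip: fps_compose_power)
    finally show ?thesis .
  qed
  have conjval: "eval2 (pw n (subst ?f A B)) fps_X (conj_series w \<beta>) = conj_series (w ^ k) \<delta> oo fps_X ^ k"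
    if w: "w ^ n = 1" for w
  proof -
    have "eval2 (pw n (subst ?f A B)) fps_X (conj_series w \<beta>) = \<delta> oo fps_X ^ k oo (fps_const w * fps_X)"
      using eval2_pw_conj_series[OF n source(1) w, of "subst ?f A B"]
      unfolding f\<beta> conj_series_def[of w "\<delta> oo fps_X ^ k"] .
    also have "\<dots> = \<delta> oo (fps_const (w ^ k) * fps_X ^ k)"
      using k by (simp add: fps_X_power_compose power_mult_distrib fps_const_power flip: fps_compose_assoc)
    also have "fps_const (w ^ k) * fps_X ^ k = fps_const (w ^ k) * fps_X oo fps_X ^ k"
      using k by (simp add: fps_compose_mult_distrib)
    also have "\<delta> oo \<dots> = conj_series (w ^ k) \<delta> oo fps_X ^ k"
      using k by (simp add: conj_series_def fps_compose_assoc)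
    finally show ?thesis .
  qed
  have "pw n (fps2_of (q ^ k)) = pw k (pw N ?q) ^ k"
    using k N n by (simp add: pw_pw pw_hom n_def)
  also have "pw k (pw N ?q) = pw k U * (\<Prod>v | v ^ N = 1. YY - fps_const (conj_series v \<delta> oo fps_X ^ k))"
    using k by (simp add: U(2) pw_hom conj_prod_def pw_fps_const)
  also have "\<dots> ^ k = pw k U ^ k * (\<Prod>w | w ^ n = 1. YY - fps_const (conj_series (w ^ k) \<delta> oo fps_X ^ k))"
    unfolding n_def power_mult_distrib
    using prod_power_roots[OF k N, of "\<lambda>v. YY - fps_const (conj_series v \<delta> oo fps_X ^ k)"] by simp
  also have "(\<Prod>w | w ^ n = 1. YY - fps_const (conj_series (w ^ k) \<delta> oo fps_X ^ k))
      = (\<Prod>w | w ^ n = 1. YY - fps_const (eval2 (pw n (subst ?f A B)) fps_X (conj_series w \<beta>)))"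
    by (intro prod.cong refl) (simp add: conjval)
  finally have 1: "pw n (fps2_of (q ^ k)) = pw k U ^ k
      * (\<Prod>w | w ^ n = 1. YY - fps_const (eval2 (pw n (subst ?f A B)) fps_X (conj_series w \<beta>)))" .
  have 2: "pw k U ^ k dvd 1"
    using dvd_power_same[of "pw k U" 1 k] U(1) k by (simp add: unit2_iff)
  show ?thesis
    using that[OF n source(1,2,3) _ i(1) val i(2)] 1 2 by blast
qed

text \<open>The conjugates being distinct, \<beta> is a simple root of the product.\<close>

lemma eval2_dy_conj_prod:
  assumes n: "n > 0" and \<beta>: "fps_nth \<beta> 0 = 0" "inj_on (\<lambda>w. conj_series w \<beta>) {w. w ^ n = 1}"
  shows "eval2 (dy (conj_prod n \<beta>)) fps_X \<beta> \<noteq> 0"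
proof -
  let ?S = "{w :: complex. w ^ n = 1}"
  define R where "R = (\<Prod>w\<in>?S - {1}. YY - fps_const (conj_series w \<beta>))"
  have "conj_prod n \<beta> = (YY - fps_const \<beta>) * R"
    unfolding conj_prod_def R_def using finite_roots_1[OF n] by (subst prod.remove[of _ 1]) auto
  moreover have "dy (YY - fps_const \<beta>) = 1"
    by (simp add: dy_def YY_def)
  ultimately have "eval2 (dy (conj_prod n \<beta>)) fps_X \<beta> = eval2 R fps_X \<beta>"
    using \<beta> by (simp add: dy_mult eval2_add eval2_mult eval2_diff eval2_fps_const)
  also have "\<dots> = (\<Prod>w\<in>?S - {1}. \<beta> - conj_series w \<beta>)"
    using \<beta> by (simp add: R_def eval2_prod eval2_diff eval2_fps_const)
  also have "\<dots> \<noteq> 0"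
    using finite_roots_1[OF n] inj_onD[OF \<beta>(2), of 1] by (auto simp: prod_zero_iff)
  finally show ?thesis .
qed

text \<open>p has no constant term, so the linear part of l is that of p times the constant term of
  the cofactor; smoothness makes that constant nonzero and the cofactor a unit.\<close>

lemma smooth_germ_dvd:
  assumes l: "smooth_germ l" and p: "irreducible p" "p dvd l"
  shows "irreducible l \<and> l dvd p"
proof -
  obtain r where r: "l = p * r" using p(2) by (elim dvdE)
  have "c2 (fps2_of p) 0 0 = 0" using p(1) unit_cps2_iff[of p] by (auto simp: irreducible_def)
  then have lin: "c2 (fps2_of l) 1 0 = c2 (fps2_of p) 1 0 * c2 (fps2_of r) 0 0"
    "c2 (fps2_of l) 0 1 = c2 (fps2_of p) 0 1 * c2 (fps2_of r) 0 0"
    by (simp_all add: r c2_mult)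
  then have "c2 (fps2_of r) 0 0 \<noteq> 0" using l by (auto simp: smooth_germ_def coeff2_c2)
  then have u: "r dvd 1" by (simp add: unit_cps2_iff)
  then obtain r' where r': "1 = r * r'" by (elim dvdE)
  have pl: "p = l * r'" unfolding r mult.assoc r'[symmetric] by simp
  have "irreducible l"
  proof (rule irreducibleI)
    show "l \<noteq> 0" using p(1) pl by (auto simp: irreducible_def)
    show "\<not> l dvd 1"
    proof
      assume "l dvd 1"
      then have "p dvd 1" using p(2) dvd_trans by blast
      then show False using p(1) by (simp add: irreducible_def)
    qed
    fix a b assume "l = a * b"
    then have "p = a * (b * r')" by (simp add: pl mult.assoc)
    then have "a dvd 1 \<or> b * r' dvd 1" by (rule irreducibleD[OF p(1)])
    then show "a dvd 1 \<or> b dvd 1" using dvd_mult_left by blast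
  qed
  then show ?thesis unfolding pl by simp
qed

text \<open>The work lies in two nonvanishing claims along the polar branch: for l, where it enters
  that l is not a branch of f, and for f, where squarefreeness enters.\<close>

lemma polar_branch_splits:
  fixes l f p q :: cps2
  assumes f0: "coeff2 f 0 0 = 0" and sqf: "squarefree f" and l: "smooth_germ l" and nb: "\<not> branch_of l f"
    and st: "straight (fps2_of l) m A B" and \<kappa>: "\<kappa> dvd 1"
    and jac: "\<And>F. dy (subst F A B) = \<kappa> * subst (pol (fps2_of l) F) A B"
    and mb: "maps_branch l f p q k" and dvd: "p dvd polar l f"
  obtains n \<beta> where "n > 0" "fps_nth \<beta> 0 = 0"
    "\<exists>U. U dvd 1 \<and> pw n (subst (fps2_of p) A B) = U * conj_prod n \<beta>"
    "\<exists>U. U dvd 1 \<and> pw n (fps2_of (q ^ k)) =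
       U * (\<Prod>w | w ^ n = 1. YY - fps_const (eval2 (pw n (subst (fps2_of f) A B)) fps_X (conj_series w \<beta>)))"
    "\<And>w. w ^ n = 1 \<Longrightarrow> eval2 (pw n (subst (fps2_of f) A B)) fps_X (conj_series w \<beta>) \<noteq> 0"
proof -
  obtain a b c d s where param: "primitive_param a b p" "primitive_param c d q"
    and irr: "irreducible p" "irreducible q"
    and s: "s \<noteq> 0" "fps_nth s 0 = 0" "subdegree s = k"
    and lf: "subst2 l a b = c oo s" "subst2 f a b = d oo s"
    using mb unfolding maps_branch_def by blast
  have nu: "nonunit2 (fps2_of l)" "nonunit2 m" "nonunit2 A" "nonunit2 B"
    and inv: "subst (fps2_of l) A B = XX" "subst A (fps2_of l) m = XX" "subst B (fps2_of l) m = YY"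
    using st by (auto simp: straight_def)
  have ab: "fps_nth a 0 = 0" "fps_nth b 0 = 0"
    using param by (simp_all add: primitive_param_def)
  \<comment> \<open>If l vanished, p would be associated to l and x would divide the y-derivative of
    F. Then F(0, y) is constant, hence zero by F(0, 0) = 0, so x divides F and l divides f.\<close>
  have nz: "subst2 l a b \<noteq> 0"
  proof
    assume l0: "subst2 l a b = 0"
    then have "p dvd l" by (intro param_kernel(2)[OF irr(1) param(1)]) (simp add: subst2_eq_eval2)
    then have il: "irreducible l" and lp: "l dvd p" using smooth_germ_dvd[OF l irr(1)] by auto
    define F where "F = subst (fps2_of f) A B"
    have "fps2_of l dvd pol (fps2_of l) (fps2_of f)"
      using lp dvd fps2_of_dvd[of l "polar l f"] by (simp add: fps2_of_polar dvd_trans)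
    then have "subst (fps2_of l) A B dvd subst (pol (fps2_of l) (fps2_of f)) A B"
      using nu by (intro subst_dvd)
    then have "XX dvd dy F" unfolding F_def jac inv by (rule dvd_mult)
    then have dF: "c2 F 0 (Suc j) = 0" for j
      using XX_dvd_iff[of "dy F"] by (auto simp: c2_dy simp del: of_nat_Suc)
    have "c2 F 0 0 = 0" using nu f0 by (simp add: F_def coeff2_c2)
    with dF have "c2 F 0 j = 0" for j by (cases j) auto
    then have "XX dvd F" by (simp add: XX_dvd_iff)
    then obtain H where H: "F = XX * H" by (elim dvdE)
    have "fps2_of f = subst F (fps2_of l) m"
      using nu by (simp add: F_def subst_subst inv)
    also have "\<dots> = fps2_of l * subst H (fps2_of l) m" using nu by (simp add: H subst_mult)
    finally have "eval2 (fps2_of f) a b = 0" using l0 ab by (simp add: eval2_mult subst2_eq_eval2)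
    then have "p dvd f" by (rule param_kernel(2)[OF irr(1) param(1)])
    then have "l dvd f" using lp dvd_trans by blast
    then show False using nb il by (simp add: branch_of_def)
  qed
  obtain n \<beta> e where n: "n > 0" and \<beta>: "fps_nth \<beta> 0 = 0" "inj_on (\<lambda>w. conj_series w \<beta>) {w. w ^ n = 1}"
    and p: "\<exists>U. U dvd 1 \<and> pw n (subst (fps2_of p) A B) = U * conj_prod n \<beta>"
    and q: "\<exists>U. U dvd 1 \<and> pw n (fps2_of (q ^ k)) =
       U * (\<Prod>w | w ^ n = 1. YY - fps_const (eval2 (pw n (subst (fps2_of f) A B)) fps_X (conj_series w \<beta>)))"
    and e: "fps_nth e 0 = 0" "fps_nth e 1 \<noteq> 0"
    and val: "\<And>F. eval2 (pw n (subst (fps2_of F) A B)) fps_X \<beta> = subst2 F a b oo e"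
    by (rule maps_branch_splits[OF st param irr s lf nz]) blast
  \<comment> \<open>If f = p g, the Leibniz rule shows that g or the polar form of p vanishes on the
    branch. The first makes p^2 divide f; the second makes \<beta> a multiple root of the product of
    conjugate factors.\<close>
  have f_nz: "subst2 f a b \<noteq> 0"
  proof
    assume "subst2 f a b = 0"
    then have "p dvd f" by (intro param_kernel(2)[OF irr(1) param(1)]) (simp add: subst2_eq_eval2)
    then obtain g where g: "f = p * g" by (elim dvdE)
    have "pol (fps2_of l) (fps2_of f) = fps2_of p * pol (fps2_of l) (fps2_of g) + fps2_of g * pol (fps2_of l) (fps2_of p)"
      by (simp add: g pol_def dx_mult dy_mult algebra_simps)
    moreover have "eval2 (pol (fps2_of l) (fps2_of f)) a b = 0" "eval2 (fps2_of p) a b = 0"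
    proof -
      show p0: "eval2 (fps2_of p) a b = 0" using param(1) by (simp add: primitive_param_def subst2_eq_eval2)
      obtain h where "polar l f = p * h" using dvd by (elim dvdE)
      then show "eval2 (pol (fps2_of l) (fps2_of f)) a b = 0"
        using ab p0 by (simp add: eval2_mult flip: fps2_of_polar)
    qed
    ultimately have "eval2 (fps2_of g) a b = 0 \<or> eval2 (pol (fps2_of l) (fps2_of p)) a b = 0"
      using ab by (simp add: eval2_add eval2_mult)
    then show False
    proof
      assume "eval2 (fps2_of g) a b = 0"
      then have "p dvd g" by (rule param_kernel(2)[OF irr(1) param(1)])
      then have "p ^ 2 dvd f" unfolding g power2_eq_square by (rule mult_dvd_mono[OF dvd_refl])
      then have "p dvd 1" using sqf by (auto simp: squarefree_def)
      then show False using irr(1) by (simp add: irreducible_def)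
    next
      assume "eval2 (pol (fps2_of l) (fps2_of p)) a b = 0"
      then have "subst2 (polar l p) a b = 0" by (simp add: subst2_eq_eval2 fps2_of_polar)
      from val[of "polar l p", unfolded this fps2_of_polar]
      have "eval2 (pw n (subst (pol (fps2_of l) (fps2_of p)) A B)) fps_X \<beta> = 0" by simp
      then have "eval2 (pw n (dy (subst (fps2_of p) A B))) fps_X \<beta> = 0"
        using n \<beta> unfolding jac by (simp add: pw_hom eval2_mult)
      moreover obtain U where U: "U dvd 1" "pw n (subst (fps2_of p) A B) = U * conj_prod n \<beta>"
        using p by blast
      ultimately have "eval2 (dy (U * conj_prod n \<beta>)) fps_X \<beta> = 0"
        using n by (simp flip: dy_pw)
      moreover have "eval2 (conj_prod n \<beta>) fps_X \<beta> = 0"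
        using \<beta> finite_roots_1[OF n]
        by (auto simp: conj_prod_def eval2_prod eval2_diff eval2_fps_const prod_zero_iff intro!: exI[of _ 1])
      moreover have "eval2 U fps_X \<beta> \<noteq> 0"
      proof
        assume "eval2 U fps_X \<beta> = 0"
        then have "c2 U 0 0 = 0" using eval2_nth_0[of fps_X \<beta> U] \<beta> by simp
        with U(1) show False by (simp add: unit2_iff)
      qed
      ultimately show False using \<beta> eval2_dy_conj_prod[OF n \<beta>]
        by (simp add: dy_mult eval2_add eval2_mult)
    qed
  qed
  have "eval2 (pw n (subst (fps2_of f) A B)) fps_X (conj_series w \<beta>) \<noteq> 0" if w: "w ^ n = 1" for w
  proof -
    have "e \<noteq> 0" using e(2) by auto
    then have "subst2 f a b oo e \<noteq> 0" using f_nz e(1) by (simp add: fps_compose_eq_0_iff)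
    moreover have "w \<noteq> 0" using w n by (auto simp: power_0_left)
    ultimately have "conj_series w (subst2 f a b oo e) \<noteq> 0" by (auto simp: fps_eq_iff conj_series_nth)
    then show ?thesis by (simp add: eval2_pw_conj_series[OF n \<beta>(1) w] val)
  qed
  then show ?thesis using that n \<beta>(1) p q by blast
qed

section \<open>Collecting all branches after a common base change\<close>

text \<open>\<Gamma> is a multiset because polar branches may be multiple. Nonzero critical values
  are part of the notion so that leading terms make sense. P and Q are left general so that single
  branches and their products are treated alike.\<close>

definition splits :: "fps2 \<Rightarrow> nat \<Rightarrow> fps2 \<Rightarrow> fps2 \<Rightarrow> complex fps multiset \<Rightarrow> bool" where
  "splits f M P Q \<Gamma> \<longleftrightarrow>
     (\<forall>\<gamma>\<in>#\<Gamma>. fps_nth \<gamma> 0 = 0 \<and> eval2 (pw M f) fps_X \<gamma> \<noteq> 0) \<and>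
     (\<exists>U. U dvd 1 \<and> pw M P = U * (\<Prod>\<gamma>\<in>#\<Gamma>. YY - fps_const \<gamma>)) \<and>
     (\<exists>U. U dvd 1 \<and> pw M Q = U * (\<Prod>\<gamma>\<in>#\<Gamma>. YY - fps_const (eval2 (pw M f) fps_X \<gamma>)))"

lemma splits_mult:
  assumes "M > 0" "splits f M P Q \<Gamma>" "splits f M P' Q' \<Gamma>'"
  shows "splits f M (P * P') (Q * Q') (\<Gamma> + \<Gamma>')"
proof -
  obtain U V where 1: "U dvd 1" "pw M P = U * (\<Prod>\<gamma>\<in>#\<Gamma>. YY - fps_const \<gamma>)" "V dvd 1"
    "pw M Q = V * (\<Prod>\<gamma>\<in>#\<Gamma>. YY - fps_const (eval2 (pw M f) fps_X \<gamma>))"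
    using assms(2) unfolding splits_def by blast
  obtain U' V' where 2: "U' dvd 1" "pw M P' = U' * (\<Prod>\<gamma>\<in>#\<Gamma>'. YY - fps_const \<gamma>)" "V' dvd 1"
    "pw M Q' = V' * (\<Prod>\<gamma>\<in>#\<Gamma>'. YY - fps_const (eval2 (pw M f) fps_X \<gamma>))"
    using assms(3) unfolding splits_def by blast
  have "pw M (P * P') = (U * U') * (\<Prod>\<gamma>\<in>#\<Gamma> + \<Gamma>'. YY - fps_const \<gamma>)"
    "pw M (Q * Q') = (V * V') * (\<Prod>\<gamma>\<in>#\<Gamma> + \<Gamma>'. YY - fps_const (eval2 (pw M f) fps_X \<gamma>))"
    using assms(1) 1 2 by (simp_all add: pw_hom mult_ac)
  moreover have "U * U' dvd 1" "V * V' dvd 1" using 1 2 by (simp_all add: unit2_iff)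
  ultimately show ?thesis using assms(2,3) unfolding splits_def by auto
qed

lemma splits_unit:
  assumes "M > 0" "splits f M P Q \<Gamma>" "u dvd 1" "v dvd 1"
  shows "splits f M (u * P) (v * Q) \<Gamma>"
proof -
  have "splits f M u v {#}"
    using assms unfolding splits_def by (auto simp: unit2_iff)
  from splits_mult[OF assms(1) this assms(2)] show ?thesis by simp
qed

lemma splits_conj_prod:
  assumes n: "n > 0" and M: "M > 0" "n dvd M" and \<beta>: "fps_nth \<beta> 0 = 0"
    and P: "\<exists>U. U dvd 1 \<and> pw n P = U * conj_prod n \<beta>"
    and Q: "\<exists>U. U dvd 1 \<and> pw n Q = U * (\<Prod>w | w ^ n = 1. YY - fps_const (eval2 (pw n f) fps_X (conj_series w \<beta>)))"
    and nz: "\<And>w. w ^ n = 1 \<Longrightarrow> eval2 (pw n f) fps_X (conj_series w \<beta>) \<noteq> 0"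
  shows "splits f M P Q (image_mset (\<lambda>w. conj_series w \<beta> oo fps_X ^ (M div n)) (mset_set {w. w ^ n = 1}))"
proof -
  define r where "r = M div n"
  have r: "r > 0" "M = r * n" using M n by (auto simp: r_def elim!: dvdE)
  have fin: "finite {w :: complex. w ^ n = 1}" using n by (rule finite_roots_1)
  have c0: "fps_nth (conj_series w \<beta>) 0 = 0" for w using \<beta> by (simp add: conj_series_nth)
  have val: "eval2 (pw M f) fps_X (conj_series w \<beta> oo fps_X ^ r)
      = eval2 (pw n f) fps_X (conj_series w \<beta>) oo fps_X ^ r" for w
  proof -
    have "eval2 (pw M f) fps_X (conj_series w \<beta> oo fps_X ^ r)
        = eval2 (pw n f) (fps_X ^ r) (conj_series w \<beta> oo fps_X ^ r)"
      using r n c0 by (simp add: eval2_pw flip: pw_pw)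
    also have "\<dots> = eval2 (pw n f) fps_X (conj_series w \<beta>) oo fps_X ^ r"
      using r c0 by (subst eval2_compose) auto
    finally show ?thesis .
  qed
  have nz': "eval2 (pw n f) fps_X (conj_series w \<beta>) oo fps_X ^ r \<noteq> 0" if "w ^ n = 1" for w
    using nz[OF that] r by (simp add: fps_compose_eq_0_iff)
  have pr: "(\<Prod>\<gamma>\<in>#image_mset g (mset_set {w. w ^ n = 1}). F \<gamma>) = (\<Prod>w | w ^ n = 1. F (g w))"
    for F :: "complex fps \<Rightarrow> fps2" and g
    by (simp add: prod_unfold_prod_mset image_mset.compositionality comp_def)
  obtain U where U: "U dvd 1" "pw n P = U * conj_prod n \<beta>" using P by blast
  have PM: "pw M P = pw r U * (\<Prod>w | w ^ n = 1. YY - fps_const (conj_series w \<beta> oo fps_X ^ r))"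
    using r n U by (simp add: pw_hom conj_prod_def pw_fps_const flip: pw_pw)
  obtain V where V: "V dvd 1" "pw n Q = V * (\<Prod>w | w ^ n = 1. YY - fps_const (eval2 (pw n f) fps_X (conj_series w \<beta>)))"
    using Q by blast
  have QM: "pw M Q = pw r V * (\<Prod>w | w ^ n = 1. YY - fps_const (eval2 (pw n f) fps_X (conj_series w \<beta>) oo fps_X ^ r))"
    using r n V by (simp add: pw_hom pw_fps_const flip: pw_pw)
  have "pw r U dvd 1" "pw r V dvd 1" using U(1) V(1) r by (simp_all add: unit2_iff)
  then show ?thesis
    unfolding splits_def r_def[symmetric] pr val using PM QM c0 r(1) nz' fin by (auto simp: val)
qed

text \<open>Quantifying over all multiples M of n lets different branches, and later the two
  discriminants, be brought to one common base change.\<close>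

lemma splits_list:
  assumes "\<And>x. x \<in> set bs \<Longrightarrow> \<exists>n>0. \<forall>M>0. n dvd M \<longrightarrow> (\<exists>\<Gamma>. splits f M (P x) (Q x) \<Gamma>)"
  shows "\<exists>n>0. \<forall>M>0. n dvd M \<longrightarrow> (\<exists>\<Gamma>. splits f M (\<Prod>x\<leftarrow>bs. P x) (\<Prod>x\<leftarrow>bs. Q x) \<Gamma>)"
  using assms
proof (induction bs)
  case Nil
  have "splits f M 1 1 {#}" if "M > 0" for M using that by (simp add: splits_def pw_hom)
  then show ?case by (intro exI[of _ "1 :: nat"]) (simp, blast)
next
  case (Cons x bs)
  obtain n where n: "n > 0" "\<And>M. M > 0 \<Longrightarrow> n dvd M \<Longrightarrow> \<exists>\<Gamma>. splits f M (P x) (Q x) \<Gamma>"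
    using Cons.prems[of x] by auto
  obtain n' where n': "n' > 0"
    "\<And>M. M > 0 \<Longrightarrow> n' dvd M \<Longrightarrow> \<exists>\<Gamma>. splits f M (\<Prod>x\<leftarrow>bs. P x) (\<Prod>x\<leftarrow>bs. Q x) \<Gamma>"
    using Cons.IH Cons.prems by auto
  show ?case
  proof (intro exI[of _ "n * n'"] conjI allI impI)
    show "n * n' > 0" using n n' by simp
    fix M assume M: "M > 0" "n * n' dvd M"
    then have "n dvd M" "n' dvd M" by (auto dest: dvd_mult_left dvd_mult_right)
    then obtain \<Gamma> \<Gamma>' where "splits f M (P x) (Q x) \<Gamma>" "splits f M (\<Prod>x\<leftarrow>bs. P x) (\<Prod>x\<leftarrow>bs. Q x) \<Gamma>'"
      using n(2) n'(2) M(1) by blast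
    from splits_mult[OF M(1) this]
    show "\<exists>\<Gamma>. splits f M (\<Prod>x\<leftarrow>x # bs. P x) (\<Prod>x\<leftarrow>x # bs. Q x) \<Gamma>" by auto
  qed
qed

text \<open>The straightened polar form is traded for the y-derivative, from which it differs by the
  unit \<kappa>.\<close>

lemma discriminant_splits:
  fixes l f D :: cps2
  assumes f0: "coeff2 f 0 0 = 0" and sqf: "squarefree f" and l: "smooth_germ l" and nb: "\<not> branch_of l f"
    and st: "straight (fps2_of l) m A B" and \<kappa>: "\<kappa> dvd 1"
    and jac: "\<And>F. dy (subst F A B) = \<kappa> * subst (pol (fps2_of l) F) A B"
    and D: "is_discriminant l f D"
  obtains n where "n > 0"
    "\<And>M. M > 0 \<Longrightarrow> n dvd M \<Longrightarrow> \<exists>\<Gamma>. splits (subst (fps2_of f) A B) M (dy (subst (fps2_of f) A B)) (fps2_of D) \<Gamma>"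
proof -
  have nu: "nonunit2 A" "nonunit2 B" using st by (auto simp: straight_def)
  define F where "F = subst (fps2_of f) A B"
  obtain bs e e' where e: "e dvd 1" "e' dvd 1"
    and bs': "\<forall>(p, q, k) \<in> set bs. maps_branch l f p q k"
    and pl: "polar l f = e * (\<Prod>(p, q, k)\<leftarrow>bs. p)" and DQ: "D = e' * (\<Prod>(p, q, k)\<leftarrow>bs. q ^ k)"
    using D unfolding is_discriminant_def direct_image_def by (elim exE conjE) (rule that)
  have bs: "maps_branch l f p q k" if "(p, q, k) \<in> set bs" for p q k
    using bspec[OF bs' that] by simp
  define P Q where "P = (\<lambda>(p, q :: cps2, k :: nat). subst (fps2_of p) A B)"
    and "Q = (\<lambda>(p :: cps2, q, k :: nat). fps2_of (q ^ k))"
  have single: "\<exists>n>0. \<forall>M>0. n dvd M \<longrightarrow> (\<exists>\<Gamma>. splits F M (P x) (Q x) \<Gamma>)" if x: "x \<in> set bs" for x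
  proof -
    obtain p q k where xpqk: "x = (p, q, k)" by (cases x)
    have "p \<in> set (map (\<lambda>(p, q, k). p) bs)" using x xpqk by force
    then have "p dvd (\<Prod>(p, q, k)\<leftarrow>bs. p)" by (rule prod_list_dvd)
    then have "p dvd polar l f" unfolding pl by (rule dvd_mult)
    show ?thesis
    proof (rule polar_branch_splits[OF f0 sqf l nb st \<kappa> jac bs[OF x[unfolded xpqk]] \<open>p dvd polar l f\<close>],
        goal_cases)
      case (1 n \<beta>)
      have "\<exists>\<Gamma>. splits F M (P x) (Q x) \<Gamma>" if M: "M > 0" "n dvd M" for M
        unfolding xpqk P_def Q_def prod.case F_def
        by (rule exI, rule splits_conj_prod[OF 1(1) M 1(2,3,4)]) (rule 1(5))
      with 1(1) show ?case by (intro exI[of _ n]) simp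
    qed
  qed
  have "\<exists>n>0. \<forall>M>0. n dvd M \<longrightarrow> (\<exists>\<Gamma>. splits F M (\<Prod>x\<leftarrow>bs. P x) (\<Prod>x\<leftarrow>bs. Q x) \<Gamma>)"
    by (rule splits_list) (rule single)
  then obtain n where n: "n > 0"
    "\<forall>M>0. n dvd M \<longrightarrow> (\<exists>\<Gamma>. splits F M (\<Prod>x\<leftarrow>bs. P x) (\<Prod>x\<leftarrow>bs. Q x) \<Gamma>)"
    by (elim exE conjE)
  have dyF: "dy F = (\<kappa> * subst (fps2_of e) A B) * (\<Prod>x\<leftarrow>bs. P x)"
  proof -
    have "subst (fps2_of (\<Prod>(p, q, k)\<leftarrow>bs. p)) A B = (\<Prod>x\<leftarrow>bs. P x)"
      using nu by (simp add: fps2_of_prod_list subst_prod_list P_def comp_def case_prod_beta)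
    then show ?thesis
      using nu unfolding F_def jac fps2_of_polar[symmetric] pl by (simp add: subst_mult mult.assoc)
  qed
  have DQ': "fps2_of D = fps2_of e' * (\<Prod>x\<leftarrow>bs. Q x)"
    by (simp add: DQ fps2_of_prod_list Q_def comp_def case_prod_beta)
  have u: "\<kappa> * subst (fps2_of e) A B dvd 1" "fps2_of e' dvd 1"
    using \<kappa> e nu by (auto simp: unit2_iff unit_cps2_iff)
  have "\<exists>\<Gamma>. splits F M (dy F) (fps2_of D) \<Gamma>" if M: "M > 0" "n dvd M" for M
  proof -
    obtain \<Gamma> where "splits F M (\<Prod>x\<leftarrow>bs. P x) (\<Prod>x\<leftarrow>bs. Q x) \<Gamma>"
      using n(2)[rule_format, OF M] by (elim exE)
    from splits_unit[OF M(1) this u] show ?thesis unfolding dyF DQ' by (rule exI)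
  qed
  then show ?thesis unfolding F_def by (rule that[OF n(1)])
qed

section \<open>Weighted initial forms\<close>

text \<open>
  The part of \<open>F\<close> of weight \<open>m\<close>, where \<open>x\<close> has weight \<open>1\<close> and \<open>y\<close> has weight \<open>h\<close>, is
  \<open>\<Sum>\<^sub>j P\<^sub>j x\<^bsup>m - h j\<^esup> y\<^sup>j\<close>, and all terms of smaller weight vanish.
\<close>
definition ipoly :: "real \<Rightarrow> fps2 \<Rightarrow> real \<Rightarrow> complex poly \<Rightarrow> bool" where
  "ipoly h F m P \<longleftrightarrow>
     (\<forall>i j. real i + h * real j < m \<longrightarrow> c2 F i j = 0) \<and>
     (\<forall>i j. real i + h * real j = m \<longrightarrow> c2 F i j = coeff P j) \<and>
     (\<forall>j. coeff P j \<noteq> 0 \<longrightarrow> (\<exists>i. real i + h * real j = m))"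

lemma ipolyD:
  assumes "ipoly h F m P"
  shows "real i + h * real j < m \<Longrightarrow> c2 F i j = 0"
    and "real i + h * real j = m \<Longrightarrow> c2 F i j = coeff P j"
    and "coeff P j \<noteq> 0 \<Longrightarrow> \<exists>i. real i + h * real j = m"
  using assms unfolding ipoly_def by blast+

lemma ipoly_mult:
  assumes F: "ipoly h F m P" and G: "ipoly h G n Q"
  shows "ipoly h (F * G) (m + n) (P * Q)"
proof -
  have split: "real i + h * real j = (real k + h * real l) + (real (i - k) + h * real (j - l))"
    if "k \<le> i" "l \<le> j" for i j k l
    using that by (simp add: of_nat_diff algebra_simps)
  have "c2 (F * G) i j = 0" if ij: "real i + h * real j < m + n" for i j
    unfolding c2_mult
  proof (intro sum.neutral ballI)
    fix l k assume "l \<in> {..j}" "k \<in> {..i}"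
    then have "real k + h * real l < m \<or> real (i - k) + h * real (j - l) < n"
      using split[of k i l j] ij by auto
    then show "c2 F k l * c2 G (i - k) (j - l) = 0"
      using ipolyD(1)[OF F] ipolyD(1)[OF G] by auto
  qed
  moreover have "c2 (F * G) i j = coeff (P * Q) j" if ij: "real i + h * real j = m + n" for i j
  proof -
    \<comment> \<open>For fixed l at most one k gives x^k y^l the weight m. If there is none with k
      \<le> i, every term vanishes, and by the third clause of \<open>ipoly\<close> one of the two
      polynomial coefficients vanishes too.\<close>
    have "(\<Sum>k\<le>i. c2 F k l * c2 G (i - k) (j - l)) = coeff P l * coeff Q (j - l)" if l: "l \<le> j" for l
    proof (cases "\<exists>k\<le>i. real k + h * real l = m")
      case True
      then obtain k0 where k0: "k0 \<le> i" "real k0 + h * real l = m" by blast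
      have "c2 F k l * c2 G (i - k) (j - l) = (if k = k0 then coeff P l * coeff Q (j - l) else 0)"
        if k: "k \<le> i" for k
      proof -
        consider "k = k0" | "real k + h * real l < m" | "real (i - k) + h * real (j - l) < n"
          using split[OF k l] k0 ij by fastforce
        then show ?thesis
        proof cases
          case 1
          then show ?thesis
            using split[OF k l] k0 ij ipolyD(2)[OF F, of k l] ipolyD(2)[OF G, of "i - k" "j - l"] by simp
        next
          case 2
          then show ?thesis using k0 ipolyD(1)[OF F] by auto
        next
          case 3
          then have "k \<noteq> k0" using split[OF k l] k0 ij by auto
          with 3 show ?thesis using ipolyD(1)[OF G] by auto
        qed
      qed
      then show ?thesis using k0(1) by simp
    next
      case False
      have *: "c2 F k l * c2 G (i - k) (j - l) = 0" if k: "k \<le> i" for k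
      proof -
        have "real k + h * real l \<noteq> m" using False k by blast
        then have "real k + h * real l < m \<or> real (i - k) + h * real (j - l) < n"
          using split[OF k l] ij by linarith
        then show ?thesis using ipolyD(1)[OF F] ipolyD(1)[OF G] by auto
      qed
      have "(\<Sum>k\<le>i. c2 F k l * c2 G (i - k) (j - l)) = 0"
        by (intro sum.neutral ballI *) simp
      moreover have "coeff P l = 0 \<or> coeff Q (j - l) = 0"
      proof (rule ccontr)
        assume "\<not> ?thesis"
        then obtain a b where "real a + h * real l = m" "real b + h * real (j - l) = n"
          using ipolyD(3)[OF F] ipolyD(3)[OF G] by blast
        then have "real i = real a + real b" using ij l by (simp add: of_nat_diff algebra_simps)
        then have "a \<le> i" by linarith
        with False \<open>real a + h * real l = m\<close> show False by blast
      qed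
      ultimately show ?thesis by auto
    qed
    then show ?thesis unfolding c2_mult coeff_mult by simp
  qed
  moreover have "\<exists>i. real i + h * real j = m + n" if "coeff (P * Q) j \<noteq> 0" for j
  proof -
    have "(\<Sum>l\<le>j. coeff P l * coeff Q (j - l)) \<noteq> 0" using that by (simp add: coeff_mult)
    then obtain l where l: "l \<le> j" "coeff P l \<noteq> 0" "coeff Q (j - l) \<noteq> 0"
      by (elim sum.not_neutral_contains_not_neutral) auto
    then obtain a b where "real a + h * real l = m" "real b + h * real (j - l) = n"
      using ipolyD(3)[OF F] ipolyD(3)[OF G] by blast
    then have "real (a + b) + h * real j = m + n" using l by (simp add: of_nat_diff algebra_simps)
    then show ?thesis by blast
  qed
  ultimately show ?thesis unfolding ipoly_def by blast
qed

lemma ipoly_add: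
  assumes F: "ipoly h F m P" and G: "ipoly h G m Q"
  shows "ipoly h (F + G) m (P + Q)"
  unfolding ipoly_def
proof (intro conjI allI impI)
  fix j assume "coeff (P + Q) j \<noteq> 0"
  then have "coeff P j \<noteq> 0 \<or> coeff Q j \<noteq> 0" by auto
  then show "\<exists>i. real i + h * real j = m" using ipolyD(3)[OF F] ipolyD(3)[OF G] by blast
qed (simp_all add: ipolyD(1,2)[OF F] ipolyD(1,2)[OF G])

lemma ipoly_0: "ipoly h 0 m 0"
  by (simp add: ipoly_def)

lemma ipoly_sum: "(\<And>s. s \<in> S \<Longrightarrow> ipoly h (f s) m (P s)) \<Longrightarrow> ipoly h (sum f S) m (sum P S)"
  by (induction S rule: infinite_finite_induct) (auto intro: ipoly_add ipoly_0)

lemma ipoly_const: "h > 0 \<Longrightarrow> ipoly h F 0 [:c2 F 0 0:]"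
  unfolding ipoly_def
proof (intro conjI allI impI)
  fix i j assume h: "h > 0" 
  show "c2 F i j = 0" if "real i + h * real j < 0"
    using that h by (meson add_nonneg_nonneg mult_nonneg_nonneg not_less of_nat_0_le_iff order_less_imp_le)
  show "c2 F i j = coeff [:c2 F 0 0:] j" if "real i + h * real j = 0"
  proof -
    have "real i = 0 \<and> h * real j = 0"
      using that h by (metis add_nonneg_eq_0_iff mult_nonneg_nonneg of_nat_0_le_iff order_less_imp_le)
    then show ?thesis using h by simp
  qed
  show "\<exists>i. real i + h * real j = 0" if "coeff [:c2 F 0 0:] j \<noteq> 0"
    using that by (cases j) auto
qed

lemma ipoly_1: "h > 0 \<Longrightarrow> ipoly h 1 0 1"
  using ipoly_const[of h 1] by (simp add: c2_1 one_pCons)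

lemma ipoly_power: "h > 0 \<Longrightarrow> ipoly h F m P \<Longrightarrow> ipoly h (F ^ k) (real k * m) (P ^ k)"
proof (induction k)
  case (Suc k)
  have "ipoly h (F * F ^ k) (m + real k * m) (P * P ^ k)" using Suc by (intro ipoly_mult) auto
  then show ?case by (simp add: algebra_simps)
qed (simp add: ipoly_1)

text \<open>A zero initial form is allowed, so that terms of larger weight can be added without
  affecting the form.\<close>

lemma ipoly_smaller: "ipoly h F n P \<Longrightarrow> m < n \<Longrightarrow> ipoly h F m 0"
  unfolding ipoly_def by auto

lemma ipoly_unique_weight:
  assumes F: "ipoly h F m P" "ipoly h F n Q" and nz: "P \<noteq> 0" "Q \<noteq> 0"
  shows "m = n"
proof -
  have "\<not> m < n" if F: "ipoly h F m P" "ipoly h F n Q" "P \<noteq> 0" for m n P Q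
  proof
    assume "m < n"
    obtain j where j: "coeff P j \<noteq> 0" using \<open>P \<noteq> 0\<close> by (auto simp: poly_eq_iff)
    then obtain i where i: "real i + h * real j = m" using ipolyD(3)[OF F(1)] by blast
    then have "c2 F i j = coeff P j" by (rule ipolyD(2)[OF F(1)])
    moreover have "c2 F i j = 0" using i \<open>m < n\<close> by (intro ipolyD(1)[OF F(2)]) simp
    ultimately show False using j by simp
  qed
  from this[OF F nz(1)] this[OF F(2,1) nz(2)] show ?thesis by simp
qed

lemma ipoly_unique:
  assumes F: "ipoly h F m P" "ipoly h F m Q"
  shows "P = Q"
proof (rule poly_eqI)
  fix j show "coeff P j = coeff Q j"
  proof (cases "\<exists>i. real i + h * real j = m")
    case True
    then show ?thesis using ipolyD(2)[OF F(1)] ipolyD(2)[OF F(2)] by metis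
  next
    case False
    then show ?thesis using ipolyD(3)[OF F(1)] ipolyD(3)[OF F(2)] by metis
  qed
qed

lemma ipoly_dy:
  assumes F: "ipoly h F m P"
  shows "ipoly h (dy F) (m - h) (pderiv P)"
  unfolding ipoly_def
proof (intro conjI allI impI)
  fix i j
  show "c2 (dy F) i j = 0" if "real i + h * real j < m - h"
    using that ipolyD(1)[OF F, of i "Suc j"] by (simp add: c2_dy algebra_simps)
  show "c2 (dy F) i j = coeff (pderiv P) j" if "real i + h * real j = m - h"
    using that ipolyD(2)[OF F, of i "Suc j"] by (simp add: c2_dy coeff_pderiv algebra_simps)
  show "\<exists>i. real i + h * real j = m - h" if "coeff (pderiv P) j \<noteq> 0"
  proof -
    have "coeff P (Suc j) \<noteq> 0" using that by (auto simp: coeff_pderiv)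
    from ipolyD(3)[OF F this] show ?thesis by (auto simp: algebra_simps)
  qed
qed

lemma ipoly_exists:
  assumes h: "h > 0" and F: "\<And>i j. real i + h * real j < m \<Longrightarrow> c2 F i j = 0"
  shows "\<exists>P. ipoly h F m P"
proof -
  define cf where "cf = (\<lambda>j. if \<exists>i. real i + h * real j = m then c2 F (THE i. real i + h * real j = m) j else 0)"
  have cf: "cf j = c2 F i j" if "real i + h * real j = m" for i j
  proof -
    have "(THE i. real i + h * real j = m) = i" using that by (intro the_equality) auto
    then show ?thesis using that by (auto simp: cf_def)
  qed
  obtain J where J: "m / h < real J" using reals_Archimedean2 by blast
  define P where "P = (\<Sum>j\<le>J. monom (cf j) j)"
  have big: "h * real j > m" if "j > J" for j
  proof -
    have "m / h < real j" using J that by linarith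
    then show ?thesis using h by (simp add: field_simps)
  qed
  have P: "coeff P j = cf j" for j
  proof (cases "j \<le> J")
    case False
    then have "\<not> (\<exists>i. real i + h * real j = m)" using big[of j]
      by (metis add.commute less_add_same_cancel1 not_le not_less_iff_gr_or_eq of_nat_0_le_iff add_increasing)
    then show ?thesis using False by (simp add: P_def coeff_sum cf_def)
  qed (simp add: P_def coeff_sum)
  show ?thesis
    by (rule exI[of _ P]) (use F cf in \<open>auto simp: ipoly_def P cf_def split: if_splits\<close>)
qed

subsection \<open>Initial forms under translation\<close>

definition fpsge :: "real \<Rightarrow> complex fps \<Rightarrow> bool" where
  "fpsge h g \<longleftrightarrow> (\<forall>i. real i < h \<longrightarrow> fps_nth g i = 0)"

text \<open>Contact exponents h are real. For h not a natural number no series has a term z x^h, so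
  the only possible centre is z = 0; this is the default.\<close>

definition coeff_at :: "real \<Rightarrow> complex fps \<Rightarrow> complex" where
  "coeff_at h g = (if \<exists>i. real i = h then fps_nth g (THE i. real i = h) else 0)"

lemma coeff_at_of_nat [simp]: "coeff_at (real i) g = fps_nth g i"
  by (simp add: coeff_at_def)

lemma coeff_at_not_nat: "\<nexists>i. real i = h \<Longrightarrow> coeff_at h g = 0"
  by (simp add: coeff_at_def)

lemma ipoly_YY: "ipoly h YY h [:0, 1:]"
  unfolding ipoly_def
  by (auto simp: c2_YY coeff_pCons split: nat.splits intro: exI[of _ 0])

lemma ipoly_fps_const:
  assumes h: "h > 0" and g: "fpsge s g"
  shows "ipoly h (fps_const g) s [:coeff_at s g:]"
  unfolding ipoly_def
proof (intro conjI allI impI)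
  fix i j
  show "c2 (fps_const g) i j = 0" if "real i + h * real j < s"
    using that g by (auto simp: c2_const_series fpsge_def)
  show "c2 (fps_const g) i j = coeff [:coeff_at s g:] j" if "real i + h * real j = s"
    using that by (cases j) (auto simp: c2_const_series)
  show "\<exists>i. real i + h * real j = s" if "coeff [:coeff_at s g:] j \<noteq> 0"
    using that coeff_at_not_nat[of s g] by (cases j) auto
qed

lemma fpsge_uminus: "fpsge h g \<Longrightarrow> fpsge h (- g)"
  and coeff_at_uminus: "coeff_at h (- g) = - coeff_at h g"
  by (auto simp: fpsge_def coeff_at_def)

lemma ipoly_linear:
  assumes "h > 0" "fpsge h g"
  shows "ipoly h (YY + fps_const g) h [:coeff_at h g, 1:]"
  using ipoly_add[OF ipoly_YY ipoly_fps_const[OF assms]] by simp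

lemma ipoly_shift:
  assumes h: "h > 0" and F: "ipoly h F m P" and g: "fpsge h g"
  shows "ipoly h (shift g F) m (pcompose P [:coeff_at h g, 1:])"
proof -
  have g0: "fps_nth g 0 = 0" using g h by (simp add: fpsge_def)
  define z where "z = coeff_at h g"
  \<comment> \<open>\<open>YY ^ J\<close> already has weight above m, so the tail of F from there on
    contributes a zero initial form, also after the translation.\<close>
  obtain J where J: "m / h < real J" using reals_Archimedean2 by blast
  then have mJ: "m < h * real J" using h by (simp add: field_simps)
  define R where "R = fps_shift J F"
  have F_split: "F = (\<Sum>j<J. fps_const (fps_nth F j) * YY ^ j) + YY ^ J * R"
  proof (rule fps_ext)
    fix n
    have "fps_nth (\<Sum>j<J. fps_const (fps_nth F j) * YY ^ j) n = (if n < J then fps_nth F n else 0)"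
      by (simp add: fps_sum_nth YY_def if_distrib[of "(*) _"] cong: if_cong)
    moreover have "fps_nth (YY ^ J * R) n = (if n < J then 0 else fps_nth F n)"
      by (simp add: R_def YY_def fps_X_power_mult_nth)
    ultimately show "fps_nth F n = fps_nth ((\<Sum>j<J. fps_const (fps_nth F j) * YY ^ j) + YY ^ J * R) n"
      by simp
  qed
  have shift_sum: "shift g (sum f S) = (\<Sum>s\<in>S. shift g (f s))" for f and S :: "nat set"
    by (induction S rule: infinite_finite_induct) (simp_all add: shift_hom[OF g0], simp_all add: shift_def)
  have shift_power: "shift g (H ^ k) = shift g H ^ k" for H k
    by (induction k) (simp_all add: shift_hom[OF g0])
  have "shift g F = (\<Sum>j<J. fps_const (fps_nth F j) * (YY + fps_const g) ^ j) + (YY + fps_const g) ^ J * shift g R"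
    by (subst F_split) (simp add: shift_hom[OF g0] shift_sum shift_power)
  moreover have lin: "ipoly h ((YY + fps_const g) ^ j) (real j * h) ([:z, 1:] ^ j)" for j
    unfolding z_def by (intro ipoly_power ipoly_linear h g)
  have "ipoly h (fps_const (fps_nth F j) * (YY + fps_const g) ^ j) ((m - h * real j) + real j * h) ([:coeff P j:] * [:z, 1:] ^ j)" for j
  proof (rule ipoly_mult[OF _ lin])
    show "ipoly h (fps_const (fps_nth F j)) (m - h * real j) [:coeff P j:]"
      unfolding ipoly_def
    proof (intro conjI allI impI)
      fix i l
      show "c2 (fps_const (fps_nth F j)) i l = 0" if "real i + h * real l < m - h * real j"
        using that ipolyD(1)[OF F, of i j] by (auto simp: c2_const_series c2_def)
      show "c2 (fps_const (fps_nth F j)) i l = coeff [:coeff P j:] l" if "real i + h * real l = m - h * real j"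
        using that ipolyD(2)[OF F, of i j] by (cases l) (auto simp: c2_const_series c2_def)
      show "\<exists>i. real i + h * real l = m - h * real j" if "coeff [:coeff P j:] l \<noteq> 0"
        using that ipolyD(3)[OF F, of j] by (cases l) (auto simp: algebra_simps)
    qed
  qed
  then have "ipoly h (fps_const (fps_nth F j) * (YY + fps_const g) ^ j) m ([:coeff P j:] * [:z, 1:] ^ j)" for j
    by (simp add: mult.commute[of h])
  moreover have "ipoly h ((YY + fps_const g) ^ J * shift g R) m 0"
    by (rule ipoly_smaller[OF ipoly_mult[OF lin[of J] ipoly_const[OF h]]]) (use mJ in \<open>simp add: mult.commute\<close>)
  ultimately have "ipoly h (shift g F) m ((\<Sum>j<J. [:coeff P j:] * [:z, 1:] ^ j) + 0)"
    by (simp only:) (intro ipoly_add ipoly_sum)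
  moreover have "(\<Sum>j<J. [:coeff P j:] * [:z, 1:] ^ j) = pcompose P [:z, 1:]"
  proof -
    have P0: "coeff P j = 0" if "j \<ge> J" for j
    proof (rule ccontr)
      assume "coeff P j \<noteq> 0"
      then obtain i where "real i + h * real j = m" using ipolyD(3)[OF F] by blast
      moreover have "h * real J \<le> h * real j" using h that by simp
      ultimately show False using mJ of_nat_0_le_iff[of i] by linarith
    qed
    have "poly (\<Sum>j<J. [:coeff P j:] * [:z, 1:] ^ j) x = poly (pcompose P [:z, 1:]) x" for x
    proof -
      have "poly P y = (\<Sum>j<J. coeff P j * y ^ j)" for y
        unfolding poly_altdef using P0
        by (intro sum.mono_neutral_cong) (auto simp: coeff_eq_0 not_le not_less)
      then show ?thesis by (simp add: poly_pcompose poly_sum)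
    qed
    then show ?thesis by (simp add: poly_eq_poly_eq_iff[symmetric] fun_eq_iff)
  qed
  ultimately show ?thesis by (simp add: z_def)
qed

section \<open>Comparison of the critical values\<close>

lemma order_prod_mset_linear:
  "order x (\<Prod>z\<in>#A. [:- z, 1:]) = count A (x :: complex)"
proof (induction A)
  case (add z A)
  have "(\<Prod>z\<in>#A. [:- z, 1:]) \<noteq> 0" by (auto simp: prod_mset_zero_iff)
  then have "order x ([:- z, 1:] * (\<Prod>z\<in>#A. [:- z, 1:])) = order x [:- z, 1:] + order x (\<Prod>z\<in>#A. [:- z, 1:])"
    by (intro order_mult) (simp only: mult_eq_0_iff pCons_eq_0_iff, simp)
  moreover have "order x [:- z, 1:] = (if x = z then 1 else 0)"
    using order_power_n_n[of z 1] by (auto intro!: order_0I)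
  ultimately show ?case using add by simp
qed simp

lemma smult_prod_mset_linear_inj:
  assumes "smult a (\<Prod>z\<in>#A. [:- z, 1:]) = smult b (\<Prod>z\<in>#B. [:- z, 1:])" "a \<noteq> 0" "b \<noteq> (0 :: complex)"
  shows "A = B"
proof (rule multiset_eqI)
  fix x
  show "count A x = count B x"
    using arg_cong[OF assms(1), of "order x"] assms(2,3) by (simp add: order_smult order_prod_mset_linear)
qed

text \<open>Allows two families of critical points to be compared class by class, without matching
  individual points.\<close>

lemma image_mset_eq_by_keys:
  assumes "\<And>K. image_mset f {#x \<in># A. k x = K#} = image_mset g {#x \<in># B. k x = K#}"
  shows "image_mset f A = image_mset g B"
proof -
  have "image_mset f {#x \<in># A. k x \<in> S#} = image_mset g {#x \<in># B. k x \<in> S#}" if "finite S" for S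
    using that
  proof (induction S rule: finite_induct)
    case (insert K S)
    have "{#x \<in># C. k x \<in> insert K S#} = {#x \<in># C. k x = K#} + {#x \<in># C. k x \<in> S#}" for C
      by (rule multiset_eqI) (use insert.hyps in auto)
    then show ?case using insert.IH assms[of K] by simp
  qed simp
  from this[of "k ` (set_mset A \<union> set_mset B)"] show ?thesis by (simp cong: filter_mset_cong)
qed

lemma ipoly_minus_ge:
  assumes "h > 0" "fpsge h g"
  shows "ipoly h (YY - fps_const g) h [:- coeff_at h g, 1:]"
  using ipoly_linear[OF assms(1) fpsge_uminus[OF assms(2)]]
  by (simp add: coeff_at_uminus flip: fps_const_neg)

lemma fpsge_subdegree: "fpsge (real (subdegree g)) g"
  unfolding fpsge_def of_nat_less_iff by (intro allI impI nth_less_subdegree_zero)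

lemma ipoly_minus_less:
  assumes h: "h > 0" and s: "real (subdegree g) < h"
  shows "ipoly h (YY - fps_const g) (real (subdegree g)) [:- fps_nth g (subdegree g):]"
proof -
  have "ipoly h (fps_const (- g)) (real (subdegree g)) [:coeff_at (real (subdegree g)) (- g):]"
    by (intro ipoly_fps_const[OF h] fpsge_uminus fpsge_subdegree)
  from ipoly_add[OF ipoly_smaller[OF ipoly_YY s] this] show ?thesis
    by (simp add: coeff_at_uminus flip: fps_const_neg)
qed

text \<open>If g has order below h, its leading term has smaller weight than y and only a constant
  survives; otherwise y survives and the factor yields a root.\<close>

lemma ipoly_linear_factor:
  assumes h: "h > 0"
  shows "\<exists>m c. c \<noteq> 0 \<and> ipoly h (YY - fps_const g) m (if fpsge h g then [:- coeff_at h g, 1:] else [:c:])"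
proof (cases "fpsge h g")
  case True
  then show ?thesis using ipoly_minus_ge[OF h True] by (intro exI[of _ h] exI[of _ 1]) simp
next
  case False
  then obtain i where i: "real i < h" "fps_nth g i \<noteq> 0" by (auto simp: fpsge_def)
  have "real (subdegree g) \<le> real i" using subdegree_leI[OF i(2)] by (rule of_nat_mono)
  with i(1) have "real (subdegree g) < h" by (rule le_less_trans[rotated])
  from ipoly_minus_less[OF h this] have "ipoly h (YY - fps_const g) (real (subdegree g))
      (if fpsge h g then [:- coeff_at h g, 1:] else [:- fps_nth g (subdegree g):])" by (simp only: False if_False)
  moreover have "- fps_nth g (subdegree g) \<noteq> 0" using i(2) by (metis fps_zero_nth neg_equal_0_iff_equal nth_subdegree_zero_iff)
  ultimately show ?thesis by blast
qed

lemma ipoly_prod_linear: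
  assumes h: "h > 0"
  shows "\<exists>m c. c \<noteq> 0 \<and> ipoly h (\<Prod>g\<in>#\<Gamma>. YY - fps_const g) m
     (smult c (\<Prod>z\<in>#image_mset (coeff_at h) {#g \<in># \<Gamma>. fpsge h g#}. [:- z, 1:]))"
proof (induction \<Gamma>)
  case empty
  show ?case using ipoly_1[OF h] by (intro exI[of _ "0 :: real"] exI[of _ "1 :: complex"]) (simp add: one_pCons)
next
  case (add g \<Gamma>)
  obtain m c where 1: "c \<noteq> 0" "ipoly h (\<Prod>g\<in>#\<Gamma>. YY - fps_const g) m
     (smult c (\<Prod>z\<in>#image_mset (coeff_at h) {#g \<in># \<Gamma>. fpsge h g#}. [:- z, 1:]))"
    using add by (elim exE conjE)
  obtain m' c' where 2: "c' \<noteq> 0" "ipoly h (YY - fps_const g) m' (if fpsge h g then [:- coeff_at h g, 1:] else [:c':])"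
    using ipoly_linear_factor[OF h, of g] by (elim exE conjE)
  have "\<exists>d. d \<noteq> 0 \<and> (if fpsge h g then [:- coeff_at h g, 1:] else [:c':]) *
      smult c (\<Prod>z\<in>#image_mset (coeff_at h) {#g \<in># \<Gamma>. fpsge h g#}. [:- z, 1:])
    = smult d (\<Prod>z\<in>#image_mset (coeff_at h) {#g \<in># add_mset g \<Gamma>. fpsge h g#}. [:- z, 1:])"
    using 1(1) 2(1) by (auto intro: exI[of _ c] exI[of _ "c * c'"])
  then obtain d where d: "d \<noteq> 0" "(if fpsge h g then [:- coeff_at h g, 1:] else [:c':]) *
      smult c (\<Prod>z\<in>#image_mset (coeff_at h) {#g \<in># \<Gamma>. fpsge h g#}. [:- z, 1:])
    = smult d (\<Prod>z\<in>#image_mset (coeff_at h) {#g \<in># add_mset g \<Gamma>. fpsge h g#}. [:- z, 1:])"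
    by (elim exE conjE)
  have "(\<Prod>g\<in>#add_mset g \<Gamma>. YY - fps_const g) = (YY - fps_const g) * (\<Prod>g\<in>#\<Gamma>. YY - fps_const g)" by simp
  with ipoly_mult[OF 2(2) 1(2)] d(1) show ?case unfolding d(2) by (intro exI conjI) (assumption, simp only:)
qed

lemma pcompose_linear_degree: "degree (pcompose P [:z, 1:]) = degree (P :: complex poly)"
  by (simp add: degree_pcompose)

definition x0 :: "fps2 \<Rightarrow> complex fps" where "x0 F = Abs_fps (c2 F 0)"

lemma x0_mult: "x0 (F * G) = x0 F * x0 G"
  by (simp add: x0_def fps_eq_iff c2_mult fps_mult_nth atLeast0AtMost)

lemma x0_eq_0_iff: "x0 F = 0 \<longleftrightarrow> XX dvd F"
  by (simp add: x0_def fps_eq_iff XX_dvd_iff)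

lemma XX_dvd_shift_iff:
  assumes "fps_nth g 0 = 0"
  shows "XX dvd shift g F \<longleftrightarrow> XX dvd F"
proof -
  have *: "XX dvd shift h G" if "XX dvd G" "fps_nth h 0 = 0" for G h
    using subst_dvd[of XX "YY + fps_const h" XX G] that by (simp add: shift_def)
  show ?thesis using *[of F g] *[of "shift g F" "- g"] assms by (auto simp: shift_shift)
qed

text \<open>
  \<open>h\<close> is the slope of the first edge of the Newton polygon of \<open>f(x, \<phi> + y)\<close>, i.e. the largest order
  of contact of \<open>y = \<phi>(x)\<close> with a branch of \<open>f = 0\<close>.
\<close>
definition slope :: "fps2 \<Rightarrow> complex fps \<Rightarrow> real \<Rightarrow> bool" where
  "slope F \<phi> h \<longleftrightarrow> h > 0 \<and>
     (\<exists>P. ipoly h (shift \<phi> F) (real (subdegree (eval2 F fps_X \<phi>))) P \<and> degree P > 0)"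

lemma slope_exists:
  assumes F: "c2 F 0 0 = 0" "\<not> XX dvd F" and \<phi>: "fps_nth \<phi> 0 = 0" "eval2 F fps_X \<phi> \<noteq> 0"
  shows "\<exists>h. slope F \<phi> h"
proof -
  define A where "A = shift \<phi> F"
  define \<theta> where "\<theta> = subdegree (eval2 F fps_X \<phi>)"
  have A0: "fps_nth A 0 = eval2 F fps_X \<phi>" using \<phi> by (simp add: A_def shift_nth_0)
  have "fps_nth (eval2 F fps_X \<phi>) 0 = 0" using F \<phi> by simp
  then have \<theta>: "\<theta> > 0" using \<phi>(2) by (auto simp: \<theta>_def subdegree_eq_0_iff intro!: Nat.gr0I)
  have "\<not> XX dvd A" using F \<phi> by (simp add: A_def XX_dvd_shift_iff)
  then obtain p where p: "c2 A 0 p \<noteq> 0" by (auto simp: XX_dvd_iff)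
  have "p \<noteq> 0" using p A0 \<open>fps_nth (eval2 F fps_X \<phi>) 0 = 0\<close> by (auto simp: c2_def intro!: Nat.gr0I)
  define S where "S = {j\<in>{1..p}. fps_nth A j \<noteq> 0}"
  \<comment> \<open>\<open>sl j\<close> is the weight of y for which the lowest term of the
    coefficient of y^j has the same weight \<theta> as the value on the curve; the maximum belongs
    to the first edge. Indices beyond p are harmless because h p \<ge> \<theta>.\<close>
  define sl where "sl = (\<lambda>j. (real \<theta> - real (subdegree (fps_nth A j))) / real j)"
  define h where "h = Max (sl ` S)"
  have fin: "finite S" by (simp add: S_def)
  have pS: "p \<in> S" using p \<open>p \<noteq> 0\<close> by (auto simp: S_def c2_def)
  have hmax: "sl j \<le> h" if "j \<in> S" for j using fin that by (simp add: h_def)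
  have "h \<in> sl ` S" unfolding h_def using fin pS by (intro Max_in) auto
  then obtain j0 where j0: "j0 \<in> S" "h = sl j0" by blast
  have "subdegree (fps_nth A p) = 0" using p by (simp add: c2_def)
  then have hp: "real \<theta> / real p \<le> h" using hmax[OF pS] by (simp add: sl_def)
  then have h: "h > 0" using \<theta> \<open>p \<noteq> 0\<close> by (smt (verit) divide_pos_pos of_nat_0_less_iff bot_nat_0.not_eq_extremum)
  have "c2 A i j = 0" if ij: "real i + h * real j < real \<theta>" for i j
  proof (cases "j = 0")
    case True
    then have "i < subdegree (fps_nth A j)" using ij by (simp add: A0 \<theta>_def)
    then show ?thesis unfolding c2_def by (rule nth_less_subdegree_zero)
  next
    case False
    have "j \<le> p"
    proof (rule ccontr)
      assume "\<not> j \<le> p"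
      then have "h * real p \<le> h * real j" using h by simp
      moreover have "real \<theta> \<le> h * real p" using hp \<open>p \<noteq> 0\<close> by (simp add: field_simps)
      ultimately show False using ij of_nat_0_le_iff[of i] by linarith
    qed
    show ?thesis
    proof (cases "fps_nth A j = 0")
      case nz: False
      then have "sl j \<le> h" using False \<open>j \<le> p\<close> by (intro hmax) (auto simp: S_def)
      then have "real \<theta> - real (subdegree (fps_nth A j)) \<le> h * real j"
        using False by (simp add: sl_def field_simps)
      then have "i < subdegree (fps_nth A j)" using ij by linarith
      then show ?thesis unfolding c2_def by (rule nth_less_subdegree_zero)
    qed (simp add: c2_def)
  qed
  then obtain P where P: "ipoly h A (real \<theta>) P" using ipoly_exists[OF h, of "real \<theta>" A] by blast
  have "real (subdegree (fps_nth A j0)) + h * real j0 = real \<theta>"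
    using j0 by (auto simp: sl_def S_def)
  then have "coeff P j0 = c2 A (subdegree (fps_nth A j0)) j0" by (rule ipolyD(2)[OF P, symmetric])
  then have "coeff P j0 \<noteq> 0" using j0 by (auto simp: c2_def S_def)
  then have "j0 \<le> degree P" by (rule le_degree)
  then have "degree P > 0" using j0 by (auto simp: S_def)
  then show ?thesis using P h unfolding slope_def A_def \<theta>_def by blast
qed

lemma slope_unique:
  assumes "slope F \<phi> h" "slope F \<phi> k"
  shows "h = k"
proof -
  have "\<not> h < k" if hk: "slope F \<phi> h" "slope F \<phi> k" for h k
  proof
    assume "h < k"
    obtain P where P: "ipoly k (shift \<phi> F) (real (subdegree (eval2 F fps_X \<phi>))) P" "degree P > 0"
      using hk(2) by (auto simp: slope_def)
    obtain Q where Q: "ipoly h (shift \<phi> F) (real (subdegree (eval2 F fps_X \<phi>))) Q"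
      using hk(1) by (auto simp: slope_def)
    define j where "j = degree P"
    have j: "coeff P j \<noteq> 0" "j > 0" using P(2) by (auto simp: j_def leading_coeff_0_iff)
    then obtain i where i: "real i + k * real j = real (subdegree (eval2 F fps_X \<phi>))"
      using ipolyD(3)[OF P(1)] by blast
    have "h * real j < k * real j" using \<open>h < k\<close> j by simp
    then have "c2 (shift \<phi> F) i j = 0" using i by (intro ipolyD(1)[OF Q]) simp
    then show False using ipolyD(2)[OF P(1) i] j by simp
  qed
  from this[OF assms] this[OF assms(2,1)] show ?thesis by simp
qed

text \<open>A ball around \<phi> without the roots of its initial polynomial, since these have
  values of higher order. Taking the set itself as the key makes having equal keys an equivalence
  relation.\<close>

definition key :: "fps2 \<Rightarrow> complex fps \<Rightarrow> complex fps set" where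
  "key F \<phi> = {\<gamma>. fpsge (THE h. slope F \<phi> h) (\<gamma> - \<phi>) \<and>
     subdegree (eval2 F fps_X \<gamma>) = subdegree (eval2 F fps_X \<phi>)}"

lemma ipoly_ball:
  assumes h: "h > 0" and P: "ipoly h (shift \<phi> F) m P" and \<phi>: "fps_nth \<phi> 0 = 0"
    and \<gamma>: "fpsge h (\<gamma> - \<phi>)"
  shows "ipoly h (shift \<gamma> F) m (pcompose P [:coeff_at h (\<gamma> - \<phi>), 1:])"
    and "fps_nth \<gamma> 0 = 0"
proof -
  have 0: "fps_nth (\<gamma> - \<phi>) 0 = 0" using \<gamma> h by (simp add: fpsge_def)
  then show "fps_nth \<gamma> 0 = 0" using \<phi> by simp
  have "shift (\<gamma> - \<phi>) (shift \<phi> F) = shift \<gamma> F" using 0 \<phi> by (simp add: shift_shift)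
  with ipoly_shift[OF h P \<gamma>] show "ipoly h (shift \<gamma> F) m (pcompose P [:coeff_at h (\<gamma> - \<phi>), 1:])" by simp
qed

lemma ipoly_value:
  assumes P: "ipoly h (shift \<gamma> F) (real m) P" and \<gamma>: "fps_nth \<gamma> 0 = 0"
  shows "i < m \<Longrightarrow> fps_nth (eval2 F fps_X \<gamma>) i = 0" "fps_nth (eval2 F fps_X \<gamma>) m = poly P 0"
  using ipolyD(1)[OF P, of i 0] ipolyD(2)[OF P, of m 0] \<gamma>
  by (simp_all add: c2_def shift_nth_0 poly_0_coeff_0)

text \<open>Around \<gamma> the initial polynomial is a translate of the one around \<phi>, of the
  same degree, so the slope is the same; and every point of an ultrametric ball is a centre of
  it.\<close>

lemma key_cong:
  assumes F: "c2 F 0 0 = 0" "\<not> XX dvd F" and \<phi>: "fps_nth \<phi> 0 = 0" "eval2 F fps_X \<phi> \<noteq> 0"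
    and \<gamma>: "eval2 F fps_X \<gamma> \<noteq> 0" "\<gamma> \<in> key F \<phi>"
  shows "key F \<gamma> = key F \<phi>"
proof -
  obtain h where h: "slope F \<phi> h" using slope_exists[OF F \<phi>] by blast
  then have the: "(THE h. slope F \<phi> h) = h" using slope_unique by blast
  have ball: "fpsge h (\<gamma> - \<phi>)" and sub: "subdegree (eval2 F fps_X \<gamma>) = subdegree (eval2 F fps_X \<phi>)"
    using \<gamma>(2) by (auto simp: key_def the)
  obtain P where P: "h > 0" "ipoly h (shift \<phi> F) (real (subdegree (eval2 F fps_X \<phi>))) P" "degree P > 0"
    using h by (auto simp: slope_def)
  have "slope F \<gamma> h"
    using ipoly_ball(1)[OF P(1,2) \<phi>(1) ball] P(1,3) unfolding slope_def sub by (auto simp: pcompose_linear_degree)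
  then have the': "(THE h. slope F \<gamma> h) = h" using slope_unique by blast
  have "fpsge h (\<psi> - \<gamma>) \<longleftrightarrow> fpsge h (\<psi> - \<phi>)" for \<psi>
    using ball unfolding fpsge_def by auto
  then show ?thesis by (simp add: key_def the the' sub)
qed

lemma key_eq_iff:
  assumes F: "c2 F 0 0 = 0" "\<not> XX dvd F" and \<phi>: "fps_nth \<phi> 0 = 0" "eval2 F fps_X \<phi> \<noteq> 0"
    and \<gamma>: "eval2 F fps_X \<gamma> \<noteq> 0"
  shows "key F \<gamma> = key F \<phi> \<longleftrightarrow> \<gamma> \<in> key F \<phi>"
proof
  have "\<gamma> \<in> key F \<gamma>" by (simp add: key_def fpsge_def)
  then show "\<gamma> \<in> key F \<phi>" if "key F \<gamma> = key F \<phi>" using that by simp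
qed (rule key_cong[OF F \<phi> \<gamma>])

definition lead :: "complex fps \<Rightarrow> nat \<times> complex" where
  "lead a = (subdegree a, fps_nth a (subdegree a))"

text \<open>
  If \<open>P\<close> is the initial form of \<open>F\<close> around \<open>\<phi>\<close>, that of \<open>\<partial>F/\<partial>y\<close> is \<open>P'\<close>, so the critical points near
  \<open>\<phi>\<close> are the roots of \<open>P'\<close> and the leading coefficients of the critical values are the values of \<open>P\<close>
  there.
\<close>
lemma lead_critical_values_near:
  assumes \<phi>: "fps_nth \<phi> 0 = 0" and h: "h > 0"
    and P: "ipoly h (shift \<phi> G) (real m) P" "degree P > 0"
    and crit: "U dvd 1" "dy G = U * (\<Prod>\<gamma>\<in>#\<Gamma>. YY - fps_const \<gamma>)"
    and \<Gamma>: "\<And>\<gamma>. \<gamma> \<in># \<Gamma> \<Longrightarrow> fps_nth \<gamma> 0 = 0 \<and> eval2 G fps_X \<gamma> \<noteq> 0"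
  shows "\<exists>c. c \<noteq> 0 \<and> pderiv P =
      smult c (\<Prod>z\<in>#image_mset (\<lambda>\<gamma>. coeff_at h (\<gamma> - \<phi>)) {#\<gamma> \<in># \<Gamma>. fpsge h (\<gamma> - \<phi>)#}. [:- z, 1:])"
    and "image_mset (\<lambda>\<gamma>. lead (eval2 G fps_X \<gamma>))
        {#\<gamma> \<in># \<Gamma>. fpsge h (\<gamma> - \<phi>) \<and> subdegree (eval2 G fps_X \<gamma>) = m#} =
      image_mset (\<lambda>z. (m, poly P z))
        {#z \<in># image_mset (\<lambda>\<gamma>. coeff_at h (\<gamma> - \<phi>)) {#\<gamma> \<in># \<Gamma>. fpsge h (\<gamma> - \<phi>)#}. poly P z \<noteq> 0#}"
proof -
  have "shift \<phi> (\<Prod>\<gamma>\<in>#\<Gamma>. YY - fps_const \<gamma>) = (\<Prod>g\<in>#image_mset (\<lambda>\<gamma>. \<gamma> - \<phi>) \<Gamma>. YY - fps_const g)"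
    by (induction \<Gamma>) (simp_all add: shift_hom[OF \<phi>] algebra_simps flip: fps_const_sub)
  moreover obtain n c where c: "c \<noteq> 0"
    "ipoly h (\<Prod>g\<in>#image_mset (\<lambda>\<gamma>. \<gamma> - \<phi>) \<Gamma>. YY - fps_const g) n
       (smult c (\<Prod>z\<in>#image_mset (coeff_at h) {#g \<in># image_mset (\<lambda>\<gamma>. \<gamma> - \<phi>) \<Gamma>. fpsge h g#}. [:- z, 1:]))"
    using ipoly_prod_linear[OF h, of "image_mset (\<lambda>\<gamma>. \<gamma> - \<phi>) \<Gamma>"] by (elim exE conjE)
  moreover have "image_mset (coeff_at h) {#g \<in># image_mset (\<lambda>\<gamma>. \<gamma> - \<phi>) \<Gamma>. fpsge h g#}
      = image_mset (\<lambda>\<gamma>. coeff_at h (\<gamma> - \<phi>)) {#\<gamma> \<in># \<Gamma>. fpsge h (\<gamma> - \<phi>)#}"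
    by (simp add: filter_mset_image_mset image_mset.compositionality comp_def)
  ultimately have "ipoly h (shift \<phi> U * shift \<phi> (\<Prod>\<gamma>\<in>#\<Gamma>. YY - fps_const \<gamma>)) (0 + n)
      ([:c2 (shift \<phi> U) 0 0:] *
       smult c (\<Prod>z\<in>#image_mset (\<lambda>\<gamma>. coeff_at h (\<gamma> - \<phi>)) {#\<gamma> \<in># \<Gamma>. fpsge h (\<gamma> - \<phi>)#}. [:- z, 1:]))"
    by (intro ipoly_mult ipoly_const h) simp
  moreover have "shift \<phi> U * shift \<phi> (\<Prod>\<gamma>\<in>#\<Gamma>. YY - fps_const \<gamma>) = dy (shift \<phi> G)"
    using \<phi> by (simp add: crit(2) dy_shift shift_hom)
  moreover define d where "d = c2 (shift \<phi> U) 0 0 * c"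
  ultimately have 1: "ipoly h (dy (shift \<phi> G)) n
      (smult d (\<Prod>z\<in>#image_mset (\<lambda>\<gamma>. coeff_at h (\<gamma> - \<phi>)) {#\<gamma> \<in># \<Gamma>. fpsge h (\<gamma> - \<phi>)#}. [:- z, 1:]))"
    by (simp add: mult.commute)
  have d: "d \<noteq> 0" using c crit(1) \<phi> by (simp add: d_def unit2_iff shift_def)
  have 2: "ipoly h (dy (shift \<phi> G)) (real m - h) (pderiv P)" by (rule ipoly_dy[OF P(1)])
  \<comment> \<open>Positive degree makes P' nonzero, so the two descriptions of the initial form of
    the derivative have the same weight and therefore agree.\<close>
  have "pderiv P \<noteq> 0" using P(2) by (simp add: pderiv_eq_0_iff)
  moreover have "smult d (\<Prod>z\<in>#image_mset (\<lambda>\<gamma>. coeff_at h (\<gamma> - \<phi>)) {#\<gamma> \<in># \<Gamma>. fpsge h (\<gamma> - \<phi>)#}. [:- z, 1:]) \<noteq> 0"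
    using d by (auto simp: prod_mset_zero_iff)
  ultimately have "real m - h = n" using ipoly_unique_weight[OF 2 1] by blast
  with ipoly_unique 1 2 d show "\<exists>c. c \<noteq> 0 \<and> pderiv P =
      smult c (\<Prod>z\<in>#image_mset (\<lambda>\<gamma>. coeff_at h (\<gamma> - \<phi>)) {#\<gamma> \<in># \<Gamma>. fpsge h (\<gamma> - \<phi>)#}. [:- z, 1:])"
    by blast
  \<comment> \<open>With z the coefficient of x^h in \<gamma> - \<phi>, the critical value has order
    at least m and P(z) as its coefficient of x^m, so the order is m exactly when P(z) is
    nonzero.\<close>
  have vals: "(subdegree (eval2 G fps_X \<gamma>) = m \<longleftrightarrow> poly P (coeff_at h (\<gamma> - \<phi>)) \<noteq> 0) \<and>
      fps_nth (eval2 G fps_X \<gamma>) m = poly P (coeff_at h (\<gamma> - \<phi>))"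
    if \<gamma>: "\<gamma> \<in># \<Gamma>" "fpsge h (\<gamma> - \<phi>)" for \<gamma>
  proof -
    note b = ipoly_ball[OF h P(1) \<phi> \<gamma>(2)]
    have v: "fps_nth (eval2 G fps_X \<gamma>) m = poly P (coeff_at h (\<gamma> - \<phi>))"
      using ipoly_value(2)[OF b] by (simp add: poly_pcompose)
    have "subdegree (eval2 G fps_X \<gamma>) = m" if "poly P (coeff_at h (\<gamma> - \<phi>)) \<noteq> 0"
      using that ipoly_value(1)[OF b] by (intro subdegreeI) (simp_all add: v)
    moreover have "fps_nth (eval2 G fps_X \<gamma>) m \<noteq> 0" if "subdegree (eval2 G fps_X \<gamma>) = m"
      using that \<Gamma>[OF \<gamma>(1)] by auto
    ultimately show ?thesis using v by auto
  qed
  have "{#\<gamma> \<in># \<Gamma>. fpsge h (\<gamma> - \<phi>) \<and> subdegree (eval2 G fps_X \<gamma>) = m#}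
      = {#\<gamma> \<in># \<Gamma>. fpsge h (\<gamma> - \<phi>) \<and> poly P (coeff_at h (\<gamma> - \<phi>)) \<noteq> 0#}"
    by (rule filter_mset_cong) (use vals in auto)
  moreover have "image_mset (\<lambda>\<gamma>. lead (eval2 G fps_X \<gamma>)) \<dots>
      = image_mset (\<lambda>\<gamma>. (m, poly P (coeff_at h (\<gamma> - \<phi>)))) \<dots>"
    by (rule image_mset_cong) (use vals in \<open>auto simp: lead_def\<close>)
  ultimately show "image_mset (\<lambda>\<gamma>. lead (eval2 G fps_X \<gamma>))
        {#\<gamma> \<in># \<Gamma>. fpsge h (\<gamma> - \<phi>) \<and> subdegree (eval2 G fps_X \<gamma>) = m#} =
      image_mset (\<lambda>z. (m, poly P z))
        {#z \<in># image_mset (\<lambda>\<gamma>. coeff_at h (\<gamma> - \<phi>)) {#\<gamma> \<in># \<Gamma>. fpsge h (\<gamma> - \<phi>)#}. poly P z \<noteq> 0#}"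
    by (simp add: filter_mset_image_mset image_mset.compositionality comp_def filter_filter_mset conj_commute)
qed

lemma lead_critical_values:
  assumes F: "c2 F 0 0 = 0" "\<not> XX dvd F" and W: "W dvd 1"
    and crit: "U dvd 1" "dy F = U * (\<Prod>\<gamma>\<in>#\<Gamma>. YY - fps_const \<gamma>)"
    and \<Gamma>: "\<And>\<gamma>. \<gamma> \<in># \<Gamma> \<Longrightarrow> fps_nth \<gamma> 0 = 0 \<and> eval2 F fps_X \<gamma> \<noteq> 0"
    and crit': "U' dvd 1" "dy (W * F) = U' * (\<Prod>\<gamma>\<in>#\<Gamma>'. YY - fps_const \<gamma>)"
    and \<Gamma>': "\<And>\<gamma>. \<gamma> \<in># \<Gamma>' \<Longrightarrow> fps_nth \<gamma> 0 = 0 \<and> eval2 (W * F) fps_X \<gamma> \<noteq> 0"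
  shows "image_mset (\<lambda>\<gamma>. map_prod id ((*) (c2 W 0 0)) (lead (eval2 F fps_X \<gamma>))) \<Gamma>
       = image_mset (\<lambda>\<gamma>. lead (eval2 (W * F) fps_X \<gamma>)) \<Gamma>'"
proof (rule image_mset_eq_by_keys[where k = "key F"])
  fix K
  define \<kappa> where "\<kappa> = c2 W 0 0"
  have \<kappa>: "\<kappa> \<noteq> 0" using W by (simp add: \<kappa>_def unit2_iff)
  \<comment> \<open>Multiplication by the unit W preserves the order of the values, so the classes
    defined from F also serve for W F.\<close>
  have subW: "eval2 (W * F) fps_X \<gamma> = eval2 W fps_X \<gamma> * eval2 F fps_X \<gamma>"
    "subdegree (eval2 (W * F) fps_X \<gamma>) = subdegree (eval2 F fps_X \<gamma>)" if "fps_nth \<gamma> 0 = 0" for \<gamma>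
  proof -
    show *: "eval2 (W * F) fps_X \<gamma> = eval2 W fps_X \<gamma> * eval2 F fps_X \<gamma>"
      using that by (simp add: eval2_mult)
    have "fps_nth (eval2 W fps_X \<gamma>) 0 \<noteq> 0" using that \<kappa> by (simp add: \<kappa>_def)
    then have "eval2 W fps_X \<gamma> \<noteq> 0" "subdegree (eval2 W fps_X \<gamma>) = 0" by auto
    then show "subdegree (eval2 (W * F) fps_X \<gamma>) = subdegree (eval2 F fps_X \<gamma>)"
      unfolding * by (cases "eval2 F fps_X \<gamma> = 0") simp_all
  qed
  have \<Gamma>'F: "eval2 F fps_X \<gamma> \<noteq> 0" if "\<gamma> \<in># \<Gamma>'" for \<gamma>
    using \<Gamma>'[OF that] subW(1)[of \<gamma>] by auto
  show "image_mset (\<lambda>\<gamma>. map_prod id ((*) (c2 W 0 0)) (lead (eval2 F fps_X \<gamma>))) {#\<gamma> \<in># \<Gamma>. key F \<gamma> = K#}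
      = image_mset (\<lambda>\<gamma>. lead (eval2 (W * F) fps_X \<gamma>)) {#\<gamma> \<in># \<Gamma>'. key F \<gamma> = K#}"
  proof (cases "\<exists>\<phi>. fps_nth \<phi> 0 = 0 \<and> eval2 F fps_X \<phi> \<noteq> 0 \<and> key F \<phi> = K")
    case False
    have 1: "{#\<gamma> \<in># \<Gamma>. key F \<gamma> = K#} = {#}" using False \<Gamma> by auto
    have 2: "{#\<gamma> \<in># \<Gamma>'. key F \<gamma> = K#} = {#}" using False \<Gamma>' \<Gamma>'F by auto
    show ?thesis unfolding 1 2 by simp
  next
    case True
    then obtain \<phi> where \<phi>: "fps_nth \<phi> 0 = 0" "eval2 F fps_X \<phi> \<noteq> 0" "key F \<phi> = K" by blast
    obtain h where h: "slope F \<phi> h" using slope_exists[OF F \<phi>(1,2)] by blast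
    then have the: "(THE h. slope F \<phi> h) = h" using slope_unique by blast
    define m where "m = subdegree (eval2 F fps_X \<phi>)"
    obtain P where P: "h > 0" "ipoly h (shift \<phi> F) (real m) P" "degree P > 0"
      using h by (auto simp: slope_def m_def)
    have "ipoly h (shift \<phi> W * shift \<phi> F) (0 + real m) ([:c2 (shift \<phi> W) 0 0:] * P)"
      by (intro ipoly_mult ipoly_const P)
    then have P': "ipoly h (shift \<phi> (W * F)) (real m) (smult \<kappa> P)"
      using \<phi>(1) by (simp add: shift_hom \<kappa>_def) (simp add: shift_def)
    have dP': "degree (smult \<kappa> P) > 0" using P(3) \<kappa> by simp
    have k: "{#\<gamma> \<in># \<Gamma>. key F \<gamma> = K#} = {#\<gamma> \<in># \<Gamma>. fpsge h (\<gamma> - \<phi>) \<and> subdegree (eval2 F fps_X \<gamma>) = m#}"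
      using \<Gamma> key_eq_iff[OF F \<phi>(1,2)] by (intro filter_mset_cong) (auto simp: key_def the m_def simp flip: \<phi>(3))
    have k': "{#\<gamma> \<in># \<Gamma>'. key F \<gamma> = K#} = {#\<gamma> \<in># \<Gamma>'. fpsge h (\<gamma> - \<phi>) \<and> subdegree (eval2 (W * F) fps_X \<gamma>) = m#}"
      using \<Gamma>' \<Gamma>'F key_eq_iff[OF F \<phi>(1,2)] subW(2)
      by (intro filter_mset_cong) (auto simp: key_def the m_def simp flip: \<phi>(3))
    note near = lead_critical_values_near[OF \<phi>(1) P crit \<Gamma>]
    note near' = lead_critical_values_near[OF \<phi>(1) P(1) P' dP' crit' \<Gamma>']
    define Z where "Z = image_mset (\<lambda>\<gamma>. coeff_at h (\<gamma> - \<phi>)) {#\<gamma> \<in># \<Gamma>. fpsge h (\<gamma> - \<phi>)#}"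
    define Z' where "Z' = image_mset (\<lambda>\<gamma>. coeff_at h (\<gamma> - \<phi>)) {#\<gamma> \<in># \<Gamma>'. fpsge h (\<gamma> - \<phi>)#}"
    obtain c where c: "c \<noteq> 0" "pderiv P = smult c (\<Prod>z\<in>#Z. [:- z, 1:])"
      using near(1) unfolding Z_def by blast
    obtain c' where c': "c' \<noteq> 0" "pderiv (smult \<kappa> P) = smult c' (\<Prod>z\<in>#Z'. [:- z, 1:])"
      using near'(1) unfolding Z'_def by blast
    \<comment> \<open>The derivatives of P and \<kappa> P have the same roots with multiplicity, so
      the multisets of centres agree even though the critical points themselves may differ.\<close>
    have "smult (\<kappa> * c) (\<Prod>z\<in>#Z. [:- z, 1:]) = smult c' (\<Prod>z\<in>#Z'. [:- z, 1:])"
      using c(2) c'(2) by (simp add: pderiv_smult)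
    from smult_prod_mset_linear_inj[OF this] have ZZ: "Z = Z'" using c(1) c'(1) \<kappa> by simp
    have "image_mset (\<lambda>\<gamma>. map_prod id ((*) (c2 W 0 0)) (lead (eval2 F fps_X \<gamma>))) {#\<gamma> \<in># \<Gamma>. key F \<gamma> = K#}
        = image_mset (map_prod id ((*) \<kappa>)) (image_mset (\<lambda>z. (m, poly P z)) {#z \<in># Z. poly P z \<noteq> 0#})"
    proof -
      have "image_mset (\<lambda>\<gamma>. map_prod id ((*) (c2 W 0 0)) (lead (eval2 F fps_X \<gamma>))) X
          = image_mset (map_prod id ((*) \<kappa>)) (image_mset (\<lambda>\<gamma>. lead (eval2 F fps_X \<gamma>)) X)" for X
        by (simp add: image_mset.compositionality comp_def \<kappa>_def)
      then show ?thesis by (simp only: k near(2) Z_def)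
    qed
    also have "\<dots> = image_mset (\<lambda>z. (m, poly (smult \<kappa> P) z)) {#z \<in># Z'. poly (smult \<kappa> P) z \<noteq> 0#}"
      using \<kappa> by (simp add: ZZ image_mset.compositionality comp_def)
    also have "\<dots> = image_mset (\<lambda>\<gamma>. lead (eval2 (W * F) fps_X \<gamma>)) {#\<gamma> \<in># \<Gamma>'. key F \<gamma> = K#}"
      unfolding k' Z'_def by (rule near'(2)[symmetric])
    finally show ?thesis .
  qed
qed

section \<open>Newton diagrams\<close>

text \<open>The initial form of y - a for the weights (1, h), which depends on a only through its
  order and leading coefficient.\<close>

definition lin_poly :: "real \<Rightarrow> nat \<times> complex \<Rightarrow> complex poly" where
  "lin_poly h x = (if real (fst x) > h then [:0, 1:] else if real (fst x) = h then [:- snd x, 1:] else [:- snd x:])"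

lemma ipoly_lin_poly:
  assumes h: "h > 0" and a: "a \<noteq> 0"
  shows "ipoly h (YY - fps_const a) (min h (real (fst (lead a)))) (lin_poly h (lead a))"
proof (cases "real (subdegree a) < h")
  case True
  then show ?thesis using ipoly_minus_less[OF h True] by (simp add: lead_def lin_poly_def)
next
  case False
  have "fpsge h a"
    unfolding fpsge_def
  proof (intro allI impI nth_less_subdegree_zero)
    fix i assume "real i < h"
    then have "real i < real (subdegree a)" using False by linarith
    then show "i < subdegree a" by (simp only: of_nat_less_iff)
  qed
  note i = ipoly_minus_ge[OF h this]
  show ?thesis
  proof (cases "real (subdegree a) = h")
    case True
    then have "coeff_at h a = fps_nth a (subdegree a)" using coeff_at_of_nat[of "subdegree a" a] by simp
    then show ?thesis using i True by (simp add: lead_def lin_poly_def)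
  next
    case ne: False
    have "coeff_at h a = 0"
    proof (cases "\<exists>k. real k = h")
      case True
      then obtain k where k: "real k = h" by blast
      then have "k < subdegree a" using False ne by (metis linorder_neqE_nat of_nat_less_iff)
      then have "fps_nth a k = 0" by (rule nth_less_subdegree_zero)
      then show ?thesis using k coeff_at_of_nat[of k a] by simp
    qed (simp add: coeff_at_not_nat)
    then show ?thesis using i False ne by (simp add: lead_def lin_poly_def)
  qed
qed

lemma ipoly_prod_lead:
  assumes h: "h > 0" and \<Lambda>: "\<And>a. a \<in># \<Lambda> \<Longrightarrow> a \<noteq> 0"
  shows "ipoly h (\<Prod>a\<in>#\<Lambda>. YY - fps_const a) (\<Sum>x\<in>#image_mset lead \<Lambda>. min h (real (fst x)))
    (\<Prod>x\<in>#image_mset lead \<Lambda>. lin_poly h x)"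
  using \<Lambda>
proof (induction \<Lambda>)
  case empty
  then show ?case using ipoly_1[OF h] by simp
next
  case (add a \<Lambda>)
  have "ipoly h ((YY - fps_const a) * (\<Prod>a\<in>#\<Lambda>. YY - fps_const a))
     (min h (real (fst (lead a))) + (\<Sum>x\<in>#image_mset lead \<Lambda>. min h (real (fst x))))
     (lin_poly h (lead a) * (\<Prod>x\<in>#image_mset lead \<Lambda>. lin_poly h x))"
    using add by (intro ipoly_mult ipoly_lin_poly h) auto
  then show ?case by simp
qed

lemma lin_poly_nonzero: "snd x \<noteq> 0 \<Longrightarrow> lin_poly h x \<noteq> 0"
  by (simp add: lin_poly_def)

text \<open>In each of the three cases the form is homogeneous of degree 1 in the variable and the
  leading coefficient. This is where scaled critical values become a rescaling of v.\<close>

lemma lin_poly_scale: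
  assumes "\<kappa> \<noteq> 0"
  shows "pcompose (lin_poly h (map_prod id ((*) \<kappa>) x)) [:0, \<kappa>:] = smult \<kappa> (lin_poly h x)"
  by (cases x) (auto simp: lin_poly_def pcompose_pCons)

lemma prod_lin_poly_scale:
  assumes "\<kappa> \<noteq> 0"
  shows "pcompose (\<Prod>x\<in>#image_mset (map_prod id ((*) \<kappa>)) N. lin_poly h x) [:0, \<kappa>:]
    = smult (\<kappa> ^ size N) (\<Prod>x\<in>#N. lin_poly h x)"
proof (induction N)
  case (add x N)
  have "pcompose (\<Prod>x\<in>#image_mset (map_prod id ((*) \<kappa>)) (add_mset x N). lin_poly h x) [:0, \<kappa>:]
      = pcompose (lin_poly h (map_prod id ((*) \<kappa>) x)) [:0, \<kappa>:]
        * pcompose (\<Prod>x\<in>#image_mset (map_prod id ((*) \<kappa>)) N. lin_poly h x) [:0, \<kappa>:]"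
    by (simp add: pcompose_mult)
  also have "\<dots> = smult (\<kappa> ^ size (add_mset x N)) (\<Prod>x\<in>#add_mset x N. lin_poly h x)"
    unfolding lin_poly_scale[OF assms] add.IH by (simp add: mult.commute[of \<kappa>])
  finally show ?case .
qed (simp add: pcompose_1)

text \<open>Base change turns u^i v^j into x^(M i) y^j, so the weights (w1, w2) on D are the weights
  (1, h) on \<open>pw M D\<close> up to the factor M / w1; this fixes h and \<mu>.\<close>

lemma initial_form:
  assumes M: "M > 0" and w: "w1 > 0" "w2 > 0" and U: "U dvd 1"
    and D: "pw M D = U * (\<Prod>a\<in>#\<Lambda>. YY - fps_const a)" and \<Lambda>0: "0 \<notin># \<Lambda>"
    and h: "h = w2 * real M / w1"
    and \<mu>: "\<mu> = (\<Sum>x\<in>#image_mset lead \<Lambda>. min h (real (fst x))) * w1 / real M"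
  shows "w1 * real i + w2 * real j < \<mu> \<Longrightarrow> c2 D i j = 0"
    and "w1 * real i + w2 * real j = \<mu> \<Longrightarrow> c2 D i j = c2 U 0 0 * coeff (\<Prod>x\<in>#image_mset lead \<Lambda>. lin_poly h x) j"
    and "\<exists>i j. w1 * real i + w2 * real j = \<mu> \<and> c2 D i j \<noteq> 0"
proof -
  have \<Lambda>: "a \<noteq> 0" if "a \<in># \<Lambda>" for a using that \<Lambda>0 by auto
  define P where "P = (\<Prod>x\<in>#image_mset lead \<Lambda>. lin_poly h x)"
  define m where "m = (\<Sum>x\<in>#image_mset lead \<Lambda>. min h (real (fst x)))"
  have h0: "h > 0" using M w by (simp add: h)
  have "ipoly h (U * (\<Prod>a\<in>#\<Lambda>. YY - fps_const a)) (0 + m) ([:c2 U 0 0:] * P)"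
    unfolding P_def m_def by (intro ipoly_mult ipoly_const ipoly_prod_lead h0 \<Lambda>)
  then have I: "ipoly h (pw M D) m (smult (c2 U 0 0) P)" by (simp add: D)
  have mm: "m = \<mu> * real M / w1" using M w by (simp add: \<mu> m_def)
  have wt: "real (M * i) + h * real j = (w1 * real i + w2 * real j) * (real M / w1)" for i j
    using w by (simp add: h field_simps)
  have pos: "real M / w1 > 0" using M w by simp
  have c: "c2 D i j = c2 (pw M D) (M * i) j" for i j using M by (simp add: c2_pw)
  show "c2 D i j = 0" if "w1 * real i + w2 * real j < \<mu>"
  proof -
    have "real (M * i) + h * real j < m"
      unfolding wt mm using mult_strict_right_mono[OF that pos] by simp
    then show ?thesis unfolding c by (rule ipolyD(1)[OF I])
  qed
  show "c2 D i j = c2 U 0 0 * coeff (\<Prod>x\<in>#image_mset lead \<Lambda>. lin_poly h x) j" if "w1 * real i + w2 * real j = \<mu>"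
  proof -
    have "real (M * i) + h * real j = m" unfolding wt mm that by simp
    then show ?thesis unfolding c using ipolyD(2)[OF I] by (simp add: P_def)
  qed
  have "lin_poly h (lead a) \<noteq> 0" if "a \<in># \<Lambda>" for a
    using \<Lambda>[OF that] by (intro lin_poly_nonzero) (simp add: lead_def)
  then have "P \<noteq> 0" by (auto simp: P_def prod_mset_zero_iff)
  then obtain j where j: "coeff (smult (c2 U 0 0) P) j \<noteq> 0"
    using U by (auto simp: poly_eq_iff unit2_iff)
  from ipolyD(3)[OF I this] obtain i' where i': "real i' + h * real j = m" by blast
  then have nz: "c2 (pw M D) i' j \<noteq> 0" using ipolyD(2)[OF I] j by metis
  then have "M dvd i'" using M by (auto simp: c2_pw split: if_splits)
  then obtain i where i: "i' = M * i" by (elim dvdE)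
  have "(w1 * real i + w2 * real j) * (real M / w1) = \<mu> * (real M / w1)"
    using i' unfolding i wt mm by simp
  then have "w1 * real i + w2 * real j = \<mu>" using M w by simp
  moreover have "c2 D i j \<noteq> 0" using nz by (simp add: i c)
  ultimately show "\<exists>i j. w1 * real i + w2 * real j = \<mu> \<and> c2 D i j \<noteq> 0" by blast
qed

section \<open>Compact edges described by supporting weights\<close>

text \<open>Lying on a compact edge, expressed through the support only; strict positivity of both
  weights stands for compactness, and the second support point for dimension 1.\<close>

definition edge_point :: "cps2 \<Rightarrow> nat \<Rightarrow> nat \<Rightarrow> bool" where
  "edge_point g i j \<longleftrightarrow> (\<exists>w1 w2 :: real. w1 > 0 \<and> w2 > 0 \<and>
     (\<forall>k l. coeff2 g k l \<noteq> 0 \<longrightarrow> w1 * real i + w2 * real j \<le> w1 * real k + w2 * real l) \<and>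
     (\<exists>k l. coeff2 g k l \<noteq> 0 \<and> (k, l) \<noteq> (i, j) \<and> w1 * real k + w2 * real l = w1 * real i + w2 * real j))"

definition supp_pts :: "cps2 \<Rightarrow> (real \<times> real) set" where
  "supp_pts g = {(real i, real j) | i j. coeff2 g i j \<noteq> 0}"

lemma newton_diagram_upward:
  assumes "z \<in> newton_diagram g" "s \<ge> 0" "t \<ge> 0"
  shows "z + (s, t) \<in> newton_diagram g"
proof -
  let ?G = "{(real i + s, real j + t) | i j s t. coeff2 g i j \<noteq> 0 \<and> 0 \<le> s \<and> 0 \<le> t}"
  have "(\<lambda>x. (s, t) + x) ` ?G \<subseteq> ?G"
  proof (rule image_subsetI)
    fix x assume "x \<in> ?G"
    then obtain i j s' t' where x: "x = (real i + s', real j + t')" "coeff2 g i j \<noteq> 0" "0 \<le> s'" "0 \<le> t'"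
      by blast
    then have "(s, t) + x = (real i + (s + s'), real j + (t + t'))" "0 \<le> s + s'" "0 \<le> t + t'"
      using assms by simp_all
    with x(2) show "(s, t) + x \<in> ?G" by blast
  qed
  then have "convex hull ((\<lambda>x. (s, t) + x) ` ?G) \<subseteq> newton_diagram g"
    unfolding newton_diagram_def by (rule hull_mono)
  moreover have "(s, t) + z \<in> convex hull ((\<lambda>x. (s, t) + x) ` ?G)"
    using assms(1) unfolding convex_hull_translation newton_diagram_def by (rule imageI)
  ultimately show ?thesis by (auto simp: add.commute)
qed

lemma supp_pts_subset: "supp_pts g \<subseteq> newton_diagram g"
  unfolding newton_diagram_def supp_pts_def
  by (rule subset_trans[OF _ hull_subset]) (force intro: exI[of _ "0 :: real"])

lemma newton_face:
  assumes w: "w1 > 0" "w2 > 0"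
    and ge: "\<And>k l. coeff2 g k l \<noteq> 0 \<Longrightarrow> m \<le> w1 * real k + w2 * real l"
  shows "newton_diagram g \<inter> {x. (w1, w2) \<bullet> x = m} = convex hull (supp_pts g \<inter> {x. (w1, w2) \<bullet> x = m})"
    and "\<And>x. x \<in> newton_diagram g \<Longrightarrow> m \<le> (w1, w2) \<bullet> x"
proof -
  let ?T = "supp_pts g \<inter> {x. (w1, w2) \<bullet> x = m}"
  have hullT: "convex hull ?T \<subseteq> {x. (w1, w2) \<bullet> x = m}"
    by (rule hull_minimal) (auto simp: convex_hyperplane)
  \<comment> \<open>C is convex and contains all generators of the diagram, because a nonzero upward
    displacement strictly increases a positive weight. Hence it contains the diagram, which
    identifies the face.\<close>
  define C where "C = {x. m < (w1, w2) \<bullet> x} \<union> convex hull ?T"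
  have C_ge: "m \<le> (w1, w2) \<bullet> x" if "x \<in> C" for x using that hullT by (auto simp: C_def)
  have "convex C"
  proof (rule convexI)
    fix x y and u v :: real assume xy: "x \<in> C" "y \<in> C" and uv: "0 \<le> u" "0 \<le> v" "u + v = 1"
    show "u *\<^sub>R x + v *\<^sub>R y \<in> C"
    proof (cases "x \<in> convex hull ?T \<and> y \<in> convex hull ?T")
      case True
      then have "u *\<^sub>R x + v *\<^sub>R y \<in> convex hull ?T"
        using uv by (intro convexD[OF convex_convex_hull]) auto
      then show ?thesis by (simp add: C_def)
    next
      case False
      show ?thesis
      proof (cases "u = 0 \<or> v = 0")
        case True
        then show ?thesis using xy uv by auto
      next
        case nz: False
        have "m < (w1, w2) \<bullet> x \<or> m < (w1, w2) \<bullet> y" using False xy by (auto simp: C_def)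
        then have "u * m + v * m < u * ((w1, w2) \<bullet> x) + v * ((w1, w2) \<bullet> y)"
          using C_ge[OF xy(1)] C_ge[OF xy(2)] nz uv
          by (auto intro: add_less_le_mono add_le_less_mono mult_left_mono mult_strict_left_mono)
        moreover have "u * m + v * m = m" using uv by (simp flip: distrib_right)
        ultimately have "m < (w1, w2) \<bullet> (u *\<^sub>R x + v *\<^sub>R y)"
          by (simp only: inner_add_right inner_scaleR_right)
        then show ?thesis by (simp add: C_def)
      qed
    qed
  qed
  have sub: "newton_diagram g \<subseteq> C"
    unfolding newton_diagram_def
  proof (rule hull_minimal[where S = convex, OF _ \<open>convex C\<close>], clarify)
    fix i j and s t :: real assume *: "coeff2 g i j \<noteq> 0" "0 \<le> s" "0 \<le> t"
    have e: "(w1, w2) \<bullet> (real i + s, real j + t) = (w1 * real i + w2 * real j) + (w1 * s + w2 * t)"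
      by (simp add: algebra_simps)
    show "(real i + s, real j + t) \<in> C"
    proof (cases "s = 0 \<and> t = 0 \<and> w1 * real i + w2 * real j = m")
      case True
      then have "(real i + s, real j + t) \<in> ?T" using * by (auto simp: supp_pts_def)
      then show ?thesis unfolding C_def by (intro UnI2 hull_inc)
    next
      case False
      have "m \<le> w1 * real i + w2 * real j" using ge * by blast
      have "0 \<le> w1 * s" "0 \<le> w2 * t" using * w by auto
      have pos: "w1 * s + w2 * t > 0" if "s \<noteq> 0 \<or> t \<noteq> 0"
      proof -
        have "0 < w1 * s \<or> 0 < w2 * t" using that * w by auto
        then show ?thesis using \<open>0 \<le> w1 * s\<close> \<open>0 \<le> w2 * t\<close> by linarith
      qed
      have "m < (w1, w2) \<bullet> (real i + s, real j + t)"
      proof (cases "s = 0 \<and> t = 0")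
        case True
        then show ?thesis unfolding e using False \<open>m \<le> w1 * real i + w2 * real j\<close> by simp
      next
        case False
        then have "w1 * s + w2 * t > 0" using pos by blast
        then show ?thesis unfolding e using \<open>m \<le> w1 * real i + w2 * real j\<close> by linarith
      qed
      then show ?thesis by (simp add: C_def)
    qed
  qed
  show "m \<le> (w1, w2) \<bullet> x" if "x \<in> newton_diagram g" for x using sub C_ge that by blast
  have "convex hull ?T \<subseteq> newton_diagram g"
  proof (rule hull_minimal)
    show "?T \<subseteq> newton_diagram g" using supp_pts_subset by blast
    show "convex (newton_diagram g)" by (simp add: newton_diagram_def)
  qed
  then show "newton_diagram g \<inter> {x. (w1, w2) \<bullet> x = m} = convex hull ?T"
    using sub hullT by (auto simp: C_def)
qed

lemma on_compact_edge_iff: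
  assumes ij: "coeff2 g i j \<noteq> 0"
  shows "on_compact_edge g i j \<longleftrightarrow> edge_point g i j"
proof
  let ?N = "newton_diagram g" and ?z = "(real i, real j)"
  have convN: "convex ?N" by (simp add: newton_diagram_def)
  have zS: "?z \<in> supp_pts g" using ij by (auto simp: supp_pts_def)
  then have zN: "?z \<in> ?N" using supp_pts_subset by blast
  {
    assume "edge_point g i j"
    then obtain w1 w2 k l where w: "w1 > 0" "w2 > 0"
      and ge: "\<And>k l. coeff2 g k l \<noteq> 0 \<Longrightarrow> w1 * real i + w2 * real j \<le> w1 * real k + w2 * real l"
      and kl: "coeff2 g k l \<noteq> 0" "(k, l) \<noteq> (i, j)" "w1 * real k + w2 * real l = w1 * real i + w2 * real j"
      unfolding edge_point_def by blast
    define m where "m = w1 * real i + w2 * real j"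
    define T where "T = supp_pts g \<inter> {x. (w1, w2) \<bullet> x = m}"
    define e where "e = ?N \<inter> {x. (w1, w2) \<bullet> x = m}"
    note face = newton_face[where g = g, OF w ge, folded m_def, folded T_def e_def]
    have "e face_of ?N"
      unfolding e_def by (rule face_of_Int_supporting_hyperplane_ge[OF convN face(2)])
    \<comment> \<open>Positive weights leave only finitely many lattice points on the line, so the
      face is the hull of a finite set and thus compact.\<close>
    have "T \<subseteq> (\<lambda>(a, b). (real a, real b)) ` ({..nat \<lceil>m / w1\<rceil>} \<times> {..nat \<lceil>m / w2\<rceil>})"
    proof
      fix x assume "x \<in> T"
      then obtain a b where ab: "x = (real a, real b)" "w1 * real a + w2 * real b = m"
        by (auto simp: T_def supp_pts_def)
      have "w1 * real a \<le> m" "w2 * real b \<le> m" using ab(2) w by (auto simp flip: ab(2))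
      then have "real a \<le> m / w1" "real b \<le> m / w2" using w by (simp_all add: field_simps)
      then have "a \<le> nat \<lceil>m / w1\<rceil>" "b \<le> nat \<lceil>m / w2\<rceil>" by linarith+
      then show "x \<in> (\<lambda>(a, b). (real a, real b)) ` ({..nat \<lceil>m / w1\<rceil>} \<times> {..nat \<lceil>m / w2\<rceil>})"
        using ab(1) by auto
    qed
    then have "finite T" by (rule finite_subset) auto
    then have "compact e" using face(1) by (simp add: finite_imp_compact_convex_hull)
    have pts: "?z \<in> e" "(real k, real l) \<in> e" "?z \<noteq> (real k, real l)"
      using zN kl supp_pts_subset[of g] by (auto simp: e_def m_def supp_pts_def)
    have "aff_dim e \<le> aff_dim {x. (w1, w2) \<bullet> x = m}"
      unfolding e_def by (rule aff_dim_subset) auto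
    also have "\<dots> = 1" using w by (subst aff_dim_hyperplane) (simp_all add: zero_prod_def)
    finally have "aff_dim e \<le> 1" .
    have "aff_dim {?z, (real k, real l)} \<le> aff_dim e" using pts by (intro aff_dim_subset) auto
    moreover have "aff_dim {?z, (real k, real l)} = 1" using pts(3) by (subst aff_dim_2) (simp del: prod.inject)
    ultimately have "1 \<le> aff_dim e" by simp
    with \<open>aff_dim e \<le> 1\<close> have "e edge_of ?N" using \<open>e face_of ?N\<close> by (simp add: edge_of_def)
    then show "on_compact_edge g i j" unfolding on_compact_edge_def using \<open>compact e\<close> pts(1) by blast
  }
  assume "on_compact_edge g i j"
  then obtain e where e: "e face_of ?N" "aff_dim e = 1" "compact e" "?z \<in> e"
    unfolding on_compact_edge_def edge_of_def by blast
  have unbounded: "\<not> bounded X"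
    if X: "x \<in> X" "\<And>t. t \<ge> 0 \<Longrightarrow> x + t *\<^sub>R v \<in> X" "v \<noteq> 0" for X and x v :: "real \<times> real"
  proof
    assume "bounded X"
    then obtain B where B: "\<And>y. y \<in> X \<Longrightarrow> norm y \<le> B" unfolding bounded_iff by blast
    define t where "t = (\<bar>B\<bar> + norm x + 1) / norm v"
    have "t \<ge> 0" by (simp add: t_def)
    have "norm (t *\<^sub>R v) = \<bar>B\<bar> + norm x + 1" using X(3) by (simp add: t_def)
    moreover have "norm (t *\<^sub>R v) \<le> norm (x + t *\<^sub>R v) + norm x"
      using norm_triangle_ineq4[of "x + t *\<^sub>R v" x] by simp
    ultimately show False using B[OF X(2)[OF \<open>t \<ge> 0\<close>]] by linarith
  qed
  have up: "x + t *\<^sub>R (1, 0) \<in> ?N" "x + t *\<^sub>R (0, 1) \<in> ?N" if "x \<in> ?N" "t \<ge> 0" for x t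
    using newton_diagram_upward[OF that(1), of t 0] newton_diagram_upward[OF that(1), of 0 t] that(2) by auto
  have "e \<noteq> ?N"
  proof
    assume "e = ?N"
    then have "bounded ?N" using e(3) compact_imp_bounded by blast
    moreover have "\<not> bounded ?N" by (rule unbounded[OF zN up(1)[OF zN]]) (auto simp: zero_prod_def)
    ultimately show False by blast
  qed
  have "convex e" using e(1) by (rule face_of_imp_convex)
  \<comment> \<open>A supporting line at a relative interior point of e cuts out a face that
    contains e, and it equals e because both have dimension 1.\<close>
  then obtain z where z: "z \<in> rel_interior e" using e(4) rel_interior_eq_empty by blast
  then have ze: "z \<in> e" using rel_interior_subset by blast
  have zN': "z \<in> ?N" using ze face_of_imp_subset[OF e(1)] by blast
  have znr: "z \<notin> rel_interior ?N" using face_of_disjoint_rel_interior[OF e(1) \<open>e \<noteq> ?N\<close>] ze by blast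
  obtain a where a: "a \<noteq> 0" "\<And>y. y \<in> ?N \<Longrightarrow> a \<bullet> z \<le> a \<bullet> y"
    by (rule supporting_hyperplane_rel_boundary[OF convN zN' znr]) (rule that)
  define F where "F = ?N \<inter> {x. a \<bullet> x = a \<bullet> z}"
  have F: "F face_of ?N" unfolding F_def by (rule face_of_Int_supporting_hyperplane_ge[OF convN a(2)])
  have "z \<in> F" using zN' by (simp add: F_def)
  have "e \<subseteq> F"
    using z \<open>z \<in> F\<close> by (intro subset_of_face_of[OF F face_of_imp_subset[OF e(1)]]) (auto simp: disjnt_def)
  have "aff_dim F \<le> aff_dim {x. a \<bullet> x = a \<bullet> z}" unfolding F_def by (rule aff_dim_subset) auto
  also have "\<dots> = 1" using a(1) by (simp add: aff_dim_hyperplane)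
  finally have dimF: "aff_dim F \<le> 1" .
  have "e face_of F" using face_of_subset[OF e(1) \<open>e \<subseteq> F\<close>] face_of_imp_subset[OF F] by blast
  then have eF: "e = F"
    using face_of_aff_dim_lt[OF face_of_imp_convex[OF F], of e] dimF e(2) by linarith
  obtain w1 w2 where aw: "a = (w1, w2)" by (cases a)
  \<comment> \<open>Upward closure of the diagram makes the weights nonnegative; a zero weight would
    put a ray into the bounded edge.\<close>
  have w1: "w1 \<ge> 0" using a(2)[OF up(1)[OF zN', of 1]] by (simp add: aw inner_add_right)
  have w2: "w2 \<ge> 0" using a(2)[OF up(2)[OF zN', of 1]] by (simp add: aw inner_add_right)
  have bF: "bounded F" using e(3) eF compact_imp_bounded by blast
  have "w1 \<noteq> 0"
  proof
    assume "w1 = 0"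
    then have "z + t *\<^sub>R (1, 0) \<in> F" if "t \<ge> 0" for t
      using up(1)[OF zN' that] by (simp add: F_def aw inner_add_right)
    from unbounded[OF \<open>z \<in> F\<close> this] bF show False by (simp add: zero_prod_def)
  qed
  have "w2 \<noteq> 0"
  proof
    assume "w2 = 0"
    then have "z + t *\<^sub>R (0, 1) \<in> F" if "t \<ge> 0" for t
      using up(2)[OF zN' that] by (simp add: F_def aw inner_add_right)
    from unbounded[OF \<open>z \<in> F\<close> this] bF show False by (simp add: zero_prod_def)
  qed
  have w: "w1 > 0" "w2 > 0" using w1 w2 \<open>w1 \<noteq> 0\<close> \<open>w2 \<noteq> 0\<close> by auto
  have "?z \<in> F" using e(4) eF by simp
  then have zm: "a \<bullet> z = w1 * real i + w2 * real j" by (simp add: F_def aw)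
  have ge: "w1 * real i + w2 * real j \<le> w1 * real k + w2 * real l" if "coeff2 g k l \<noteq> 0" for k l
  proof -
    have "(real k, real l) \<in> ?N" using that supp_pts_subset[of g] by (auto simp: supp_pts_def)
    from a(2)[OF this] show ?thesis unfolding zm by (simp add: aw)
  qed
  define T where "T = supp_pts g \<inter> {x. (w1, w2) \<bullet> x = w1 * real i + w2 * real j}"
  have FT: "F = convex hull T"
    unfolding F_def zm unfolding aw T_def by (rule newton_face(1)[OF w ge])
  have "T \<noteq> {?z}"
  proof
    assume "T = {?z}"
    then have "aff_dim F = 0" by (simp add: FT)
    then show False using e(2) eF by simp
  qed
  moreover have "?z \<in> T" using zS by (simp add: T_def)
  ultimately obtain y where y: "y \<in> T" "y \<noteq> ?z" by blast
  then obtain k l where "y = (real k, real l)" "coeff2 g k l \<noteq> 0" "w1 * real k + w2 * real l = w1 * real i + w2 * real j"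
    by (auto simp: T_def supp_pts_def)
  with y(2) have "coeff2 g k l \<noteq> 0 \<and> (k, l) \<noteq> (i, j) \<and> w1 * real k + w2 * real l = w1 * real i + w2 * real j" by auto
  then show "edge_point g i j" unfolding edge_point_def using w ge by blast
qed

section \<open>From weighted initial forms to initial Newton polynomials\<close>

text \<open>A weight supporting an edge of g must take its minimum \<mu> on it, so both points of
  the edge lie in the support of g' as well. It is applied in both directions, with a ratio and its
  inverse.\<close>

lemma edge_point_transfer:
  assumes cmp: "\<And>w1 w2 :: real. w1 > 0 \<Longrightarrow> w2 > 0 \<Longrightarrow> \<exists>\<mu>.
      (\<forall>i j. w1 * real i + w2 * real j < \<mu> \<longrightarrow> coeff2 g i j = 0 \<and> coeff2 g' i j = 0) \<and>
      (\<exists>i j. w1 * real i + w2 * real j = \<mu> \<and> coeff2 g i j \<noteq> 0) \<and>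
      (\<forall>i j. w1 * real i + w2 * real j = \<mu> \<longrightarrow> coeff2 g i j = r j * coeff2 g' i j)"
    and g: "coeff2 g i j \<noteq> 0" "edge_point g i j"
  shows "edge_point g' i j \<and> coeff2 g i j = r j * coeff2 g' i j"
proof -
  obtain w1 w2 k l where w: "w1 > 0" "w2 > 0"
    and ge: "\<And>k l. coeff2 g k l \<noteq> 0 \<Longrightarrow> w1 * real i + w2 * real j \<le> w1 * real k + w2 * real l"
    and kl: "coeff2 g k l \<noteq> 0" "(k, l) \<noteq> (i, j)" "w1 * real k + w2 * real l = w1 * real i + w2 * real j"
    using g(2) unfolding edge_point_def by blast
  obtain \<mu> a b where lt: "\<And>i j. w1 * real i + w2 * real j < \<mu> \<Longrightarrow> coeff2 g i j = 0 \<and> coeff2 g' i j = 0"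
    and ab: "w1 * real a + w2 * real b = \<mu>" "coeff2 g a b \<noteq> 0"
    and eq: "\<And>i j. w1 * real i + w2 * real j = \<mu> \<Longrightarrow> coeff2 g i j = r j * coeff2 g' i j"
    using cmp[OF w] by blast
  have \<mu>: "w1 * real i + w2 * real j = \<mu>"
    using ge[OF ab(2)] ab(1) lt[of i j] g(1) by fastforce
  have "coeff2 g' k l \<noteq> 0" using eq[of k l] kl \<mu> by auto
  moreover have "w1 * real i + w2 * real j \<le> w1 * real k + w2 * real l" if "coeff2 g' k l \<noteq> 0" for k l
    using lt[of k l] that \<mu> by fastforce
  ultimately have "edge_point g' i j" unfolding edge_point_def using w kl(2,3) by blast
  then show ?thesis using eq[OF \<mu>] by blast
qed

lemma coeff2_initial_newton_polynomial:
  "coeff2 (initial_newton_polynomial g) i j = (if coeff2 g i j \<noteq> 0 \<and> edge_point g i j then coeff2 g i j else 0)"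
proof -
  have "coeff2 (initial_newton_polynomial g) i j = (if on_compact_edge g i j then coeff2 g i j else 0)"
    by (simp add: initial_newton_polynomial_def coeff2_def restrict_supp.rep_eq)
  then show ?thesis using on_compact_edge_iff[of g i j] by auto
qed

lemma XX_not_dvd_prod_linear: "\<not> XX dvd (\<Prod>\<gamma>\<in>#\<Gamma>. YY - fps_const \<gamma>)" if "\<And>\<gamma>. \<gamma> \<in># \<Gamma> \<Longrightarrow> fps_nth \<gamma> 0 = 0"
proof -
  have "x0 (\<Prod>\<gamma>\<in>#\<Gamma>. YY - fps_const \<gamma>) \<noteq> 0"
  proof (induction \<Gamma>)
    case empty
    have "fps_nth (x0 1) 0 \<noteq> 0" by (simp add: x0_def c2_1)
    then have "x0 1 \<noteq> 0" by (metis fps_zero_nth)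
    then show ?case by simp
  next
    case (add \<gamma> \<Gamma>)
    have "fps_nth (x0 (YY - fps_const \<gamma>)) 1 \<noteq> 0" by (simp add: x0_def c2_YY c2_const_series)
    then have "x0 (YY - fps_const \<gamma>) \<noteq> 0" by (metis fps_zero_nth)
    with add show ?case by (simp add: x0_mult)
  qed
  then show ?thesis by (simp add: x0_eq_0_iff)
qed

lemma unit_not_XX_dvd: "U dvd 1 \<Longrightarrow> XX dvd U * F \<Longrightarrow> XX dvd F"
proof -
  assume "U dvd 1" "XX dvd U * F"
  then obtain V where "1 = U * V" by (elim dvdE)
  then have "F = V * (U * F)" by (metis mult.assoc mult.commute mult_1)
  with \<open>XX dvd U * F\<close> show "XX dvd F" by (metis dvd_mult)
qed

theorem theorem6p2:
  fixes f l u1 D1 D2 :: cps2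
  assumes "singular_germ f" and "squarefree f"
    and "smooth_germ l" and "\<not> branch_of l f"
    and "u1 dvd 1"
    and "is_discriminant l f D1" and "is_discriminant l (u1 * f) D2"
  shows "equal_up_to_rescaling (initial_newton_polynomial D1) (initial_newton_polynomial D2)"
proof -
  obtain v where v: "1 = u1 * v" using assms(5) by (elim dvdE)
  have fv: "f = v * (u1 * f)" using v by (metis mult.assoc mult.commute mult_1)
  have f0: "coeff2 f 0 0 = 0" using assms(1) by (simp add: singular_germ_def)
  then have uf0: "coeff2 (u1 * f) 0 0 = 0" by (simp add: coeff2_c2)
  have dvd_uf: "x dvd f" if "x dvd u1 * f" for x using that fv by (metis dvd_mult)
  have sqf': "squarefree (u1 * f)"
    unfolding squarefree_def
  proof (intro allI impI)
    fix x assume "x\<^sup>2 dvd u1 * f"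
    then have "x\<^sup>2 dvd f" by (rule dvd_uf)
    then show "x dvd 1" using assms(2) by (simp add: squarefree_def)
  qed
  have nb': "\<not> branch_of l (u1 * f)" using assms(4) dvd_uf by (auto simp: branch_of_def)
  have "nonunit2 (fps2_of l)" "c2 (fps2_of l) 1 0 \<noteq> 0 \<or> c2 (fps2_of l) 0 1 \<noteq> 0"
    using assms(3) by (simp_all add: smooth_germ_def nonunit2_def coeff2_c2)
  from straight_exists[OF this] obtain m A B \<kappa>0 where st: "straight (fps2_of l) m A B" and \<kappa>0: "\<kappa>0 dvd 1"
    and jac: "\<And>F. dy (subst F A B) = \<kappa>0 * subst (pol (fps2_of l) F) A B" by metis
  have nu: "nonunit2 A" "nonunit2 B" using st by (auto simp: straight_def)
  define F W where "F = subst (fps2_of f) A B" and "W = subst (fps2_of u1) A B"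
  have WF: "subst (fps2_of (u1 * f)) A B = W * F" using nu by (simp add: F_def W_def subst_mult)
  obtain n1 where n1: "n1 > 0" "\<And>M. M > 0 \<Longrightarrow> n1 dvd M \<Longrightarrow> \<exists>\<Gamma>. splits F M (dy F) (fps2_of D1) \<Gamma>"
    using discriminant_splits[OF f0 assms(2,3,4) st \<kappa>0 jac assms(6)] unfolding F_def by metis
  obtain n2 where n2: "n2 > 0" "\<And>M. M > 0 \<Longrightarrow> n2 dvd M \<Longrightarrow> \<exists>\<Gamma>. splits (W * F) M (dy (W * F)) (fps2_of D2) \<Gamma>"
    using discriminant_splits[OF uf0 sqf' assms(3) nb' st \<kappa>0 jac assms(7)] unfolding WF by metis
  \<comment> \<open>A common multiple makes both splittings available after the same base
    change.\<close>
  define M where "M = n1 * n2"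
  have M: "M > 0" using n1(1) n2(1) by (simp add: M_def)
  obtain \<Gamma> where "splits F M (dy F) (fps2_of D1) \<Gamma>" using n1(2)[OF M] by (auto simp: M_def)
  then obtain U U1 where \<Gamma>: "\<And>\<gamma>. \<gamma> \<in># \<Gamma> \<Longrightarrow> fps_nth \<gamma> 0 = 0 \<and> eval2 (pw M F) fps_X \<gamma> \<noteq> 0"
    and U: "U dvd 1" "dy (pw M F) = U * (\<Prod>\<gamma>\<in>#\<Gamma>. YY - fps_const \<gamma>)"
    and U1: "U1 dvd 1" "pw M (fps2_of D1) = U1 * (\<Prod>\<gamma>\<in>#\<Gamma>. YY - fps_const (eval2 (pw M F) fps_X \<gamma>))"
    unfolding splits_def dy_pw[OF M] by blast
  obtain \<Gamma>' where "splits (W * F) M (dy (W * F)) (fps2_of D2) \<Gamma>'" using n2(2)[OF M] by (auto simp: M_def)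
  then obtain U' U2 where \<Gamma>': "\<And>\<gamma>. \<gamma> \<in># \<Gamma>' \<Longrightarrow> fps_nth \<gamma> 0 = 0 \<and> eval2 (pw M W * pw M F) fps_X \<gamma> \<noteq> 0"
    and U': "U' dvd 1" "dy (pw M W * pw M F) = U' * (\<Prod>\<gamma>\<in>#\<Gamma>'. YY - fps_const \<gamma>)"
    and U2: "U2 dvd 1" "pw M (fps2_of D2) = U2 * (\<Prod>\<gamma>\<in>#\<Gamma>'. YY - fps_const (eval2 (pw M W * pw M F) fps_X \<gamma>))"
    unfolding splits_def pw_hom(1)[OF M, symmetric] dy_pw[OF M] by blast
  have F00: "c2 (pw M F) 0 0 = 0" using M f0 nu by (simp add: F_def coeff2_c2)
  \<comment> \<open>If x divided the base-changed F, it would divide its y-derivative and hence a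
    product of factors y - \<gamma>, which is nonzero at x = 0.\<close>
  have XF: "\<not> XX dvd pw M F"
  proof
    assume "XX dvd pw M F"
    then have "XX dvd dy (pw M F)" by (simp add: XX_dvd_iff c2_dy)
    then have "XX dvd (\<Prod>\<gamma>\<in>#\<Gamma>. YY - fps_const \<gamma>)" unfolding U(2) by (rule unit_not_XX_dvd[OF U(1)])
    then show False using XX_not_dvd_prod_linear[of \<Gamma>] \<Gamma> by blast
  qed
  define \<kappa> where "\<kappa> = c2 (pw M W) 0 0"
  have \<kappa>: "\<kappa> \<noteq> 0" using assms(5) M nu by (simp add: \<kappa>_def W_def unit_cps2_iff)
  then have Wu: "pw M W dvd 1" by (simp add: unit2_iff \<kappa>_def)
  define \<Lambda> \<Lambda>' where "\<Lambda> = image_mset (eval2 (pw M F) fps_X) \<Gamma>"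
    and "\<Lambda>' = image_mset (eval2 (pw M W * pw M F) fps_X) \<Gamma>'"
  define N where "N = image_mset lead \<Lambda>"
  have N': "image_mset lead \<Lambda>' = image_mset (map_prod id ((*) \<kappa>)) N"
    using lead_critical_values[OF F00 XF Wu U \<Gamma> U' \<Gamma>']
    by (simp add: N_def \<Lambda>_def \<Lambda>'_def \<kappa>_def image_mset.compositionality comp_def)
  have D1: "pw M (fps2_of D1) = U1 * (\<Prod>a\<in>#\<Lambda>. YY - fps_const a)" "0 \<notin># \<Lambda>"
    using U1(2) \<Gamma> by (auto simp: \<Lambda>_def image_mset.compositionality comp_def)
  have D2: "pw M (fps2_of D2) = U2 * (\<Prod>a\<in>#\<Lambda>'. YY - fps_const a)" "0 \<notin># \<Lambda>'"
    using U2(2) \<Gamma>' by (auto simp: \<Lambda>'_def image_mset.compositionality comp_def)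
  \<comment> \<open>The quotient of the constant terms of the two units, corrected by one factor
    \<kappa> for each critical value in the substitution v \<mapsto> \<kappa> v.\<close>
  define c where "c = c2 U1 0 0 / (c2 U2 0 0 * \<kappa> ^ size N)"
  have u12: "c2 U1 0 0 \<noteq> 0" "c2 U2 0 0 \<noteq> 0" using U1 U2 by (simp_all add: unit2_iff)
  then have c: "c \<noteq> 0" using \<kappa> by (simp add: c_def)
  have cmp: "\<exists>\<mu>. (\<forall>i j. w1 * real i + w2 * real j < \<mu> \<longrightarrow> coeff2 D1 i j = 0 \<and> coeff2 D2 i j = 0) \<and>
      (\<exists>i j. w1 * real i + w2 * real j = \<mu> \<and> coeff2 D1 i j \<noteq> 0) \<and>
      (\<exists>i j. w1 * real i + w2 * real j = \<mu> \<and> coeff2 D2 i j \<noteq> 0) \<and>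
      (\<forall>i j. w1 * real i + w2 * real j = \<mu> \<longrightarrow> coeff2 D1 i j = c * \<kappa> ^ j * coeff2 D2 i j)"
    if w: "w1 > 0" "w2 > 0" for w1 w2 :: real
  proof -
    define h where "h = w2 * real M / w1"
    define \<mu> where "\<mu> = (\<Sum>x\<in>#image_mset lead \<Lambda>. min h (real (fst x))) * w1 / real M"
    have \<mu>': "\<mu> = (\<Sum>x\<in>#image_mset lead \<Lambda>'. min h (real (fst x))) * w1 / real M"
      unfolding \<mu>_def N' N_def[symmetric] by (simp add: image_mset.compositionality comp_def)
    note I1 = initial_form[OF M w U1(1) D1 h_def \<mu>_def, folded coeff2_c2]
    note I2 = initial_form[OF M w U2(1) D2 h_def \<mu>', folded coeff2_c2]
    have I3: "coeff2 D1 i j = c * \<kappa> ^ j * coeff2 D2 i j" if ij: "w1 * real i + w2 * real j = \<mu>" for i j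
    proof -
      define P where "P = (\<Prod>x\<in>#N. lin_poly h x)"
      have "\<kappa> ^ j * coeff (\<Prod>x\<in>#image_mset lead \<Lambda>'. lin_poly h x) j = \<kappa> ^ size N * coeff P j"
        unfolding N' P_def using arg_cong[OF prod_lin_poly_scale[OF \<kappa>, of h N], of "\<lambda>p. coeff p j"]
        by (simp add: coeff_pcompose_linear)
      then have "c * \<kappa> ^ j * coeff2 D2 i j = c * c2 U2 0 0 * (\<kappa> ^ size N * coeff P j)"
        unfolding I2(2)[OF ij] by (simp add: mult_ac)
      also have "\<dots> = coeff2 D1 i j"
        unfolding I1(2)[OF ij] using u12 \<kappa> by (simp add: c_def P_def N_def)
      finally show ?thesis ..
    qed
    show ?thesis
    proof (rule exI[of _ \<mu>], intro conjI)
      show "\<forall>i j. w1 * real i + w2 * real j < \<mu> \<longrightarrow> coeff2 D1 i j = 0 \<and> coeff2 D2 i j = 0"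
        using I1(1) I2(1) by simp
      show "\<forall>i j. w1 * real i + w2 * real j = \<mu> \<longrightarrow> coeff2 D1 i j = c * \<kappa> ^ j * coeff2 D2 i j"
        using I3 by simp
    qed (rule I1(3), rule I2(3))
  qed
  have t1: "edge_point D2 i j \<and> coeff2 D1 i j = c * \<kappa> ^ j * coeff2 D2 i j"
    if "coeff2 D1 i j \<noteq> 0" "edge_point D1 i j" for i j
  proof (rule edge_point_transfer[where r = "\<lambda>j. c * \<kappa> ^ j", OF _ that])
    fix w1 w2 :: real assume "w1 > 0" "w2 > 0"
    from cmp[OF this] show "\<exists>\<mu>. (\<forall>i j. w1 * real i + w2 * real j < \<mu> \<longrightarrow> coeff2 D1 i j = 0 \<and> coeff2 D2 i j = 0) \<and>
      (\<exists>i j. w1 * real i + w2 * real j = \<mu> \<and> coeff2 D1 i j \<noteq> 0) \<and>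
      (\<forall>i j. w1 * real i + w2 * real j = \<mu> \<longrightarrow> coeff2 D1 i j = c * \<kappa> ^ j * coeff2 D2 i j)"
      by (elim ex_forward conjE) (intro conjI)
  qed
  have t2: "edge_point D1 i j \<and> coeff2 D2 i j = (1 / (c * \<kappa> ^ j)) * coeff2 D1 i j"
    if "coeff2 D2 i j \<noteq> 0" "edge_point D2 i j" for i j
  proof (rule edge_point_transfer[where r = "\<lambda>j. 1 / (c * \<kappa> ^ j)", OF _ that])
    fix w1 w2 :: real assume w: "w1 > 0" "w2 > 0"
    have swap: "coeff2 D1 i j = c * \<kappa> ^ j * coeff2 D2 i j \<longleftrightarrow> coeff2 D2 i j = 1 / (c * \<kappa> ^ j) * coeff2 D1 i j" for i j
      using c \<kappa> by (auto simp: field_simps)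
    have comm: "(coeff2 D1 i j = 0 \<and> coeff2 D2 i j = 0) \<longleftrightarrow> (coeff2 D2 i j = 0 \<and> coeff2 D1 i j = 0)" for i j
      by (rule conj_commute)
    from cmp[OF w, unfolded swap comm] show "\<exists>\<mu>. (\<forall>i j. w1 * real i + w2 * real j < \<mu> \<longrightarrow> coeff2 D2 i j = 0 \<and> coeff2 D1 i j = 0) \<and>
      (\<exists>i j. w1 * real i + w2 * real j = \<mu> \<and> coeff2 D2 i j \<noteq> 0) \<and>
      (\<forall>i j. w1 * real i + w2 * real j = \<mu> \<longrightarrow> coeff2 D2 i j = 1 / (c * \<kappa> ^ j) * coeff2 D1 i j)"
      by (elim ex_forward conjE) (intro conjI)
  qed
  have "coeff2 (initial_newton_polynomial D1) i j
      = c * (coeff2 (initial_newton_polynomial D2) i j * 1 ^ i * \<kappa> ^ j)" for i j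
  proof (cases "coeff2 D1 i j \<noteq> 0 \<and> edge_point D1 i j")
    case True
    then have "edge_point D2 i j" "coeff2 D1 i j = c * \<kappa> ^ j * coeff2 D2 i j" using t1 by auto
    with True show ?thesis by (simp add: coeff2_initial_newton_polynomial)
  next
    case False
    then have "\<not> (coeff2 D2 i j \<noteq> 0 \<and> edge_point D2 i j)" using t2[of i j] by auto
    with False show ?thesis by (auto simp: coeff2_initial_newton_polynomial)
  qed
  then show ?thesis unfolding equal_up_to_rescaling_def using c \<kappa> by (intro exI[of _ 1] exI[of _ \<kappa>] exI[of _ c]) simp
qed

end
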